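(* (1) For every power circuit $(\Pi,\delta)$ with a marking $M$ there is a $(0,+,-,2^x)$-circuit $\mathcal{C}$ with $\mathrm{eval}(\mathcal{C})=\varepsilon(M)$ such that - $|\mathcal{C}|\leq 2|\sigma(\delta)|+3|\Pi|+1$, - $\mathrm{depth}(\mathcal{C})\leq(\mathrm{depth}(\Pi)+2)\cdot(\lceil\log_2|\Pi|\rceil+2)$, and - $\mathrm{depth}_{2^x}(\mathcal{C})=\mathrm{depth}(\Pi)+1$. Moreover, $\mathcal{C}$ can be computed from $(\Pi,\delta)$ and $M$ in $\mathsf{TC}^0$. (2) Conversely, for every $(0,+,-,2^x)$-circuit $\mathcal{C}$ there is a generalized power circuit $(\Pi,\delta)$ with a marking $M$ such that $\mathrm{eval}(\mathcal{C})=\varepsilon(M)$ and - $\mathrm{depth}(\Pi)\leq\mathrm{depth}_{2^x}(\mathcal{C})$, and - $|\Pi|\leq|\mathcal{C}|^2+|\mathcal{C}|$. Moreover, $(\Pi,\delta)$ and $M$ can be computed from $\mathcal{C}$ in $\mathsf{NC}^2$. If the input of every $2^x$-gate of $\mathcal{C}$ is non-negative, then $(\Pi,\delta)$ is, indeed, a power circuit, i.e. all its nodes evaluate to positive integers.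
   Context: Power circuits. Let $\Gamma$ be a finite set and $\delta\colon\Gamma\times\Gamma\to\{-1,0,1\}$ such that the directed graph on $\Gamma$ with edge set $\sigma(\delta)=\{(P,Q):\delta(P,Q)\neq 0\}$ is acyclic (a dag). A marking on $\Gamma$ is a map $M\colon\Gamma\to\{-1,0,1\}$. The successor marking of $P\in\Gamma$ is $\Lambda_P\colon Q\mapsto\delta(P,Q)$. The evaluation is defined bottom-up in the dag by $\varepsilon(P)=2^{\varepsilon(\Lambda_P)}\in\mathbb{R}$ for nodes and $\varepsilon(M)=\sum_{P}M(P)\varepsilon(P)$ for markings (the empty sum is $0$). We call any such $(\Gamma,\delta)$ a generalized power circuit; it is a power circuit if every node evaluates to an element of $\{2^n:n\in\mathbb{N}\}$. Size is $|\Gamma|$; $\mathrm{depth}(\Gamma)$ is the number of edges of a longest path in the dag. A $(0,+,-,2^x)$-circuit is a dag in which each node is a $0$-gate (a constant; no inputs), a $+$-gate (two inputs), a $-$-gate (one input, negation) or a $2^x$-gate (one input), with one designated output gate. $\mathrm{eval}(\mathcal{C})\in\mathbb{R}$ is the value of the output gate, defined in the obvious way. $|\mathcal{C}|$ is the number of gates, $\mathrm{depth}(\mathcal{C})$ is the length of a longest path, and $\mathrm{depth}_{2^x}(\mathcal{C})$ is the maximal number of $2^x$-gates on any path in the circuit. $\mathsf{TC}^0$: functions computed by (non-uniform) polynomial-size, constant-depth circuits with unbounded fan-in And, Or, Not and Majority gates. $\mathsf{NC}^2$: functions computed by polynomial-size, $O(\log^2 n)$-depth Boolean circuits of bounded fan-in.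 *)

theory Defs
  imports Complex_Main "HOL-Library.Landau_Symbols"
begin

section \<open>Paths in finite dags\<close>

definition dag_path :: "'v set \<Rightarrow> ('v \<times> 'v) set \<Rightarrow> 'v list \<Rightarrow> bool" where
  "dag_path V E p \<longleftrightarrow> p \<noteq> [] \<and> set p \<subseteq> V \<and> successively (\<lambda>x y. (x, y) \<in> E) p"

text \<open>The number of edges of a longest path. On \<^typ>\<open>nat\<close>, the supremum of a nonempty finite set
  is its maximum, and the supremum of the empty set is 0, so the empty dag has depth 0.\<close>

definition dag_depth :: "'v set \<Rightarrow> ('v \<times> 'v) set \<Rightarrow> nat" where
  "dag_depth V E = Sup {length p - 1 | p. dag_path V E p}"


section \<open>Power circuits\<close>

definition marking :: "'a set \<Rightarrow> ('a \<Rightarrow> int) \<Rightarrow> bool" where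
  "marking \<Gamma> M \<longleftrightarrow> (\<forall>P\<in>\<Gamma>. M P \<in> {-1, 0, 1})"

definition pc_edges :: "'a set \<Rightarrow> ('a \<Rightarrow> 'a \<Rightarrow> int) \<Rightarrow> ('a \<times> 'a) set" where
  "pc_edges \<Gamma> \<delta> = {(P, Q). P \<in> \<Gamma> \<and> Q \<in> \<Gamma> \<and> \<delta> P Q \<noteq> 0}"

definition succ_marking :: "('a \<Rightarrow> 'a \<Rightarrow> int) \<Rightarrow> 'a \<Rightarrow> 'a \<Rightarrow> int" where
  "succ_marking \<delta> P = (\<lambda>Q. \<delta> P Q)"

definition generalized_power_circuit :: "'a set \<Rightarrow> ('a \<Rightarrow> 'a \<Rightarrow> int) \<Rightarrow> bool" where
  "generalized_power_circuit \<Gamma> \<delta> \<longleftrightarrow>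
     finite \<Gamma> \<and> (\<forall>P\<in>\<Gamma>. marking \<Gamma> (succ_marking \<delta> P)) \<and> acyclic (pc_edges \<Gamma> \<delta>)"

text \<open>Evaluation by recursion along the edges of the dag; the recursion equation is
  \<open>node_eval_eq\<close> below.\<close>

definition node_eval :: "'a set \<Rightarrow> ('a \<Rightarrow> 'a \<Rightarrow> int) \<Rightarrow> 'a \<Rightarrow> real" where
  "node_eval \<Gamma> \<delta> = wfrec ((pc_edges \<Gamma> \<delta>)\<inverse>)
     (\<lambda>f P. 2 powr (\<Sum>Q\<in>\<Gamma>. of_int (succ_marking \<delta> P Q) * f Q))"

definition marking_eval :: "'a set \<Rightarrow> ('a \<Rightarrow> 'a \<Rightarrow> int) \<Rightarrow> ('a \<Rightarrow> int) \<Rightarrow> real" where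
  "marking_eval \<Gamma> \<delta> M = (\<Sum>P\<in>\<Gamma>. of_int (M P) * node_eval \<Gamma> \<delta> P)"

definition power_circuit :: "'a set \<Rightarrow> ('a \<Rightarrow> 'a \<Rightarrow> int) \<Rightarrow> bool" where
  "power_circuit \<Gamma> \<delta> \<longleftrightarrow>
     generalized_power_circuit \<Gamma> \<delta> \<and> (\<forall>P\<in>\<Gamma>. \<exists>n::nat. node_eval \<Gamma> \<delta> P = 2 ^ n)"

definition pc_depth :: "'a set \<Rightarrow> ('a \<Rightarrow> 'a \<Rightarrow> int) \<Rightarrow> nat" where
  "pc_depth \<Gamma> \<delta> = dag_depth \<Gamma> (pc_edges \<Gamma> \<delta>)"

lemma node_eval_eq:
  assumes "generalized_power_circuit \<Gamma> \<delta>" and "P \<in> \<Gamma>"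
  shows "node_eval \<Gamma> \<delta> P = 2 powr marking_eval \<Gamma> \<delta> (succ_marking \<delta> P)"
proof -
  let ?R = "(pc_edges \<Gamma> \<delta>)\<inverse>"
  have "finite (pc_edges \<Gamma> \<delta>)"
    by (rule finite_subset[of _ "\<Gamma> \<times> \<Gamma>"])
       (use assms(1) in \<open>auto simp: pc_edges_def generalized_power_circuit_def\<close>)
  hence wf: "wf ?R"
    using assms(1) by (auto intro: finite_acyclic_wf_converse simp: generalized_power_circuit_def)
  have "of_int (\<delta> P Q) * cut (node_eval \<Gamma> \<delta>) ?R P Q = of_int (\<delta> P Q) * node_eval \<Gamma> \<delta> Q"
    if "Q \<in> \<Gamma>" for Q
    using that assms(2) by (cases "\<delta> P Q = 0") (auto simp: cut_def pc_edges_def)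
  hence "(\<Sum>Q\<in>\<Gamma>. of_int (\<delta> P Q) * cut (node_eval \<Gamma> \<delta>) ?R P Q) =
      (\<Sum>Q\<in>\<Gamma>. of_int (\<delta> P Q) * node_eval \<Gamma> \<delta> Q)"
    by (rule sum.cong[OF refl])
  thus ?thesis
    by (subst def_wfrec[OF eq_reflection[OF node_eval_def] wf])
       (simp add: marking_eval_def succ_marking_def)
qed


section \<open>Circuits over 0, +, - and powers of two\<close>

datatype 'g gate_op = Zero_Gate | Plus_Gate 'g 'g | Minus_Gate 'g | Exp2_Gate 'g

fun gate_inputs :: "'g gate_op \<Rightarrow> 'g list" where
  "gate_inputs Zero_Gate = []"
| "gate_inputs (Plus_Gate g h) = [g, h]"
| "gate_inputs (Minus_Gate g) = [g]"
| "gate_inputs (Exp2_Gate g) = [g]"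

fun is_exp2_gate :: "'g gate_op \<Rightarrow> bool" where
  "is_exp2_gate (Exp2_Gate g) = True"
| "is_exp2_gate _ = False"

record 'g circuit =
  gates :: "'g set"
  gate_op :: "'g \<Rightarrow> 'g gate_op"
  out_gate :: 'g

definition circuit_edges :: "'g circuit \<Rightarrow> ('g \<times> 'g) set" where
  "circuit_edges C = {(g, h). g \<in> gates C \<and> h \<in> set (gate_inputs (gate_op C g))}"

definition circuit :: "'g circuit \<Rightarrow> bool" where
  "circuit C \<longleftrightarrow> finite (gates C) \<and> out_gate C \<in> gates C \<and>
     (\<forall>g\<in>gates C. set (gate_inputs (gate_op C g)) \<subseteq> gates C) \<and> acyclic (circuit_edges C)"

text \<open>The recursion equation is \<open>gate_eval_eq\<close> below.\<close>

definition gate_eval :: "'g circuit \<Rightarrow> 'g \<Rightarrow> real" where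
  "gate_eval C = wfrec ((circuit_edges C)\<inverse>)
     (\<lambda>f g. case gate_op C g of
              Zero_Gate \<Rightarrow> 0
            | Plus_Gate h k \<Rightarrow> f h + f k
            | Minus_Gate h \<Rightarrow> - f h
            | Exp2_Gate h \<Rightarrow> 2 powr f h)"

definition circuit_eval :: "'g circuit \<Rightarrow> real" where
  "circuit_eval C = gate_eval C (out_gate C)"

definition circuit_size :: "'g circuit \<Rightarrow> nat" where
  "circuit_size C = card (gates C)"

definition circuit_depth :: "'g circuit \<Rightarrow> nat" where
  "circuit_depth C = dag_depth (gates C) (circuit_edges C)"

definition circuit_depth_exp2 :: "'g circuit \<Rightarrow> nat" where
  "circuit_depth_exp2 C =
     Sup {length (filter (\<lambda>g. is_exp2_gate (gate_op C g)) p) | p.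
            dag_path (gates C) (circuit_edges C) p}"

lemma gate_eval_eq:
  assumes "circuit C" and "g \<in> gates C"
  shows "gate_eval C g = (case gate_op C g of
              Zero_Gate \<Rightarrow> 0
            | Plus_Gate h k \<Rightarrow> gate_eval C h + gate_eval C k
            | Minus_Gate h \<Rightarrow> - gate_eval C h
            | Exp2_Gate h \<Rightarrow> 2 powr gate_eval C h)"
proof -
  have "finite (circuit_edges C)"
    by (rule finite_subset[of _ "gates C \<times> gates C"])
       (use assms(1) in \<open>auto simp: circuit_edges_def circuit_def\<close>)
  hence wf: "wf ((circuit_edges C)\<inverse>)"
    using assms(1) by (auto intro: finite_acyclic_wf_converse simp: circuit_def)
  show ?thesis
    by (subst def_wfrec[OF eq_reflection[OF gate_eval_def] wf])
       (use assms(2) in \<open>auto simp: cut_def circuit_edges_def split: gate_op.split\<close>)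
qed


section \<open>Encoding by bit strings\<close>

text \<open>
  A Boolean circuit has a fixed number of input and output wires, so the encodings below consist of
  a list of slots, each of which holds an element of the encoded structure or is inactive
  (\<^term>\<open>None\<close>). The length of an encoding depends on the number of slots only. Every finite set has
  an enumeration without inactive slots.
\<close>

definition enumerates :: "'a option list \<Rightarrow> 'a set \<Rightarrow> bool" where
  "enumerates xs V \<longleftrightarrow>
     distinct (filter (\<lambda>x. x \<noteq> None) xs) \<and> set (filter (\<lambda>x. x \<noteq> None) xs) = Some ` V"

lemma enumerates_exists: "finite V \<Longrightarrow> \<exists>xs. None \<notin> set xs \<and> enumerates xs V"
proof -
  assume "finite V"
  then obtain vs where "set vs = V" "distinct vs"
    using finite_distinct_list by blast
  thus ?thesis
    by (intro exI[of _ "map Some vs"]) (auto simp: enumerates_def filter_map comp_def distinct_map)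
qed

definition encode_sign :: "int \<Rightarrow> bool list" where
  "encode_sign i = [i \<noteq> 0, i < 0]"

text \<open>For every slot: an activity bit, the value of the marking, and the row of the matrix \<open>\<delta>\<close>;
  \<open>n\<close> slots yield \<open>n (2 n + 3)\<close> bits.\<close>

definition encode_pc :: "'a option list \<Rightarrow> ('a \<Rightarrow> 'a \<Rightarrow> int) \<Rightarrow> ('a \<Rightarrow> int) \<Rightarrow> bool list" where
  "encode_pc xs \<delta> M = concat (map
     (\<lambda>x. case x of
            None \<Rightarrow> replicate (2 * length xs + 3) False
          | Some P \<Rightarrow> True # encode_sign (M P) @
              concat (map (\<lambda>y. encode_sign (case y of None \<Rightarrow> 0 | Some Q \<Rightarrow> \<delta> P Q)) xs)) xs)"

text \<open>For every slot: an activity bit, a bit marking the output gate, two bits for the kind of the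
  gate, and for each of the at most two inputs the characteristic vector of its slot (all zero if
  there is no such input); \<open>n\<close> slots yield \<open>n (2 n + 4)\<close> bits.\<close>

definition unit_vector :: "'g option list \<Rightarrow> 'g \<Rightarrow> bool list" where
  "unit_vector xs g = map (\<lambda>y. y = Some g) xs"

definition zero_vector :: "'g option list \<Rightarrow> bool list" where
  "zero_vector xs = replicate (length xs) False"

fun encode_gate_op :: "'g option list \<Rightarrow> 'g gate_op \<Rightarrow> bool list" where
  "encode_gate_op xs Zero_Gate = [False, False] @ zero_vector xs @ zero_vector xs"
| "encode_gate_op xs (Plus_Gate g h) = [False, True] @ unit_vector xs g @ unit_vector xs h"
| "encode_gate_op xs (Minus_Gate g) = [True, False] @ unit_vector xs g @ zero_vector xs"
| "encode_gate_op xs (Exp2_Gate g) = [True, True] @ unit_vector xs g @ zero_vector xs"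

definition encode_circuit :: "'g option list \<Rightarrow> 'g circuit \<Rightarrow> bool list" where
  "encode_circuit xs C = concat (map
     (\<lambda>x. case x of
            None \<Rightarrow> replicate (2 * length xs + 4) False
          | Some g \<Rightarrow> True # (g = out_gate C) # encode_gate_op xs (gate_op C g)) xs)"


section \<open>Boolean circuits, TC0 and NC2\<close>

text \<open>Boolean circuits are given by a topologically sorted list of gates, in which a gate refers to
  earlier gates by their position, and the list of the positions of the output gates.\<close>

datatype bgate =
    Input_BGate nat
  | Not_BGate nat
  | And_BGate "nat list"
  | Or_BGate "nat list"
  | Maj_BGate "nat list"

type_synonym bcircuit = "bgate list \<times> nat list"

fun bgate_args :: "bgate \<Rightarrow> nat list" where
  "bgate_args (Input_BGate i) = []"
| "bgate_args (Not_BGate j) = [j]"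
| "bgate_args (And_BGate js) = js"
| "bgate_args (Or_BGate js) = js"
| "bgate_args (Maj_BGate js) = js"

definition wf_bcircuit :: "nat \<Rightarrow> bcircuit \<Rightarrow> bool" where
  "wf_bcircuit n B \<longleftrightarrow>
     (\<forall>i. Input_BGate i \<in> set (fst B) \<longrightarrow> i < n) \<and>
     (\<forall>k<length (fst B). \<forall>j\<in>set (bgate_args (fst B ! k)). j < k) \<and>
     (\<forall>j\<in>set (snd B). j < length (fst B))"

text \<open>Here \<open>w\<close> is the input and \<open>vs\<close> is the list of the values of all earlier gates. A majority gate
  checks whether more than half of its inputs are true.\<close>

fun bgate_eval :: "bool list \<Rightarrow> bool list \<Rightarrow> bgate \<Rightarrow> bool" where
  "bgate_eval w vs (Input_BGate i) = w ! i"
| "bgate_eval w vs (Not_BGate j) = (\<not> vs ! j)"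
| "bgate_eval w vs (And_BGate js) = (\<forall>j\<in>set js. vs ! j)"
| "bgate_eval w vs (Or_BGate js) = (\<exists>j\<in>set js. vs ! j)"
| "bgate_eval w vs (Maj_BGate js) = (length js < 2 * length (filter (\<lambda>j. vs ! j) js))"

definition bcircuit_eval :: "bcircuit \<Rightarrow> bool list \<Rightarrow> bool list" where
  "bcircuit_eval B w =
     (let vs = foldl (\<lambda>vs g. vs @ [bgate_eval w vs g]) [] (fst B) in map (\<lambda>j. vs ! j) (snd B))"

fun bgate_depth :: "nat list \<Rightarrow> bgate \<Rightarrow> nat" where
  "bgate_depth ds (Input_BGate i) = 0"
| "bgate_depth ds g = Suc (Max (insert 0 ((\<lambda>j. ds ! j) ` set (bgate_args g))))"

definition bcircuit_depth :: "bcircuit \<Rightarrow> nat" where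
  "bcircuit_depth B = Max (insert 0 (set (foldl (\<lambda>ds g. ds @ [bgate_depth ds g]) [] (fst B))))"

text \<open>The size counts gates, wires and outputs. Counting the wires matters because a gate may use
  the same wire repeatedly.\<close>

definition bcircuit_size :: "bcircuit \<Rightarrow> nat" where
  "bcircuit_size B = (\<Sum>g\<leftarrow>fst B. 1 + length (bgate_args g)) + length (snd B)"

fun bounded_fanin_gate :: "bgate \<Rightarrow> bool" where
  "bounded_fanin_gate (Maj_BGate js) = False"
| "bounded_fanin_gate g = (length (bgate_args g) \<le> 2)"

text \<open>A non-uniform family has one circuit for every input length.\<close>

definition computed_by_poly_family :: "(nat \<Rightarrow> bcircuit) \<Rightarrow> (bool list \<Rightarrow> bool list) \<Rightarrow> bool" where
  "computed_by_poly_family B F \<longleftrightarrow>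
     (\<forall>n. wf_bcircuit n (B n)) \<and>
     (\<forall>w. bcircuit_eval (B (length w)) w = F w) \<and>
     (\<exists>k::nat. (\<lambda>n. real (bcircuit_size (B n))) \<in> O(\<lambda>n. real n ^ k))"

definition in_TC0 :: "(bool list \<Rightarrow> bool list) \<Rightarrow> bool" where
  "in_TC0 F \<longleftrightarrow> (\<exists>B. computed_by_poly_family B F \<and> (\<exists>d. \<forall>n. bcircuit_depth (B n) \<le> d))"

definition in_NC2 :: "(bool list \<Rightarrow> bool list) \<Rightarrow> bool" where
  "in_NC2 F \<longleftrightarrow> (\<exists>B. computed_by_poly_family B F \<and>
     (\<forall>n. \<forall>g\<in>set (fst (B n)). bounded_fanin_gate g) \<and>
     (\<lambda>n. real (bcircuit_depth (B n))) \<in> O(\<lambda>n. (log 2 (real n))\<^sup>2))"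

end

theory Submission
  imports Defs "HOL-Library.Discrete_Functions" "HOL-Library.Countable"
begin

text \<open>
  From power circuits to circuits: every node becomes a \<open>2\<^sup>x\<close>-gate and a \<open>-\<close>-gate, and the
  successor marking of a node with \<open>k\<close> successors is summed up by a heap-shaped tree of \<open>k - 1\<close>
  \<open>+\<close>-gates. The \<open>j\<close>-th leaf of the tree is the \<open>j\<close>-th successor, so the wiring is determined by
  counting successors, which majority gates do in constant depth.

  From circuits to power circuits: every gate is an integer combination of \<open>2\<^sup>x\<close>-gates. The
  coefficients are signed path counts, hence entries of a power of an integer matrix \<open>A\<close> with
  \<open>n\<close> rows. They are computed modulo \<open>2 ^ n\<close> by \<open>O(log n)\<close> squarings, each of which takes depth
  \<open>O(log n)\<close> by a tree of carry-save adders and a final carry lookahead. A signed binary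
  expansion of the coefficients turns the combinations into markings on nodes that represent the
  products of \<open>2\<^sup>x\<close>-gates with powers of two.
\<close>

section \<open>Compiling layered formulas to Boolean circuits\<close>

text \<open>Two obstacles shape the proof. A Boolean circuit has a fixed number of outputs, but the
  number of gates or nodes to be produced depends on the input. So every gate or node that can occur
  at all has a slot of its own, an activity formula decides whether the slot is used, and all output
  bits of the slot are conjoined with that formula. Moreover, Boolean circuits are compiled from
  formulas, which are trees: depth \<open>d\<close> with fan-in \<open>f\<close> costs
  \<open>(2 * f + 1) ^ d\<close>. This is polynomial for constant depth and polynomial fan-in, and
  for logarithmic depth and fan-in 2, but not for the depth of all squarings together. Intermediate
  results are therefore kept in registers, so that sizes and depths of successive steps merely add
  up. The count \<open>N ^ 2 + N\<close> comes from a bound on the coefficients. A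
  \<open>+\<close>-gate at most doubles the bound of its inputs, so absolute coefficients of a gate
  of height \<open>h\<close> sum to at most \<open>2 ^ h\<close>, and for \<open>N\<close> gates
  \<open>N\<close> signed digits per \<open>2\<^sup>x\<close>-gate suffice. The other
  \<open>N\<close> nodes have value 1 and provide the factors \<open>2 ^ i\<close>.\<close>

definition bgate_values :: "bool list \<Rightarrow> bgate list \<Rightarrow> bool list" where
  "bgate_values w gs = foldl (\<lambda>vs g. vs @ [bgate_eval w vs g]) [] gs"

definition bgate_depths :: "bgate list \<Rightarrow> nat list" where
  "bgate_depths gs = foldl (\<lambda>ds g. ds @ [bgate_depth ds g]) [] gs"

definition bgates_size :: "bgate list \<Rightarrow> nat" where
  "bgates_size gs = (\<Sum>g\<leftarrow>gs. 1 + length (bgate_args g))"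

lemma bgate_values_simps [simp]:
  "bgate_values w [] = []"
  "bgate_values w (gs @ [g]) = bgate_values w gs @ [bgate_eval w (bgate_values w gs) g]"
  by (simp_all add: bgate_values_def)

lemma bgate_depths_simps [simp]:
  "bgate_depths [] = []"
  "bgate_depths (gs @ [g]) = bgate_depths gs @ [bgate_depth (bgate_depths gs) g]"
  by (simp_all add: bgate_depths_def)

lemma length_bgate_values [simp]: "length (bgate_values w gs) = length gs"
  by (induction gs rule: rev_induct) auto

lemma length_bgate_depths [simp]: "length (bgate_depths gs) = length gs"
  by (induction gs rule: rev_induct) auto

lemma bgate_values_append_nth:
  "j < length gs \<Longrightarrow> bgate_values w (gs @ hs) ! j = bgate_values w gs ! j"
  by (induction hs rule: rev_induct) (auto simp: nth_append simp flip: append_assoc)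

lemma bgate_depths_append_nth:
  "j < length gs \<Longrightarrow> bgate_depths (gs @ hs) ! j = bgate_depths gs ! j"
  by (induction hs rule: rev_induct) (auto simp: nth_append simp flip: append_assoc)

lemma bgates_size_simps [simp]:
  "bgates_size [] = 0" "bgates_size (gs @ hs) = bgates_size gs + bgates_size hs"
  "bgates_size (g # gs) = 1 + length (bgate_args g) + bgates_size gs"
  by (simp_all add: bgates_size_def)

section \<open>Invariants of growing gate lists\<close>

fun is_maj :: "bgate \<Rightarrow> bool" where
  "is_maj (Maj_BGate js) = True"
| "is_maj _ = False"

text \<open>One invariant serves both circuit classes: \<open>n\<close> is the input length,
  \<open>f\<close> bounds the fan-in, \<open>b\<close> permits majority gates, and \<open>D\<close>
  bounds the depth of every gate.\<close>

definition wf_bgates :: "nat \<Rightarrow> nat \<Rightarrow> bool \<Rightarrow> nat \<Rightarrow> bgate list \<Rightarrow> bool" where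
  "wf_bgates n f b D gs \<longleftrightarrow>
     (\<forall>i. Input_BGate i \<in> set gs \<longrightarrow> i < n) \<and>
     (\<forall>k<length gs. \<forall>j\<in>set (bgate_args (gs ! k)). j < k) \<and>
     (\<forall>g\<in>set gs. length (bgate_args g) \<le> f \<and> (is_maj g \<longrightarrow> b)) \<and>
     (\<forall>d\<in>set (bgate_depths gs). d \<le> D)"

text \<open>The depth bound concerns the single position \<open>j\<close>. Gates are appended in the
  order of compilation, so a late gate may be shallow, and a new gate must not inherit the depth of
  the whole list.\<close>

definition computed_at :: "nat \<Rightarrow> bgate list \<Rightarrow> nat \<Rightarrow> (bool list \<Rightarrow> bool) \<Rightarrow> nat \<Rightarrow> bool" where
  "computed_at n gs D p j \<longleftrightarrow>
     j < length gs \<and> (\<forall>w. length w = n \<longrightarrow> bgate_values w gs ! j = p w) \<and>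
     bgate_depths gs ! j \<le> D"

definition available :: "nat \<Rightarrow> bgate list \<Rightarrow> nat \<Rightarrow> (bool list \<Rightarrow> bool) \<Rightarrow> bool" where
  "available n gs D p \<longleftrightarrow> (\<exists>j. computed_at n gs D p j)"

lemma computed_at_append: "computed_at n gs D p j \<Longrightarrow> computed_at n (gs @ hs) D p j"
  by (auto simp: computed_at_def bgate_values_append_nth bgate_depths_append_nth)

lemma available_append: "available n gs D p \<Longrightarrow> available n (gs @ hs) D p"
  by (auto simp: available_def intro: computed_at_append)

lemma available_mono: "available n gs D p \<Longrightarrow> D \<le> D' \<Longrightarrow> available n gs D' p"
  by (auto simp: available_def computed_at_def intro: le_trans)

lemma wf_bgates_snoc:
  assumes "wf_bgates n f b E gs" and "\<forall>j\<in>set (bgate_args g). j < length gs"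
    and "length (bgate_args g) \<le> f" and "is_maj g \<longrightarrow> b" and "\<And>i. g = Input_BGate i \<Longrightarrow> i < n"
    and "bgate_depth (bgate_depths gs) g \<le> E"
  shows "wf_bgates n f b E (gs @ [g])"
  using assms unfolding wf_bgates_def by (auto simp: nth_append less_Suc_eq)

section \<open>Formulas over inputs and registers, and their compilation\<close>

datatype 'r form =
    Inp nat
  | Reg 'r
  | Neg "'r form"
  | Conj "'r form list"
  | Disj "'r form list"
  | Maj "'r form list"

text \<open>Inputs beyond the end of the input list read as \<^term>\<open>False\<close>, so that no side conditions on
  the input positions arise.\<close>

fun form_eval :: "bool list \<Rightarrow> ('r \<Rightarrow> bool) \<Rightarrow> 'r form \<Rightarrow> bool" where
  "form_eval w e (Inp i) = (i < length w \<and> w ! i)"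
| "form_eval w e (Reg r) = e r"
| "form_eval w e (Neg \<phi>) = (\<not> form_eval w e \<phi>)"
| "form_eval w e (Conj \<phi>s) = (\<forall>\<phi>\<in>set \<phi>s. form_eval w e \<phi>)"
| "form_eval w e (Disj \<phi>s) = (\<exists>\<phi>\<in>set \<phi>s. form_eval w e \<phi>)"
| "form_eval w e (Maj \<phi>s) = (length \<phi>s < 2 * length (filter (form_eval w e) \<phi>s))"

fun form_bound :: "nat \<Rightarrow> bool \<Rightarrow> nat \<Rightarrow> 'r form \<Rightarrow> bool" where
  "form_bound f b d (Inp i) = True"
| "form_bound f b d (Reg r) = True"
| "form_bound f b d (Neg \<phi>) = (d > 0 \<and> form_bound f b (d - 1) \<phi>)"
| "form_bound f b d (Conj \<phi>s) =
     (length \<phi>s \<le> f \<and> d > 0 \<and> (\<forall>\<phi>\<in>set \<phi>s. form_bound f b (d - 1) \<phi>))"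
| "form_bound f b d (Disj \<phi>s) =
     (length \<phi>s \<le> f \<and> d > 0 \<and> (\<forall>\<phi>\<in>set \<phi>s. form_bound f b (d - 1) \<phi>))"
| "form_bound f b d (Maj \<phi>s) =
     (b \<and> length \<phi>s \<le> f \<and> d > 0 \<and> (\<forall>\<phi>\<in>set \<phi>s. form_bound f b (d - 1) \<phi>))"

lemma form_bound_mono: "form_bound f b d \<phi> \<Longrightarrow> d \<le> d' \<Longrightarrow> form_bound f b d' \<phi>"
proof (induction \<phi> arbitrary: b d d')
  case (Neg \<phi>)
  show ?case using Neg.prems by (auto intro!: Neg.IH[of _ "d - Suc 0" "d' - Suc 0"])
next
  case (Conj \<phi>s)
  show ?case using Conj.prems by (auto intro!: Conj.IH[of _ _ "d - Suc 0" "d' - Suc 0"])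
next
  case (Disj \<phi>s)
  show ?case using Disj.prems by (auto intro!: Disj.IH[of _ _ "d - Suc 0" "d' - Suc 0"])
next
  case (Maj \<phi>s)
  show ?case using Maj.prems by (auto intro!: Maj.IH[of _ _ "d - Suc 0" "d' - Suc 0"])
qed auto

definition env_available :: "nat \<Rightarrow> bgate list \<Rightarrow> nat \<Rightarrow> (bool list \<Rightarrow> 'r \<Rightarrow> bool) \<Rightarrow> bool" where
  "env_available n gs D e \<longleftrightarrow>
     (\<forall>r. available n gs D (\<lambda>w. e w r)) \<and> (\<forall>i. available n gs D (\<lambda>w. i < length w \<and> w ! i))"

lemma env_available_append: "env_available n gs D e \<Longrightarrow> env_available n (gs @ hs) D e"
  by (auto simp: env_available_def intro: available_append)

text \<open>\<open>D\<close> is the depth at which inputs and registers are available, and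
  \<open>E\<close> caps the depth of the whole list and stays fixed while \<open>D\<close> grows.
  The factor \<open>2 * f + 1\<close> per level pays for \<open>f\<close> subformulas,
  \<open>f\<close> wires and one gate.\<close>

definition compilable ::
  "nat \<Rightarrow> nat \<Rightarrow> bool \<Rightarrow> nat \<Rightarrow> nat \<Rightarrow> (bool list \<Rightarrow> 'r \<Rightarrow> bool) \<Rightarrow> nat \<Rightarrow> 'r form \<Rightarrow> bool" where
  "compilable n f b E D e d \<phi> \<longleftrightarrow>
     (\<forall>gs. wf_bgates n f b E gs \<longrightarrow> env_available n gs D e \<longrightarrow>
        (\<exists>hs. wf_bgates n f b E (gs @ hs) \<and>
              available n (gs @ hs) (D + d) (\<lambda>w. form_eval w (e w) \<phi>) \<and>
              bgates_size hs \<le> (2 * f + 1) ^ d))"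

lemma compile_form_list:
  assumes "\<forall>\<phi>\<in>set \<phi>s. compilable n f b E D e d \<phi>"
    and "wf_bgates n f b E gs" and "env_available n gs D e"
  shows "\<exists>hs. wf_bgates n f b E (gs @ hs) \<and>
              (\<forall>\<phi>\<in>set \<phi>s. available n (gs @ hs) (D + d) (\<lambda>w. form_eval w (e w) \<phi>)) \<and>
              bgates_size hs \<le> length \<phi>s * (2 * f + 1) ^ d"
  using assms(1)
proof (induction \<phi>s)
  case Nil
  show ?case by (rule exI[of _ "[]"]) (use assms in auto)
next
  case (Cons \<phi> \<phi>s)
  then obtain hs where hs: "wf_bgates n f b E (gs @ hs)"
    "\<forall>\<phi>\<in>set \<phi>s. available n (gs @ hs) (D + d) (\<lambda>w. form_eval w (e w) \<phi>)"
    "bgates_size hs \<le> length \<phi>s * (2 * f + 1) ^ d"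
    by auto
  have "compilable n f b E D e d \<phi>" using Cons.prems by simp
  with hs(1) env_available_append[OF assms(3), of hs] obtain hs' where hs':
    "wf_bgates n f b E ((gs @ hs) @ hs')"
    "available n ((gs @ hs) @ hs') (D + d) (\<lambda>w. form_eval w (e w) \<phi>)"
    "bgates_size hs' \<le> (2 * f + 1) ^ d"
    unfolding compilable_def by blast
  show ?case
  proof (intro exI[of _ "hs @ hs'"] conjI ballI)
    fix \<psi> assume "\<psi> \<in> set (\<phi> # \<phi>s)"
    thus "available n (gs @ hs @ hs') (D + d) (\<lambda>w. form_eval w (e w) \<psi>)"
      using hs' available_append[of n "gs @ hs" "D + d" _ hs'] hs(2) by auto
  qed (use hs hs' in auto)
qed

lemma available_positions:
  assumes "\<forall>\<phi>\<in>set \<phi>s. available n gs D (p \<phi>)"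
  shows "\<exists>js. length js = length \<phi>s \<and> (\<forall>k<length \<phi>s. computed_at n gs D (p (\<phi>s ! k)) (js ! k))"
proof -
  have "\<forall>k<length \<phi>s. \<exists>j. computed_at n gs D (p (\<phi>s ! k)) j"
    using assms by (auto simp: available_def)
  then obtain J where J: "\<forall>k<length \<phi>s. computed_at n gs D (p (\<phi>s ! k)) (J k)"
    by metis
  show ?thesis
    by (rule exI[of _ "map J [0..<length \<phi>s]"]) (use J in auto)
qed

lemma available_snoc:
  assumes "wf_bgates n f b E gs" and "D + 1 \<le> E" and "length js \<le> f"
    and "\<forall>k<length js. computed_at n gs D (P k) (js ! k)"
    and "bgate_args g = js" and "is_maj g \<longrightarrow> b" and "\<And>i. g \<noteq> Input_BGate i"
    and "\<And>w. length w = n \<Longrightarrow> bgate_eval w (bgate_values w gs) g = q w"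
  shows "wf_bgates n f b E (gs @ [g]) \<and> available n (gs @ [g]) (D + 1) q"
proof -
  have depth: "bgate_depth (bgate_depths gs) g \<le> D + 1"
  proof -
    have "bgate_depth (bgate_depths gs) g =
        Suc (Max (insert 0 ((\<lambda>j. bgate_depths gs ! j) ` set (bgate_args g))))"
      using assms(7) by (cases g) auto
    moreover have "\<forall>j\<in>set js. bgate_depths gs ! j \<le> D"
      using assms(4) by (auto simp: computed_at_def in_set_conv_nth)
    ultimately show ?thesis using assms(5) by auto
  qed
  have lt: "\<forall>j\<in>set (bgate_args g). j < length gs"
    using assms(4,5) by (auto simp: computed_at_def in_set_conv_nth)
  have "wf_bgates n f b E (gs @ [g])"
    by (rule wf_bgates_snoc) (use assms lt depth in auto)
  moreover have "computed_at n (gs @ [g]) (D + 1) q (length gs)"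
    using assms(8) depth by (auto simp: computed_at_def nth_append)
  ultimately show ?thesis by (auto simp: available_def)
qed

text \<open>The common core of negation, conjunction, disjunction and majority. The gate
  \<open>G js\<close> has to be correct only when the values at the positions \<open>js\<close> are
  those of the formulas \<open>\<phi>s\<close>.\<close>

lemma compile_connective:
  assumes "\<forall>\<phi>\<in>set \<phi>s. compilable n f b E D e d \<phi>" and "length \<phi>s \<le> f" and "D + d + 1 \<le> E"
    and args: "\<And>js. length js = length \<phi>s \<Longrightarrow> bgate_args (G js) = js" and maj: "\<And>js. is_maj (G js) \<longrightarrow> b"
    and inp: "\<And>js i. G js \<noteq> Input_BGate i" 
    and eval: "\<And>w vs js. length js = length \<phi>s \<Longrightarrow>
      map ((!) vs) js = map (form_eval w (e w)) \<phi>s \<Longrightarrow>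
      bgate_eval w vs (G js) = form_eval w (e w) \<psi>"
  shows "compilable n f b E D e (Suc d) \<psi>"
  unfolding compilable_def
proof (intro allI impI)
  fix gs assume gs: "wf_bgates n f b E gs" "env_available n gs D e"
  obtain hs where hs: "wf_bgates n f b E (gs @ hs)"
    "\<forall>\<phi>\<in>set \<phi>s. available n (gs @ hs) (D + d) (\<lambda>w. form_eval w (e w) \<phi>)"
    "bgates_size hs \<le> length \<phi>s * (2 * f + 1) ^ d"
    using compile_form_list[OF assms(1) gs] by blast
  obtain js where js: "length js = length \<phi>s"
    "\<forall>k<length \<phi>s. computed_at n (gs @ hs) (D + d) (\<lambda>w. form_eval w (e w) (\<phi>s ! k)) (js ! k)"
    using available_positions[OF hs(2)] by blast
  have "wf_bgates n f b E ((gs @ hs) @ [G js]) \<and>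
      available n ((gs @ hs) @ [G js]) (D + d + 1) (\<lambda>w. form_eval w (e w) \<psi>)"
  proof (rule available_snoc[where js = js and P = "\<lambda>k w. form_eval w (e w) (\<phi>s ! k)"])
    fix w :: "bool list" assume "length w = n"
    thus "bgate_eval w (bgate_values w (gs @ hs)) (G js) = form_eval w (e w) \<psi>"
      using js by (intro eval) (auto simp: computed_at_def intro!: nth_equalityI)
  qed (use assms hs js in auto)
  moreover have "bgates_size (hs @ [G js]) \<le> (2 * f + 1) ^ Suc d"
  proof -
    let ?c = "(2 * f + 1) ^ d"
    have "bgates_size (hs @ [G js]) \<le> length \<phi>s * ?c + 1 + length \<phi>s"
      using hs(3) args js(1) by simp
    also have "\<dots> \<le> f * ?c + 1 + f"
      using assms(2) by (intro add_mono mult_right_mono) auto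
    also have "\<dots> \<le> f * ?c + ?c + f * ?c"
      by (intro add_mono) auto
    finally show ?thesis by (simp add: algebra_simps)
  qed
  ultimately show "\<exists>hs. wf_bgates n f b E (gs @ hs) \<and>
              available n (gs @ hs) (D + Suc d) (\<lambda>w. form_eval w (e w) \<psi>) \<and>
              bgates_size hs \<le> (2 * f + 1) ^ Suc d"
    by (intro exI[of _ "hs @ [G js]"]) auto
qed

text \<open>Each of the three quantities depends on the Boolean list \<open>map p xs\<close>
  alone.\<close>

lemma map_eq_quantifiers:
  assumes "map p xs = map q ys"
  shows "(\<forall>x\<in>set xs. p x) \<longleftrightarrow> (\<forall>y\<in>set ys. q y)" and "(\<exists>x\<in>set xs. p x) \<longleftrightarrow> (\<exists>y\<in>set ys. q y)"
    and "length (filter p xs) = length (filter q ys)"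
  using arg_cong[OF assms, of "list_all id"] arg_cong[OF assms, of "list_ex id"]
    arg_cong[OF assms, of "\<lambda>bs. length (filter id bs)"]
  by (simp_all add: list_all_iff list_ex_iff filter_map)

lemma compile_form:
  assumes "form_bound f b d \<phi>" and "D + d \<le> E" and "f \<ge> 1"
  shows "compilable n f b E D e d \<phi>"
  using assms(1,2)
proof (induction \<phi> arbitrary: d)
  case (Inp i)
  show ?case unfolding compilable_def
    by (intro allI impI exI[of _ "[]"]) (auto simp: env_available_def intro: available_mono)
next
  case (Reg r)
  show ?case unfolding compilable_def
    by (intro allI impI exI[of _ "[]"]) (auto simp: env_available_def intro: available_mono)
next
  case (Neg \<phi>)
  obtain d' where d: "d = Suc d'"
    using Neg.prems(1) by (cases d) auto
  have "compilable n f b E D e d' \<phi>"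
    by (rule Neg.IH) (use Neg.prems d in auto)
  thus ?case unfolding d
    by (intro compile_connective[where \<phi>s = "[\<phi>]" and G = "\<lambda>js. Not_BGate (hd js)"])
       (use Neg.prems(2) d assms(3) in \<open>auto simp: length_Suc_conv\<close>)
next
  case (Conj \<phi>s)
  obtain d' where d: "d = Suc d'"
    using Conj.prems(1) by (cases d) auto
  have "\<forall>\<phi>\<in>set \<phi>s. compilable n f b E D e d' \<phi>"
  proof
    fix \<phi> assume \<phi>: "\<phi> \<in> set \<phi>s"
    hence "form_bound f b d' \<phi>" using Conj.prems(1) d by simp
    moreover have "D + d' \<le> E" using Conj.prems(2) d by simp
    ultimately show "compilable n f b E D e d' \<phi>" by (rule Conj.IH[OF \<phi>])
  qed
  thus ?case unfolding d
  proof (rule compile_connective[where G = And_BGate])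
    fix w vs js
    assume len: "length js = length \<phi>s" and eq: "map ((!) vs) js = map (form_eval w (e w)) \<phi>s"
    show "bgate_eval w vs (And_BGate js) = form_eval w (e w) (Conj \<phi>s)"
      using map_eq_quantifiers[OF eq] len by simp
  qed (use Conj.prems d in auto)
next
  case (Disj \<phi>s)
  obtain d' where d: "d = Suc d'"
    using Disj.prems(1) by (cases d) auto
  have "\<forall>\<phi>\<in>set \<phi>s. compilable n f b E D e d' \<phi>"
  proof
    fix \<phi> assume \<phi>: "\<phi> \<in> set \<phi>s"
    hence "form_bound f b d' \<phi>" using Disj.prems(1) d by simp
    moreover have "D + d' \<le> E" using Disj.prems(2) d by simp
    ultimately show "compilable n f b E D e d' \<phi>" by (rule Disj.IH[OF \<phi>])
  qed
  thus ?case unfolding d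
  proof (rule compile_connective[where G = Or_BGate])
    fix w vs js
    assume len: "length js = length \<phi>s" and eq: "map ((!) vs) js = map (form_eval w (e w)) \<phi>s"
    show "bgate_eval w vs (Or_BGate js) = form_eval w (e w) (Disj \<phi>s)"
      using map_eq_quantifiers[OF eq] len by simp
  qed (use Disj.prems d in auto)
next
  case (Maj \<phi>s)
  obtain d' where d: "d = Suc d'"
    using Maj.prems(1) by (cases d) auto
  have "\<forall>\<phi>\<in>set \<phi>s. compilable n f b E D e d' \<phi>"
  proof
    fix \<phi> assume \<phi>: "\<phi> \<in> set \<phi>s"
    hence "form_bound f b d' \<phi>"
      using Maj.prems(1) unfolding d form_bound.simps diff_Suc_1 by blast
    moreover have "D + d' \<le> E" using Maj.prems(2) d by simp
    ultimately show "compilable n f b E D e d' \<phi>" by (rule Maj.IH[OF \<phi>])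
  qed
  thus ?case unfolding d
  proof (rule compile_connective[where G = Maj_BGate])
    fix w vs js
    assume len: "length js = length \<phi>s" and eq: "map ((!) vs) js = map (form_eval w (e w)) \<phi>s"
    show "bgate_eval w vs (Maj_BGate js) = form_eval w (e w) (Maj \<phi>s)"
      using map_eq_quantifiers[OF eq] len by simp
  qed (use Maj.prems d in auto)
qed

section \<open>Programs of simultaneous register assignments\<close>

type_synonym 'r step = "'r list \<times> ('r \<Rightarrow> 'r form)"

text \<open>All right-hand sides are evaluated in the old environment \<open>e\<close>, so a step is
  one parallel round.\<close>

definition step_env :: "bool list \<Rightarrow> ('r \<Rightarrow> bool) \<Rightarrow> 'r step \<Rightarrow> 'r \<Rightarrow> bool" where
  "step_env w e st r = (if r \<in> set (fst st) then form_eval w e (snd st r) else e r)"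

definition run :: "bool list \<Rightarrow> 'r step list \<Rightarrow> ('r \<Rightarrow> bool) \<Rightarrow> 'r \<Rightarrow> bool" where
  "run w ps e = foldl (step_env w) e ps"

lemma run_simps [simp]:
  "run w [] e = e" "run w (ps @ qs) e = run w qs (run w ps e)"
  "run w (p # ps) e = run w ps (step_env w e p)"
  by (simp_all add: run_def)

definition step_bound :: "nat \<Rightarrow> bool \<Rightarrow> nat \<Rightarrow> nat \<Rightarrow> 'r step \<Rightarrow> bool" where
  "step_bound f b d q st \<longleftrightarrow> length (fst st) \<le> q \<and> (\<forall>r\<in>set (fst st). form_bound f b d (snd st r))"

text \<open>A register is a gate position to which later steps refer as often as they like. So the
  exponential cost \<open>(2 * f + 1) ^ d\<close> is paid only for the depth of a single
  step.\<close>

lemma compile_steps: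
  assumes "\<forall>st\<in>set ps. step_bound f b d q st" and "D + length ps * d \<le> E" and "f \<ge> 1"
    and "wf_bgates n f b E gs" and "env_available n gs D e"
  shows "\<exists>hs. wf_bgates n f b E (gs @ hs) \<and>
              env_available n (gs @ hs) (D + length ps * d) (\<lambda>w. run w ps (e w)) \<and>
              bgates_size hs \<le> length ps * q * (2 * f + 1) ^ d"
  using assms
proof (induction ps arbitrary: D gs e)
  case Nil
  thus ?case by (intro exI[of _ "[]"]) auto
next
  case (Cons st ps)
  have st: "length (fst st) \<le> q" "\<forall>r\<in>set (fst st). form_bound f b d (snd st r)"
    using Cons.prems(1) by (auto simp: step_bound_def)
  have "\<forall>\<phi>\<in>set (map (snd st) (fst st)). compilable n f b E D e d \<phi>"
    using st Cons.prems by (auto intro!: compile_form)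
  from compile_form_list[OF this Cons.prems(4,5)] obtain hs where hs: 
    "wf_bgates n f b E (gs @ hs)"
    "\<forall>r\<in>set (fst st). available n (gs @ hs) (D + d) (\<lambda>w. form_eval w (e w) (snd st r))"
    "bgates_size hs \<le> length (fst st) * (2 * f + 1) ^ d"
    by auto
  have "env_available n (gs @ hs) (D + d) (\<lambda>w. step_env w (e w) st)"
    unfolding env_available_def
  proof (intro conjI allI)
    fix r
    show "available n (gs @ hs) (D + d) (\<lambda>w. step_env w (e w) st r)"
      using hs(2) env_available_append[OF Cons.prems(5), of hs]
      by (cases "r \<in> set (fst st)") (auto simp: step_env_def env_available_def intro: available_mono)
    fix i
    show "available n (gs @ hs) (D + d) (\<lambda>w. i < length w \<and> w ! i)"
      using env_available_append[OF Cons.prems(5), of hs]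
      by (auto simp: env_available_def intro: available_mono)
  qed
  from Cons.IH[OF _ _ _ hs(1) this] Cons.prems obtain hs' where hs':
    "wf_bgates n f b E ((gs @ hs) @ hs')"
    "env_available n ((gs @ hs) @ hs') (D + d + length ps * d) (\<lambda>w. run w ps (step_env w (e w) st))"
    "bgates_size hs' \<le> length ps * q * (2 * f + 1) ^ d"
    by (auto simp: add.assoc)
  have "bgates_size (hs @ hs') \<le> q * (2 * f + 1) ^ d + length ps * q * (2 * f + 1) ^ d"
    using hs(3) hs'(3) mult_le_mono1[OF st(1), of "(2 * f + 1) ^ d"] unfolding bgates_size_simps
    by linarith
  thus ?case using hs' by (intro exI[of _ "hs @ hs'"]) (auto simp: algebra_simps)
qed

text \<open>The empty disjunction is the constant \<open>False\<close>. It is the initial value of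
  all registers and the value of the input positions from \<open>n\<close> on; it has depth 1, hence
  \<open>E \<ge> 1\<close>.\<close>

lemma initial_gates:
  fixes n :: nat
  assumes "E \<ge> 1"
  defines "gs \<equiv> map Input_BGate [0..<n] @ [Or_BGate []]"
  shows "wf_bgates n f b E gs \<and> env_available n gs 1 (\<lambda>w r. False) \<and> bgates_size gs = n + 1"
proof -
  let ?is = "\<lambda>m. map Input_BGate [0..<m]"
  have vals: "bgate_values w (?is m) = map ((!) w) [0..<m]" for w m
    by (induction m) (simp_all flip: append_assoc)
  have depths: "bgate_depths (?is m) = replicate m 0" for m
    by (induction m) (simp_all add: replicate_append_same)
  have wf: "wf_bgates n f b E (?is n)"
    using assms(1) by (auto simp: wf_bgates_def depths)
  have size: "bgates_size (?is m) = m" for m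
    by (induction m) auto
  have const: "available n gs 1 (\<lambda>w. False)"
    unfolding available_def gs_def
    by (rule exI[of _ n]) (auto simp: computed_at_def nth_append)
  have "available n gs 1 (\<lambda>w. i < length w \<and> w ! i)" for i
  proof (cases "i < n")
    case True
    hence "computed_at n (?is n) 1 (\<lambda>w. i < length w \<and> w ! i) i"
      by (auto simp: computed_at_def vals depths)
    thus ?thesis using computed_at_append available_def gs_def by blast
  next
    case False
    thus ?thesis using const by (auto simp: available_def computed_at_def)
  qed
  moreover have "wf_bgates n f b E gs"
    unfolding gs_def by (rule wf_bgates_snoc) (use wf assms in auto)
  ultimately show ?thesis using const size by (auto simp: env_available_def gs_def)
qed

theorem compile_program:
  assumes "\<forall>st\<in>set ps. step_bound f b d q st" and "\<forall>\<phi>\<in>set outs. form_bound f b d \<phi>" and "f \<ge> 1"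
  shows "\<exists>B. wf_bcircuit n B \<and>
     (\<forall>w. length w = n \<longrightarrow>
        bcircuit_eval B w = map (form_eval w (run w ps (\<lambda>_. False))) outs) \<and>
     bcircuit_depth B \<le> 1 + (length ps + 1) * d \<and>
     bcircuit_size B \<le> n + 1 + (length ps * q + length outs) * (2 * f + 1) ^ d + length outs \<and>
     (\<forall>g\<in>set (fst B). length (bgate_args g) \<le> f \<and> (is_maj g \<longrightarrow> b))"
proof -
  define E where "E = 1 + (length ps + 1) * d"
  define gs where "gs = map Input_BGate [0..<n] @ [Or_BGate []]"
  let ?e = "\<lambda>w. run w ps (\<lambda>_. False)"
  let ?D = "1 + length ps * d"
  have gs: "wf_bgates n f b E gs" "env_available n gs 1 (\<lambda>w r. False)" "bgates_size gs = n + 1"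
    using initial_gates[of E n f b] by (auto simp: gs_def E_def)
  from compile_steps[OF assms(1) _ assms(3) gs(1,2)] obtain hs where hs:
    "wf_bgates n f b E (gs @ hs)" "env_available n (gs @ hs) ?D ?e"
    "bgates_size hs \<le> length ps * q * (2 * f + 1) ^ d"
    by (auto simp: E_def)
  have "\<forall>\<phi>\<in>set outs. compilable n f b E ?D ?e d \<phi>"
    using assms by (auto intro!: compile_form simp: E_def)
  from compile_form_list[OF this hs(1,2)] obtain hs' where hs':
    "wf_bgates n f b E ((gs @ hs) @ hs')"
    "\<forall>\<phi>\<in>set outs. available n ((gs @ hs) @ hs') (?D + d) (\<lambda>w. form_eval w (?e w) \<phi>)"
    "bgates_size hs' \<le> length outs * (2 * f + 1) ^ d"
    by blast
  define ks where "ks = (gs @ hs) @ hs'"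
  obtain js where js: "length js = length outs"
    "\<forall>k<length outs. computed_at n ks (?D + d) (\<lambda>w. form_eval w (?e w) (outs ! k)) (js ! k)"
    using available_positions[OF hs'(2)] unfolding ks_def by blast
  show ?thesis
  proof (intro exI[of _ "(ks, js)"] conjI allI impI)
    have "\<forall>j\<in>set js. j < length ks"
      using js by (auto simp: in_set_conv_nth computed_at_def)
    thus "wf_bcircuit n (ks, js)"
      using hs'(1) by (auto simp: wf_bcircuit_def wf_bgates_def ks_def)
    fix w :: "bool list" assume "length w = n"
    thus "bcircuit_eval (ks, js) w = map (form_eval w (?e w)) outs"
      using js by (auto simp: bcircuit_eval_def bgate_values_def[symmetric] computed_at_def intro!: nth_equalityI)
  next
    show "bcircuit_depth (ks, js) \<le> 1 + (length ps + 1) * d"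
      using hs'(1) by (auto simp: bcircuit_depth_def wf_bgates_def bgate_depths_def ks_def E_def)
    have "bcircuit_size (ks, js) = bgates_size ks + length outs"
      using js(1) by (simp add: bcircuit_size_def bgates_size_def)
    also have "bgates_size ks \<le> n + 1 + (length ps * q * (2 * f + 1) ^ d + length outs * (2 * f + 1) ^ d)"
      using gs(3) hs(3) hs'(3) by (simp add: ks_def)
    finally show "bcircuit_size (ks, js) \<le>
        n + 1 + (length ps * q + length outs) * (2 * f + 1) ^ d + length outs"
      by (simp add: algebra_simps)
    show "\<forall>g\<in>set (fst (ks, js)). length (bgate_args g) \<le> f \<and> (is_maj g \<longrightarrow> b)"
      using hs'(1) by (auto simp: wf_bgates_def ks_def)
  qed
qed


section \<open>Circuit families indexed by the number of slots\<close>

lemma poly_bound_bigo: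
  fixes g :: "nat \<Rightarrow> nat"
  assumes "\<And>l. l \<ge> 1 \<Longrightarrow> g l \<le> c * (l + 1) ^ k"
  shows "(\<lambda>l. real (g l)) \<in> O(\<lambda>l. real l ^ k)"
proof (rule bigoI[of _ "real (c * 2 ^ k)"])
  show "\<forall>\<^sub>F l in at_top. norm (real (g l)) \<le> real (c * 2 ^ k) * norm (real l ^ k)"
    using eventually_ge_at_top[of 1]
  proof eventually_elim
    case (elim l)
    have "g l \<le> c * (l + 1) ^ k" using assms elim .
    also have "\<dots> \<le> c * (2 * l) ^ k"
      using elim by (intro mult_le_mono2 power_mono) auto
    finally have "real (g l) \<le> real (c * (2 * l) ^ k)" by (simp only: of_nat_le_iff)
    thus ?case by (simp add: power_mult_distrib)
  qed
qed

text \<open>\<open>len n\<close> is the length of an encoding with \<open>n\<close> slots, and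
  \<open>inv len\<close> recovers the number of slots. Lengths that no encoding has get the empty
  circuit.\<close>

definition slot_family :: "(nat \<Rightarrow> nat) \<Rightarrow> (nat \<Rightarrow> bcircuit) \<Rightarrow> nat \<Rightarrow> bcircuit" where
  "slot_family len B l = (if l \<in> range len then B (inv len l) else ([], []))"

lemma computed_by_slot_family:
  assumes "inj len" and "\<And>n. n \<le> len n" and "\<And>n. wf_bcircuit (len n) (B n)"
    and "\<And>n. bcircuit_size (B n) \<le> c * (n + 1) ^ k"
  shows "computed_by_poly_family (slot_family len B) (\<lambda>w. bcircuit_eval (slot_family len B (length w)) w)"
proof -
  have "bcircuit_size (slot_family len B l) \<le> c * (l + 1) ^ k" for l
  proof (cases "l \<in> range len")
    case True
    then obtain n where n: "l = len n" by auto
    have "bcircuit_size (B n) \<le> c * (n + 1) ^ k" by (rule assms)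
    also have "\<dots> \<le> c * (l + 1) ^ k"
      using assms(2)[of n] n by (intro mult_le_mono2 power_mono) auto
    finally show ?thesis using assms(1) by (simp add: slot_family_def n)
  qed (simp add: slot_family_def bcircuit_size_def)
  hence "(\<lambda>l. real (bcircuit_size (slot_family len B l))) \<in> O(\<lambda>l. real l ^ k)"
    by (rule poly_bound_bigo)
  moreover have "wf_bcircuit l (slot_family len B l)" for l
    using assms(1,3) by (auto simp: slot_family_def wf_bcircuit_def)
  ultimately show ?thesis by (auto simp: computed_by_poly_family_def)
qed

lemma in_TC0_slot_family:
  assumes "inj len" and "\<And>n. n \<le> len n" and "\<And>n. wf_bcircuit (len n) (B n)"
    and "\<And>n. bcircuit_size (B n) \<le> c * (n + 1) ^ k" and "\<And>n. bcircuit_depth (B n) \<le> d"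
  shows "\<exists>F. in_TC0 F \<and> (\<forall>n w. length w = len n \<longrightarrow> F w = bcircuit_eval (B n) w)"
proof (intro exI conjI allI impI)
  have "bcircuit_depth (slot_family len B l) \<le> d" for l
    using assms(5) by (auto simp: slot_family_def bcircuit_depth_def)
  thus "in_TC0 (\<lambda>w. bcircuit_eval (slot_family len B (length w)) w)"
    using computed_by_slot_family[OF assms(1-4)] unfolding in_TC0_def by blast
  fix n and w :: "bool list" assume "length w = len n"
  thus "bcircuit_eval (slot_family len B (length w)) w = bcircuit_eval (B n) w"
    using assms(1) by (simp add: slot_family_def)
qed

text \<open>For \<open>n > 0\<close> the assumption \<open>2 * n \<le> len n\<close> gives
  \<open>floor_log n + 1 \<le> log 2 (len n)\<close>, which absorbs the summand 1 even for the
  shortest inputs. By \<open>len 0 = 0\<close> the case \<open>n = 0\<close> does not meet the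
  lengths \<open>l \<ge> 1\<close>.\<close>

lemma in_NC2_slot_family:
  assumes "inj len" and "\<And>n. 2 * n \<le> len n" and "\<And>n. wf_bcircuit (len n) (B n)"
    and "\<And>n. bcircuit_size (B n) \<le> c * (n + 1) ^ k"
    and "\<And>n. bcircuit_depth (B n) \<le> d * (floor_log n + 1)\<^sup>2"
    and "\<And>n g. g \<in> set (fst (B n)) \<Longrightarrow> bounded_fanin_gate g"
    and "len 0 = 0"
  shows "\<exists>F. in_NC2 F \<and> (\<forall>n w. length w = len n \<longrightarrow> F w = bcircuit_eval (B n) w)"
proof (intro exI conjI allI impI)
  let ?C = "slot_family len B"
  have depth: "real (bcircuit_depth (?C l)) \<le> real d * (log 2 (real l))\<^sup>2" if "l \<ge> 1" for l
  proof (cases "l \<in> range len")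
    case True
    then obtain m where m: "l = len m" by auto
    have m0: "m > 0" using that m assms(7) by (cases m) auto
    have "2 ^ (floor_log m + 1) \<le> 2 * m" using floor_log_exp2_le[of m] m0 by simp
    also have "\<dots> \<le> l" using assms(2) m by simp
    finally have "real (2 ^ (floor_log m + 1)) \<le> real l" by (simp only: of_nat_le_iff)
    hence "real (floor_log m + 1) \<le> log 2 (real l)"
      using that by (simp add: le_log_iff powr_add powr_realpow)
    hence "(real (floor_log m + 1))\<^sup>2 \<le> (log 2 (real l))\<^sup>2" by (intro power_mono) auto
    moreover have "bcircuit_depth (?C l) \<le> d * (floor_log m + 1)\<^sup>2"
      using assms(1,5) by (simp add: slot_family_def m)
    hence "real (bcircuit_depth (?C l)) \<le> real d * (real (floor_log m + 1))\<^sup>2"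
      by (metis of_nat_le_iff of_nat_mult of_nat_power)
    ultimately show ?thesis by (meson mult_left_mono of_nat_0_le_iff order_trans)
  qed (simp add: slot_family_def bcircuit_depth_def)
  show "in_NC2 (\<lambda>w. bcircuit_eval (slot_family len B (length w)) w)"
    unfolding in_NC2_def
  proof (intro exI[of _ ?C] conjI allI ballI)
    show "computed_by_poly_family ?C (\<lambda>w. bcircuit_eval (?C (length w)) w)"
      using computed_by_slot_family[OF assms(1) _ assms(3,4)] assms(2)
      by (metis add_leD1 mult_2)
    show "bounded_fanin_gate g" if "g \<in> set (fst (?C l))" for l g
      using that assms(6) by (auto simp: slot_family_def split: if_splits)
    show "(\<lambda>l. real (bcircuit_depth (?C l))) \<in> O(\<lambda>l. (log 2 (real l))\<^sup>2)"
      by (rule bigoI[of _ "real d"])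
         (use depth in \<open>auto intro!: eventually_mono[OF eventually_ge_at_top[of 1]]\<close>)
  qed
  fix n and w :: "bool list" assume "length w = len n"
  thus "bcircuit_eval (slot_family len B (length w)) w = bcircuit_eval (B n) w"
    using assms(1) by (simp add: slot_family_def)
qed


section \<open>Slots\<close>

lemma nth_concat_blocks:
  assumes "\<forall>ys\<in>set yss. length ys = b" and "i < length yss" and "j < b"
  shows "concat yss ! (i * b + j) = yss ! i ! j"
  using assms
proof (induction yss arbitrary: i)
  case (Cons ys yss)
  show ?case
  proof (cases i)
    case (Suc i')
    thus ?thesis using Cons by (simp add: nth_append)
  qed (use Cons in \<open>simp add: nth_append\<close>)
qed simp

lemma length_concat_blocks:
  "\<forall>ys\<in>set yss. length ys = b \<Longrightarrow> length (concat yss) = length yss * b"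
  by (induction yss) auto

lemma distinct_filter_nth:
  assumes "distinct (filter P xs)" and "i < j" and "j < length xs" and "P (xs ! i)"
  shows "xs ! i \<noteq> xs ! j"
  using assms
proof (induction xs arbitrary: i j)
  case (Cons x xs)
  then obtain j' where j: "j = Suc j'" by (cases j) auto
  show ?case
  proof (cases i)
    case 0
    thus ?thesis using Cons.prems j by (auto split: if_splits)
  next
    case (Suc i')
    have "distinct (filter P xs)" using Cons.prems(1) by (auto split: if_splits)
    thus ?thesis using Cons.prems Cons.IH[of i' j'] j Suc by auto
  qed
qed simp

lemma enumerates_inj:
  assumes "enumerates xs V" and "i < length xs" and "j < length xs" and "xs ! i = Some g" and "xs ! j = Some g"
  shows "i = j"
  using assms distinct_filter_nth[of "\<lambda>x. x \<noteq> None" xs i j] distinct_filter_nth[of "\<lambda>x. x \<noteq> None" xs j i]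
  by (cases i j rule: linorder_cases) (auto simp: enumerates_def)

lemma enumerates_set: "enumerates xs V \<Longrightarrow> Some g \<in> set xs \<longleftrightarrow> g \<in> V"
  by (auto simp: enumerates_def set_eq_iff)

lemma enumerates_bij_betw:
  assumes "enumerates xs V"
  shows "bij_betw (\<lambda>i. the (xs ! i)) {i. i < length xs \<and> xs ! i \<noteq> None} V"
proof (rule bij_betwI')
  show "(the (xs ! i) = the (xs ! j)) = (i = j)"
    if "i \<in> {i. i < length xs \<and> xs ! i \<noteq> None}" "j \<in> {i. i < length xs \<and> xs ! i \<noteq> None}" for i j
    using that enumerates_inj[OF assms] by auto
  show "the (xs ! i) \<in> V" if "i \<in> {i. i < length xs \<and> xs ! i \<noteq> None}" for i
    using that enumerates_set[OF assms, of "the (xs ! i)"] nth_mem[of i xs] by auto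
  show "\<exists>i\<in>{i. i < length xs \<and> xs ! i \<noteq> None}. g = the (xs ! i)" if "g \<in> V" for g
    using that enumerates_set[OF assms, of g] by (force simp: in_set_conv_nth)
qed

lemma enumerates_map_Some:
  assumes "distinct ss" and "inj_on f {s \<in> set ss. P s}"
  shows "enumerates (map (\<lambda>s. if P s then Some (f s) else None) ss) (f ` {s \<in> set ss. P s})"
proof -
  have "filter (\<lambda>x. x \<noteq> None) (map (\<lambda>s. if P s then Some (f s) else None) ss) = map (Some \<circ> f) (filter P ss)"
    by (induction ss) auto
  moreover have "distinct (map (Some \<circ> f) (filter P ss))"
    using assms by (auto simp: distinct_map inj_on_def)
  ultimately show ?thesis by (auto simp: enumerates_def)
qed


section \<open>Heights in finite dags\<close>

text \<open>Consecutive vertices are related by \<open>E\<^sup>+\<close>, by transitivity so are all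
  pairs of an earlier and a later vertex, and acyclicity makes this relation irreflexive.\<close>

lemma dag_path_distinct:
  assumes "acyclic E" and "dag_path V E p"
  shows "distinct p"
proof -
  have "successively (\<lambda>x y. (x, y) \<in> E\<^sup>+) p"
    using assms(2) by (auto simp: dag_path_def elim: successively_mono)
  hence "sorted_wrt (\<lambda>x y. (x, y) \<in> E\<^sup>+) p"
    by (subst (asm) successively_conv_sorted_wrt) (auto intro: transpI)
  thus ?thesis
    using assms(1) by (induction p) (auto simp: acyclic_def)
qed

lemma finite_dag_paths:
  assumes "finite V" and "acyclic E"
  shows "finite {p. dag_path V E p}"
  by (rule finite_subset[OF _ finite_subset_distinct[OF assms(1)]])
     (use dag_path_distinct[OF assms(2)] in \<open>auto simp: dag_path_def\<close>)

lemma Sup_nat_le: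
  fixes f :: "'b \<Rightarrow> nat"
  assumes "\<And>p. P p \<Longrightarrow> f p \<le> B"
  shows "Sup {f p | p. P p} \<le> B"
proof (cases "\<exists>p. P p")
  case True
  thus ?thesis by (intro cSup_least) (auto intro: assms)
qed (simp add: Sup_nat_def)

lemma le_Sup_dag_paths:
  fixes f :: "'v list \<Rightarrow> nat"
  assumes "finite V" and "acyclic E" and "dag_path V E p"
  shows "f p \<le> Sup {f p | p. dag_path V E p}"
proof (rule cSup_upper)
  have "finite (f ` {p. dag_path V E p})" using finite_dag_paths[OF assms(1,2)] by (rule finite_imageI)
  moreover have "{f p | p. dag_path V E p} = f ` {p. dag_path V E p}" by auto
  ultimately show "bdd_above {f p | p. dag_path V E p}" by simp
qed (use assms in auto)

text \<open>A potential argument: along each edge \<open>H\<close> drops by at least the weight of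
  the vertex that is left. Weight 1 bounds the number of vertices of a path, the indicator of
  \<open>2\<^sup>x\<close>-gates bounds their number.\<close>

lemma dag_path_weight_le:
  fixes wt H :: "'v \<Rightarrow> nat"
  assumes "\<And>x. x \<in> V \<Longrightarrow> wt x \<le> H x" and "\<And>x y. (x, y) \<in> E \<Longrightarrow> x \<in> V \<Longrightarrow> y \<in> V \<Longrightarrow> wt x + H y \<le> H x"
    and "dag_path V E p"
  shows "sum_list (map wt p) \<le> H (hd p)"
  using assms(3)
proof (induction p)
  case (Cons x p)
  show ?case
  proof (cases p)
    case Nil
    thus ?thesis using Cons.prems assms(1) by (simp add: dag_path_def)
  next
    case (Cons y q)
    hence "sum_list (map wt p) \<le> H y" using Cons.IH Cons.prems by (auto simp: dag_path_def)
    moreover have "wt x + H y \<le> H x" using Cons.prems Cons by (intro assms(2)) (auto simp: dag_path_def)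
    ultimately show ?thesis by simp
  qed
qed (simp add: dag_path_def)

lemma acyclic_potential:
  fixes H :: "'v \<Rightarrow> nat"
  assumes "\<And>x y. (x, y) \<in> E \<Longrightarrow> H y < H x"
  shows "acyclic E"
proof -
  have "E \<subseteq> (measure H)\<inverse>" using assms by auto
  thus ?thesis by (meson acyclic_converse acyclic_subset wf_acyclic wf_measure)
qed

lemma dag_depth_le:
  fixes H :: "'v \<Rightarrow> nat"
  assumes "\<And>x. x \<in> V \<Longrightarrow> H x \<le> B" and "\<And>x y. (x, y) \<in> E \<Longrightarrow> x \<in> V \<Longrightarrow> y \<in> V \<Longrightarrow> H y < H x"
  shows "dag_depth V E \<le> B"
  unfolding dag_depth_def
proof (rule Sup_nat_le)
  fix p assume p: "dag_path V E p"
  \<comment> \<open>Weights count vertices whereas the depth counts edges, hence the summand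
    1.\<close>
  have "sum_list (map (\<lambda>_. 1) p) \<le> H (hd p) + 1"
    by (rule dag_path_weight_le[OF _ _ p]) (use assms(2) in force)+
  moreover have "hd p \<in> V" using p by (cases p) (auto simp: dag_path_def)
  ultimately show "length p - 1 \<le> B" using assms(1)[of "hd p"] by (simp add: sum_list_triv)
qed

text \<open>\<open>H x\<close> is the maximal weight of a path that starts in \<open>x\<close>, the
  least potential. The weight of \<open>x\<close> itself is included, so for constant weight 1 the
  number of edges is \<open>H x - 1\<close>.\<close>

lemma dag_height:
  fixes wt :: "'v \<Rightarrow> nat"
  assumes "finite V" and "acyclic E" and "E \<subseteq> V \<times> V"
  obtains H where "\<And>x y. (x, y) \<in> E \<Longrightarrow> wt x + H y \<le> H x"
    and "\<And>x. x \<in> V \<Longrightarrow> \<exists>p. dag_path V E p \<and> hd p = x \<and> H x = sum_list (map wt p)"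
    and "\<And>x. x \<in> V \<Longrightarrow> wt x \<le> H x"
proof -
  define S where "S x = (\<lambda>p. sum_list (map wt p)) ` {p. dag_path V E p \<and> hd p = x}" for x
  have fin: "finite (S x)" for x
    unfolding S_def by (rule finite_imageI, rule finite_subset[OF _ finite_dag_paths[OF assms(1,2)]]) auto
  have ne: "wt x \<in> S x" if "x \<in> V" for x
    unfolding S_def using that by (intro image_eqI[of _ _ "[x]"]) (auto simp: dag_path_def)
  have Max: "Max (S x) \<in> S x" if "x \<in> V" for x
    using fin ne[OF that] by (intro Max_in) auto
  show thesis
  proof (rule that[of "\<lambda>x. Max (S x)"])
    show "\<exists>p. dag_path V E p \<and> hd p = x \<and> Max (S x) = sum_list (map wt p)" if "x \<in> V" for x
      using Max[OF that] unfolding S_def by auto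
    show "wt x \<le> Max (S x)" if "x \<in> V" for x
      using fin ne[OF that] by (rule Max_ge)
    fix x y assume xy: "(x, y) \<in> E"
    hence "y \<in> V" using assms(3) by auto
    then obtain p where p: "dag_path V E p" "hd p = y" "Max (S y) = sum_list (map wt p)"
      using Max unfolding S_def by blast
    hence "dag_path V E (x # p)" using xy assms(3) by (cases p) (auto simp: dag_path_def)
    hence "wt x + Max (S y) \<in> S x" using p unfolding S_def[of x] by (intro image_eqI[of _ _ "x # p"]) auto
    thus "wt x + Max (S y) \<le> Max (S x)" using fin by (intro Max_ge)
  qed
qed


section \<open>Circuits on coded gates\<close>

text \<open>The gates are designed as elements of a countable datatype; the coding moves them to
  \<open>nat\<close>, where the resulting circuit has to live.\<close>

definition coded_circuit :: "'s::countable set \<Rightarrow> ('s \<Rightarrow> 's gate_op) \<Rightarrow> 's \<Rightarrow> nat circuit" where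
  "coded_circuit S f s = \<lparr>gates = to_nat ` S,
     gate_op = (\<lambda>j. map_gate_op to_nat (f (from_nat j))), out_gate = to_nat s\<rparr>"

lemma gate_inputs_map [simp]: "gate_inputs (map_gate_op h g) = map h (gate_inputs g)"
  by (cases g) auto

lemma is_exp2_gate_map [simp]: "is_exp2_gate (map_gate_op h g) = is_exp2_gate g"
  by (cases g) auto

lemma coded_circuit_simps [simp]:
  "gates (coded_circuit S f s) = to_nat ` S" "out_gate (coded_circuit S f s) = to_nat s"
  "gate_op (coded_circuit S f s) (to_nat t) = map_gate_op to_nat (f t)"
  by (simp_all add: coded_circuit_def)

lemma circuit_edges_coded:
  "circuit_edges (coded_circuit S f s) =
     (\<lambda>(t, u). (to_nat t, to_nat u)) ` {(t, u). t \<in> S \<and> u \<in> set (gate_inputs (f t))}"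
  by (auto simp: circuit_edges_def)

lemma length_filter_eq_sum: "length (filter P p) = sum_list (map (\<lambda>x. of_bool (P x)) p)"
  by (induction p) auto

locale slot_circuit =
  fixes S :: "'s::countable set" and f :: "'s \<Rightarrow> 's gate_op" and out :: 's and H :: "'s \<Rightarrow> nat"
  assumes finite: "finite S" and out: "out \<in> S"
    and closed: "\<And>t u. t \<in> S \<Longrightarrow> u \<in> set (gate_inputs (f t)) \<Longrightarrow> u \<in> S"
    and potential: "\<And>t u. t \<in> S \<Longrightarrow> u \<in> set (gate_inputs (f t)) \<Longrightarrow> H u < H t"
begin

abbreviation "C \<equiv> coded_circuit S f out"

lemma acyclic_edges: "acyclic (circuit_edges C)"
  by (rule acyclic_potential[of _ "\<lambda>j. H (from_nat j)"]) (auto simp: circuit_edges_coded potential)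

lemma circuit: "circuit C"
  using acyclic_edges closed finite out by (auto simp: circuit_def)

lemma gate_eval:
  assumes "t \<in> S"
  shows "gate_eval C (to_nat t) = (case f t of
              Zero_Gate \<Rightarrow> 0
            | Plus_Gate h k \<Rightarrow> gate_eval C (to_nat h) + gate_eval C (to_nat k)
            | Minus_Gate h \<Rightarrow> - gate_eval C (to_nat h)
            | Exp2_Gate h \<Rightarrow> 2 powr gate_eval C (to_nat h))"
  using gate_eval_eq[OF circuit, of "to_nat t"] assms by (cases "f t") auto

lemma depth_le:
  assumes "\<And>t. t \<in> S \<Longrightarrow> H t \<le> B"
  shows "circuit_depth C \<le> B"
  unfolding circuit_depth_def
  by (rule dag_depth_le[of _ "\<lambda>j. H (from_nat j)"])
     (auto simp: circuit_edges_coded potential assms)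

lemma depth_exp2_le:
  assumes "\<And>t. t \<in> S \<Longrightarrow> of_bool (is_exp2_gate (f t)) \<le> X t"
    and "\<And>t u. t \<in> S \<Longrightarrow> u \<in> set (gate_inputs (f t)) \<Longrightarrow> of_bool (is_exp2_gate (f t)) + X u \<le> X t"
    and "\<And>t. t \<in> S \<Longrightarrow> X t \<le> B"
  shows "circuit_depth_exp2 C \<le> B"
  unfolding circuit_depth_exp2_def
proof (rule Sup_nat_le)
  fix p assume p: "dag_path (gates C) (circuit_edges C) p"
  have "sum_list (map (\<lambda>j. of_bool (is_exp2_gate (gate_op C j))) p) \<le> X (from_nat (hd p))"
  proof (rule dag_path_weight_le[OF _ _ p])
    show "of_bool (is_exp2_gate (gate_op C j)) \<le> X (from_nat j)" if "j \<in> gates C" for j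
      using that assms(1) by force
    show "of_bool (is_exp2_gate (gate_op C j)) + X (from_nat k) \<le> X (from_nat j)"
      if "(j, k) \<in> circuit_edges C" for j k
      using that assms(2) unfolding circuit_edges_coded by force
  qed
  moreover have "hd p \<in> to_nat ` S" using p by (cases p) (auto simp: dag_path_def)
  hence "X (from_nat (hd p)) \<le> B" using assms(3) by auto
  ultimately show "length (filter (\<lambda>g. is_exp2_gate (gate_op C g)) p) \<le> B"
    by (simp add: length_filter_eq_sum)
qed

text \<open>Potentials give upper bounds only. The lower bound on \<open>circuit_depth_exp2\<close>
  needs an explicit path, which is built from its end upwards.\<close>

definition exp2_below :: "'s \<Rightarrow> nat \<Rightarrow> bool" where
  "exp2_below t k \<longleftrightarrow> (\<exists>p. dag_path (gates C) (circuit_edges C) (to_nat t # p) \<and>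
     k \<le> length (filter (\<lambda>g. is_exp2_gate (gate_op C g)) (to_nat t # p)))"

lemma exp2_below_self: "t \<in> S \<Longrightarrow> exp2_below t (of_bool (is_exp2_gate (f t)))"
  unfolding exp2_below_def by (rule exI[of _ "[]"]) (auto simp: dag_path_def)

lemma exp2_below_step:
  assumes "exp2_below u k" and "t \<in> S" and "u \<in> set (gate_inputs (f t))"
  shows "exp2_below t (of_bool (is_exp2_gate (f t)) + k)"
proof -
  obtain p where p: "dag_path (gates C) (circuit_edges C) (to_nat u # p)"
    "k \<le> length (filter (\<lambda>g. is_exp2_gate (gate_op C g)) (to_nat u # p))"
    using assms(1) unfolding exp2_below_def by blast
  show ?thesis unfolding exp2_below_def
    by (rule exI[of _ "to_nat u # p"])
       (use p assms(2,3) in \<open>auto simp: dag_path_def circuit_edges_def\<close>)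
qed

lemma exp2_below_le_depth: "exp2_below t k \<Longrightarrow> k \<le> circuit_depth_exp2 C"
  unfolding exp2_below_def circuit_depth_exp2_def
  by (auto simp del: filter.simps intro: order_trans[OF _ le_Sup_dag_paths[OF _ acyclic_edges]] simp: finite)

end


section \<open>From power circuits to circuits\<close>

text \<open>\<open>Pow x\<close> has the value of the node \<open>x\<close> and \<open>Inv x\<close> the negated value. The gates \<open>Plus x i\<close>
  compute the value of the successor marking of \<open>x\<close>.\<close>

datatype pgate = Const | Pow nat | Inv nat | Plus nat nat

instance pgate :: countable
  by countable_datatype

text \<open>The vertices in \<open>{i..<2*i}\<close> form a cut of the tree. Passing to
  \<open>i + 1\<close> replaces vertex \<open>i\<close> by its children \<open>2 * i\<close> and
  \<open>2 * i + 1\<close>, which does not change the sum. The cut is the root for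
  \<open>i = 1\<close> and consists of the \<open>k\<close> leaves for \<open>i = k\<close>.\<close>

lemma heap_sum:
  fixes F :: "nat \<Rightarrow> real"
  assumes "\<And>i. 1 \<le> i \<Longrightarrow> i < k \<Longrightarrow> F i = F (2 * i) + F (2 * i + 1)" and "1 \<le> i" and "i \<le> k"
  shows "(\<Sum>c=i..<2*i. F c) = F 1"
  using assms(2,3)
proof (induction i rule: dec_induct)
  case base
  have "{1..<2 * 1} = {1::nat}" by auto
  thus ?case by simp
next
  case (step i)
  have "(\<Sum>c=i..<2*i. F c) = F i + (\<Sum>c=Suc i..<2*i. F c)"
    using step by (intro sum.atLeast_Suc_lessThan) auto
  moreover have "(\<Sum>c=Suc i..<2*Suc i. F c) = (\<Sum>c=Suc i..<2*i. F c) + F (2 * i) + F (2 * i + 1)"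
    using step by simp
  ultimately show ?case using step assms(1)[of i] by simp
qed

text \<open>The nodes of the power circuit are slots below \<open>n\<close>; row \<open>n\<close> of \<open>r\<close> is the marking that is to
  be evaluated.\<close>

locale slot_power_circuit =
  fixes n :: nat and a :: "nat \<Rightarrow> bool" and r :: "nat \<Rightarrow> nat \<Rightarrow> int"
    and v :: "nat \<Rightarrow> real" and ht :: "nat \<Rightarrow> nat" and D L :: nat
  assumes r_range: "r x y \<in> {-1, 0, 1}"
    and r_active: "r x y \<noteq> 0 \<Longrightarrow> y < n \<and> a y \<and> (x = n \<or> x < n \<and> a x)"
    and v_eq: "x < n \<Longrightarrow> a x \<Longrightarrow> v x = 2 powr (\<Sum>y<n. of_int (r x y) * v y)"
    and ht_less: "x < n \<Longrightarrow> r x y \<noteq> 0 \<Longrightarrow> ht y < ht x"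
    and ht_le: "x < n \<Longrightarrow> a x \<Longrightarrow> ht x \<le> D"
    and card_le: "card {x. x < n \<and> a x} \<le> 2 ^ L"
begin

definition succs :: "nat \<Rightarrow> nat list" where
  "succs x = filter (\<lambda>y. r x y \<noteq> 0) [0..<n]"

definition cnt :: "nat \<Rightarrow> nat" where
  "cnt x = length (succs x)"

text \<open>The successor marking is summed up by a heap-shaped tree with root \<open>1\<close> in which vertex
  \<open>i\<close> has the children \<open>2 i\<close> and \<open>2 i + 1\<close>. With \<open>k\<close> leaves the inner vertices are those
  below \<open>k\<close>, so the tree has minimal depth.\<close>

definition heap_gate :: "nat \<Rightarrow> nat \<Rightarrow> pgate" where
  "heap_gate x c =
     (if cnt x = 0 then Const
      else if c < cnt x then Plus x c
      else let y = succs x ! (c - cnt x) in if r x y = 1 then Pow y else Inv y)"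

fun pgate_op :: "pgate \<Rightarrow> pgate gate_op" where
  "pgate_op Const = Zero_Gate"
| "pgate_op (Pow x) = Exp2_Gate (heap_gate x 1)"
| "pgate_op (Inv x) = Minus_Gate (Pow x)"
| "pgate_op (Plus x i) = Plus_Gate (heap_gate x (2 * i)) (heap_gate x (2 * i + 1))"

fun active :: "pgate \<Rightarrow> bool" where
  "active Const = True"
| "active (Pow x) = (x < n \<and> a x)"
| "active (Inv x) = (x < n \<and> a x)"
| "active (Plus x i) = (x \<le> n \<and> 1 \<le> i \<and> i < cnt x)"

text \<open>The marking row \<open>n\<close> counts as a further node above all others.\<close>

definition rank :: "nat \<Rightarrow> nat" where
  "rank x = (if x = n then D + 1 else ht x)"

lemma set_succs: "y \<in> set (succs x) \<longleftrightarrow> r x y \<noteq> 0"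
  using r_active[of x y] by (auto simp: succs_def)

lemma leaf:
  assumes "cnt x \<le> c" and "c < 2 * cnt x"
  defines "y \<equiv> succs x ! (c - cnt x)"
  shows "r x y \<noteq> 0" and "y < n" and "a y" and "rank y < rank x" and "rank y = ht y"
    and "heap_gate x c = (if r x y = 1 then Pow y else Inv y)"
proof -
  have "y \<in> set (succs x)"
    unfolding y_def by (rule nth_mem) (use assms in \<open>auto simp: cnt_def\<close>)
  thus r: "r x y \<noteq> 0" by (simp add: set_succs)
  show y: "y < n" "a y" using r_active[OF r] by auto
  show "rank y = ht y" using y by (simp add: rank_def)
  show "rank y < rank x"
    using r_active[OF r] ht_less[OF _ r] ht_le[OF y] by (auto simp: rank_def)
  show "heap_gate x c = (if r x y = 1 then Pow y else Inv y)"
    using assms by (simp add: heap_gate_def)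
qed

lemma active_heap_gate:
  assumes "x \<le> n" and "1 \<le> c" and "cnt x = 0 \<or> c < 2 * cnt x"
  shows "active (heap_gate x c)"
proof (cases "cnt x = 0 \<or> c < cnt x")
  case False
  thus ?thesis using assms leaf[of x c] by auto
qed (use assms in \<open>auto simp: heap_gate_def\<close>)

lemma active_inputs: "active s \<Longrightarrow> t \<in> set (gate_inputs (pgate_op s)) \<Longrightarrow> active t"
  by (cases s) (auto intro!: active_heap_gate)

lemma cnt_le: "cnt x \<le> card {x. x < n \<and> a x}"
proof -
  have "cnt x = card (set (succs x))"
    unfolding cnt_def succs_def by (subst distinct_card) auto
  also have "\<dots> \<le> card {x. x < n \<and> a x}"
    using r_active[of x] by (intro card_mono) (auto simp: set_succs)
  finally show ?thesis .
qed

lemma rank_pos: "cnt x \<noteq> 0 \<Longrightarrow> 0 < rank x"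
  using leaf(4)[of x "cnt x"] by auto

lemma floor_log_less: "1 \<le> i \<Longrightarrow> i < cnt x \<Longrightarrow> floor_log i < L"
proof -
  assume i: "1 \<le> i" "i < cnt x"
  hence "2 ^ floor_log i \<le> i" using floor_log_exp2_le[of i] by simp
  also have "\<dots> < 2 ^ L" using i cnt_le[of x] card_le by simp
  finally show ?thesis by simp
qed

text \<open>One rank is worth \<open>L + 2\<close> levels: \<open>L\<close> for the tree, whose
  vertex \<open>i\<close> lies \<open>floor_log i\<close> levels below its root, and two for
  \<open>Pow\<close> and \<open>Inv\<close>.\<close>

fun height :: "pgate \<Rightarrow> nat" where
  "height Const = 0"
| "height (Pow x) = rank x * (L + 2) + 1"
| "height (Inv x) = rank x * (L + 2) + 2"
| "height (Plus x i) = rank x * (L + 2) - floor_log i"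

lemma height_leaf:
  assumes "cnt x \<le> c" and "c < 2 * cnt x"
  shows "height (heap_gate x c) + L \<le> rank x * (L + 2)"
proof -
  let ?y = "succs x ! (c - cnt x)"
  have "height (heap_gate x c) + L \<le> (rank ?y + 1) * (L + 2)"
    using leaf(6)[OF assms] by auto
  also have "\<dots> \<le> rank x * (L + 2)"
    using leaf(4)[OF assms] by (intro mult_le_mono1) auto
  finally show ?thesis .
qed

lemma height_child:
  assumes "1 \<le> i" and "i < cnt x" and "c \<in> {2 * i, 2 * i + 1}"
  shows "height (heap_gate x c) < height (Plus x i)"
proof (cases "c < cnt x")
  case True
  have "floor_log c = Suc (floor_log i)"
    using assms by (auto simp: floor_log_rec)
  moreover have "floor_log c < L" using True assms by (intro floor_log_less) auto
  \<comment> \<open>A positive rank keeps the subtraction in \<open>height (Plus x i)\<close> from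
    being truncated at 0.\<close>
  moreover have "1 * (L + 2) \<le> rank x * (L + 2)"
    using rank_pos[of x] assms by (intro mult_le_mono1) auto
  ultimately show ?thesis using True by (simp add: heap_gate_def)
next
  case False
  have "floor_log i < L" using assms by (intro floor_log_less) auto
  moreover have "height (heap_gate x c) + L \<le> rank x * (L + 2)"
    using False assms by (intro height_leaf) auto
  ultimately show ?thesis by simp
qed

lemma height_inputs:
  assumes "active s" and "t \<in> set (gate_inputs (pgate_op s))"
  shows "height t < height s"
proof (cases s)
  case (Pow x)
  consider "cnt x = 0" | "cnt x = 1" | "1 < cnt x" by linarith
  thus ?thesis
  proof cases
    case 2
    thus ?thesis using height_leaf[of x 1] assms Pow by simp
  qed (use assms Pow in \<open>auto simp: heap_gate_def\<close>)
next
  case (Plus x i)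
  thus ?thesis using assms by (auto intro!: height_child simp del: height.simps)
qed (use assms in auto)

lemma rank_le: "x = n \<or> cnt x \<noteq> 0 \<or> x < n \<and> a x \<Longrightarrow> rank x \<le> D + 1"
proof -
  assume *: "x = n \<or> cnt x \<noteq> 0 \<or> x < n \<and> a x"
  have "x = n \<or> x < n \<and> a x"
  proof (cases "cnt x = 0")
    case False
    hence "r x (succs x ! (cnt x - cnt x)) \<noteq> 0" by (intro leaf) auto
    thus ?thesis by (rule disjE[OF conjunct2[OF conjunct2[OF r_active]]]) auto
  qed (use * in auto)
  thus ?thesis using ht_le[of x] by (auto simp: rank_def)
qed

lemma height_le: "active s \<Longrightarrow> height s \<le> (D + 1) * (L + 2)"
proof -
  assume s: "active s"
  have *: "ht x * (L + 2) \<le> D * (L + 2)" if "x < n" "a x" for x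
    using ht_le[OF that] by (rule mult_le_mono1)
  show ?thesis
  proof (cases s)
    case (Plus x i)
    have "rank x \<le> D + 1" using s Plus by (intro rank_le) auto
    hence "rank x * (L + 2) \<le> (D + 1) * (L + 2)" by (rule mult_le_mono1)
    thus ?thesis using Plus by simp
  qed (use s *[of "case s of Pow x \<Rightarrow> x | Inv x \<Rightarrow> x"] in \<open>auto simp: rank_def\<close>)
qed

abbreviation "S \<equiv> {s. active s}"

lemma S_eq: "S = {Const} \<union> Pow ` {x. x < n \<and> a x} \<union> Inv ` {x. x < n \<and> a x} \<union>
    (\<lambda>(x, i). Plus x i) ` (SIGMA x:{..n}. {1..<cnt x})"
proof (intro set_eqI)
  fix s
  show "s \<in> S \<longleftrightarrow> s \<in> {Const} \<union> Pow ` {x. x < n \<and> a x} \<union> Inv ` {x. x < n \<and> a x} \<union>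
      (\<lambda>(x, i). Plus x i) ` (SIGMA x:{..n}. {1..<cnt x})"
    by (cases s) auto
qed

lemma finite_S: "finite S"
  unfolding S_eq by auto

sublocale slot_circuit S pgate_op "heap_gate n 1" height
  by unfold_locales
     (use finite_S active_inputs height_inputs in \<open>auto intro!: active_heap_gate\<close>)

text \<open>One constant, a \<open>Pow\<close> and an \<open>Inv\<close> per node, and fewer than
  \<open>cnt x\<close> additions in each nonempty row. The marking row has at most one entry per
  node, which accounts for the third multiple of the number of nodes.\<close>

lemma card_S: "card S \<le> 1 + 3 * card {x. x < n \<and> a x} + (\<Sum>x<n. cnt x)"
proof -
  let ?A = "{x. x < n \<and> a x}"
  have "card S \<le> card {Const} + card (Pow ` ?A) + card (Inv ` ?A) +
      card ((\<lambda>(x, i). Plus x i) ` (SIGMA x:{..n}. {1..<cnt x}))"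
    unfolding S_eq by (intro order_trans[OF card_Un_le] add_mono order_refl)
  also have "card (Pow ` ?A) \<le> card ?A" by (rule card_image_le) simp
  also have "card (Inv ` ?A) \<le> card ?A" by (rule card_image_le) simp
  also have "card ((\<lambda>(x, i). Plus x i) ` (SIGMA x:{..n}. {1..<cnt x})) \<le>
      card (SIGMA x:{..n}. {1..<cnt x})"
    by (rule card_image_le) auto
  also have "\<dots> = (\<Sum>x\<le>n. cnt x - 1)" by simp
  also have "\<dots> \<le> (\<Sum>x\<le>n. cnt x)" by (rule sum_mono) simp
  also have "\<dots> = (\<Sum>x<n. cnt x) + cnt n" by (simp add: lessThan_Suc_atMost[symmetric])
  also have "cnt n \<le> card ?A" by (rule cnt_le)
  finally show ?thesis by simp
qed

text \<open>The values of the \<open>Pow\<close> gates are presupposed only for successors of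
  \<open>x\<close>. So the lemma serves inside the induction over the nodes and, after it, for the
  marking row.\<close>

lemma heap_eval:
  assumes "x \<le> n" and "\<And>y. r x y \<noteq> 0 \<Longrightarrow> gate_eval C (to_nat (Pow y)) = v y"
  shows "gate_eval C (to_nat (heap_gate x 1)) = (\<Sum>y<n. of_int (r x y) * v y)"
proof -
  let ?F = "\<lambda>c. gate_eval C (to_nat (heap_gate x c))"
  let ?k = "cnt x"
  have sum: "(\<Sum>y<n. of_int (r x y) * v y) = (\<Sum>y\<leftarrow>succs x. of_int (r x y) * v y)"
  proof -
    have "(\<Sum>y<n. of_int (r x y) * v y) = (\<Sum>y\<in>set (succs x). of_int (r x y) * v y)"
      using r_active[of x] by (intro sum.mono_neutral_right) (auto simp: set_succs)
    also have "\<dots> = (\<Sum>y\<leftarrow>succs x. of_int (r x y) * v y)"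
      by (rule sum.distinct_set_conv_list) (simp add: succs_def)
    finally show ?thesis .
  qed
  show ?thesis
  proof (cases "?k = 0")
    case True
    have "?F 1 = 0" using gate_eval[of Const] True by (simp add: heap_gate_def)
    thus ?thesis using True unfolding sum by (simp add: cnt_def)
  next
    case False
    have "?F 1 = (\<Sum>c=?k..<2*?k. ?F c)"
    proof (rule heap_sum[symmetric, of ?k])
      fix i assume i: "1 \<le> i" "i < ?k"
      hence "?F i = gate_eval C (to_nat (Plus x i))" by (simp add: heap_gate_def)
      also have "\<dots> = ?F (2 * i) + ?F (2 * i + 1)"
        using gate_eval[of "Plus x i"] i assms(1) by simp
      finally show "?F i = ?F (2 * i) + ?F (2 * i + 1)" .
    qed (use False in auto)
    also have "\<dots> = (\<Sum>j<?k. ?F (?k + j))"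
      using sum.shift_bounds_nat_ivl[of ?F 0 ?k ?k]
      by (simp add: atLeast0LessThan add.commute mult_2)
    also have "\<dots> = (\<Sum>j<?k. of_int (r x (succs x ! j)) * v (succs x ! j))"
    proof (rule sum.cong[OF refl])
      fix j assume "j \<in> {..<?k}"
      hence j: "?k \<le> ?k + j" "?k + j < 2 * ?k" by auto
      let ?y = "succs x ! j"
      have y: "r x ?y \<noteq> 0" "?y < n" "a ?y" and
        gate: "heap_gate x (?k + j) = (if r x ?y = 1 then Pow ?y else Inv ?y)"
        using leaf[OF j] by auto
      have "gate_eval C (to_nat (Pow ?y)) = v ?y" using assms(2) y by blast
      moreover from this have "gate_eval C (to_nat (Inv ?y)) = - v ?y"
        using gate_eval[of "Inv ?y"] y by simp
      ultimately show "?F (?k + j) = of_int (r x ?y) * v ?y"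
        using gate y(1) r_range[of x ?y] by auto
    qed
    also have "\<dots> = (\<Sum>y\<leftarrow>succs x. of_int (r x y) * v y)"
      by (simp add: sum_list_sum_nth cnt_def atLeast0LessThan)
    finally show ?thesis unfolding sum .
  qed
qed

lemma Pow_eval: "x < n \<Longrightarrow> a x \<Longrightarrow> gate_eval C (to_nat (Pow x)) = v x"
proof (induction "ht x" arbitrary: x rule: less_induct)
  case less
  have "gate_eval C (to_nat (heap_gate x 1)) = (\<Sum>y<n. of_int (r x y) * v y)"
  proof (rule heap_eval)
    fix y assume r: "r x y \<noteq> 0"
    show "gate_eval C (to_nat (Pow y)) = v y"
      by (rule less.hyps) (use ht_less[OF _ r] r_active[OF r] less.prems in auto)
  qed (use less in simp)
  thus ?case using gate_eval[of "Pow x"] v_eq less.prems by simp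
qed

lemma eval: "circuit_eval C = (\<Sum>y<n. of_int (r n y) * v y)"
  unfolding circuit_eval_def coded_circuit_simps
  by (rule heap_eval) (use r_active Pow_eval in auto)

lemma size: "circuit_size C \<le> 1 + 3 * card {x. x < n \<and> a x} + (\<Sum>x<n. cnt x)"
  using card_S by (simp add: circuit_size_def card_image)

lemma depth: "circuit_depth C \<le> (D + 1) * (L + 2)"
  by (rule depth_le) (use height_le in auto)

section \<open>The number of exponential gates on paths\<close>

fun exp2_height :: "pgate \<Rightarrow> nat" where
  "exp2_height Const = 0"
| "exp2_height (Pow x) = rank x + 1"
| "exp2_height (Inv x) = rank x + 1"
| "exp2_height (Plus x i) = rank x"

lemma exp2_height_heap_gate:
  assumes "1 \<le> c" and "cnt x = 0 \<or> c < 2 * cnt x"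
  shows "exp2_height (heap_gate x c) \<le> rank x"
proof (cases "cnt x = 0 \<or> c < cnt x")
  case False
  thus ?thesis using assms leaf[of x c] by auto
qed (auto simp: heap_gate_def)

lemma depth_exp2_upper: "circuit_depth_exp2 C \<le> D + 1"
proof (rule depth_exp2_le[of exp2_height])
  show "of_bool (is_exp2_gate (pgate_op t)) \<le> exp2_height t" if "t \<in> S" for t
    using that by (cases t) auto
  show "of_bool (is_exp2_gate (pgate_op t)) + exp2_height u \<le> exp2_height t"
    if "t \<in> S" "u \<in> set (gate_inputs (pgate_op t))" for t u
    using that by (cases t) (auto intro!: exp2_height_heap_gate)
  show "exp2_height t \<le> D + 1" if "t \<in> S" for t
  proof (cases t)
    case (Plus x i)
    thus ?thesis using that rank_le[of x] by auto
  qed (use that ht_le in \<open>auto simp: rank_def\<close>)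
qed

text \<open>A path is prolonged from the tree vertex \<open>c\<close> to its parent
  \<open>c div 2\<close> until the root 1 is reached; the \<open>+\<close>-gates on the way do not
  affect the count.\<close>

lemma exp2_below_root:
  assumes "x \<le> n" and "exp2_below (heap_gate x c) k" and "1 \<le> c" and "c < 2 * cnt x"
  shows "exp2_below (heap_gate x 1) k"
  using assms(2-)
proof (induction c rule: less_induct)
  case (less c)
  show ?case
  proof (cases "c = 1")
    case False
    let ?i = "c div 2"
    have i: "1 \<le> ?i" "?i < cnt x" "c = 2 * ?i \<or> c = 2 * ?i + 1" using False less.prems by auto
    have "heap_gate x c \<in> set (gate_inputs (pgate_op (Plus x ?i)))"
      using i(3) by auto
    hence "exp2_below (Plus x ?i) (of_bool (is_exp2_gate (pgate_op (Plus x ?i))) + k)"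
      using i assms(1) by (intro exp2_below_step[OF less.prems(1)]) auto
    hence "exp2_below (heap_gate x ?i) k" using i by (simp add: heap_gate_def)
    thus ?thesis using i False less.prems by (intro less.IH[of ?i]) auto
  qed (use less in simp)
qed

text \<open>A path of the power circuit lifts to a path of gates through the \<open>Pow\<close>
  gates of all its nodes. Every node has its gates, whether or not the marking depends on it, so a
  longest path can be lifted.\<close>

lemma exp2_below_path:
  assumes "successively (\<lambda>x y. r x y \<noteq> 0) p" and "p \<noteq> []" and "\<forall>x\<in>set p. x < n \<and> a x"
  shows "exp2_below (Pow (hd p)) (length p)"
  using assms
proof (induction p rule: induct_list012)
  case (2 x)
  thus ?case using exp2_below_self[of "Pow x"] by simp
next
  case (3 x y p)
  hence IH: "exp2_below (Pow y) (length (y # p))" by simp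
  have "y \<in> set (succs x)" using 3 by (simp add: set_succs)
  then obtain j where j: "j < cnt x" "succs x ! j = y" by (auto simp: in_set_conv_nth cnt_def)
  have "exp2_below (heap_gate x (cnt x + j)) (length (y # p))"
  proof (cases "r x y = 1")
    case True
    thus ?thesis using IH j by (simp add: heap_gate_def)
  next
    case False
    have "exp2_below (Inv y) (of_bool (is_exp2_gate (pgate_op (Inv y))) + length (y # p))"
      by (rule exp2_below_step[OF IH]) (use 3 in auto)
    thus ?thesis using False j by (simp add: heap_gate_def)
  qed
  hence "exp2_below (heap_gate x 1) (length (y # p))"
    by (rule exp2_below_root[rotated]) (use 3 j in auto)
  hence "exp2_below (Pow x) (of_bool (is_exp2_gate (pgate_op (Pow x))) + length (y # p))"
    by (rule exp2_below_step) (use 3 in auto)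
  thus ?case by simp
qed simp

lemma depth_exp2:
  assumes "successively (\<lambda>x y. r x y \<noteq> 0) p" and "\<forall>x\<in>set p. x < n \<and> a x" and "length p = D + 1"
  shows "circuit_depth_exp2 C = D + 1"
proof (rule antisym[OF depth_exp2_upper])
  have "exp2_below (Pow (hd p)) (length p)" by (rule exp2_below_path) (use assms in auto)
  thus "D + 1 \<le> circuit_depth_exp2 C" using exp2_below_le_depth assms(3) by metis
qed

end


section \<open>The first construction in TC0\<close>

abbreviation TT :: "'r form" where "TT \<equiv> Conj []"
abbreviation FF :: "'r form" where "FF \<equiv> Disj []"

definition const_form :: "bool \<Rightarrow> 'r form" where
  "const_form b = (if b then TT else FF)"

lemma eval_const_form [simp]: "form_eval w e (const_form b) = b"
  by (simp add: const_form_def)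

lemma form_bound_const_form [simp]: "form_bound f b d (const_form c) = (0 < d)"
  by (simp add: const_form_def)

text \<open>The padding turns the majority gate into a gate with threshold \<open>k\<close>.\<close>

definition more_than :: "nat \<Rightarrow> 'r form list \<Rightarrow> 'r form" where
  "more_than k \<phi>s = Maj (\<phi>s @ replicate (length \<phi>s) TT @ replicate (2 * k) FF)"

lemma eval_more_than [simp]:
  "form_eval w e (more_than k \<phi>s) \<longleftrightarrow> k < length (filter (form_eval w e) \<phi>s)"
  by (auto simp: more_than_def)

definition exactly :: "nat \<Rightarrow> 'r form list \<Rightarrow> 'r form" where
  "exactly k \<phi>s = Conj [if k = 0 then TT else more_than (k - 1) \<phi>s, Neg (more_than k \<phi>s)]"

lemma eval_exactly [simp]:
  "form_eval w e (exactly k \<phi>s) \<longleftrightarrow> length (filter (form_eval w e) \<phi>s) = k"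
  by (auto simp: exactly_def)

lemma form_bound_more_than:
  assumes "2 * (length \<phi>s + k) \<le> f" and "\<forall>\<phi>\<in>set \<phi>s. form_bound f True 1 \<phi>"
  shows "form_bound f True 2 (more_than k \<phi>s)"
  using assms by (auto simp: more_than_def)

lemma form_bound_exactly:
  assumes "2 * (length \<phi>s + k) \<le> f" and "2 \<le> f" and "\<forall>\<phi>\<in>set \<phi>s. form_bound f True 1 \<phi>"
  shows "form_bound f True 4 (exactly k \<phi>s)"
  using assms form_bound_mono[OF form_bound_more_than[of \<phi>s "k - 1" f], of 3]
    form_bound_more_than[of \<phi>s k f]
  by (auto simp: exactly_def)

text \<open>The signs of the marking, row \<open>n\<close>, are scattered over the blocks of all
  slots \<open>y\<close>, right behind the activity bits, whereas row \<open>x\<close> of \<delta>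
  fills the rest of block \<open>x\<close>. The second bit of a sign, at the next position, is set
  for -1.\<close>

definition sign_pos :: "nat \<Rightarrow> nat \<Rightarrow> nat \<Rightarrow> nat" where
  "sign_pos n x y = (if x = n then y * (2 * n + 3) + 1 else x * (2 * n + 3) + (3 + y * 2))"

definition row_form :: "nat \<Rightarrow> nat \<Rightarrow> nat \<Rightarrow> unit form list" where
  "row_form n x m = map (\<lambda>y. Inp (sign_pos n x y)) [0..<m]"

text \<open>The child \<open>c\<close> in the tree of \<open>x\<close> is the leaf of \<open>y\<close> iff \<open>c\<close> is the sum of the number of leaves
  and the number of the leaves before \<open>y\<close>.\<close>

fun heap_form :: "nat \<Rightarrow> nat \<Rightarrow> nat \<Rightarrow> pgate \<Rightarrow> unit form" where
  "heap_form n x c Const = Neg (more_than 0 (row_form n x n))"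
| "heap_form n x c (Pow y) = Conj [Inp (sign_pos n x y), Neg (Inp (sign_pos n x y + 1)),
     exactly c (row_form n x n @ row_form n x y)]"
| "heap_form n x c (Inv y) = Conj [Inp (sign_pos n x y), Inp (sign_pos n x y + 1),
     exactly c (row_form n x n @ row_form n x y)]"
| "heap_form n x c (Plus x' i) = (if x' = x \<and> i = c then more_than c (row_form n x n) else FF)"

fun active_form :: "nat \<Rightarrow> pgate \<Rightarrow> unit form" where
  "active_form n Const = TT"
| "active_form n (Pow x) = Inp (x * (2 * n + 3))"
| "active_form n (Inv x) = Inp (x * (2 * n + 3))"
| "active_form n (Plus x i) = (if i = 0 then FF else more_than i (row_form n x n))"

fun kind_bits :: "pgate \<Rightarrow> bool list" where
  "kind_bits Const = [False, False]"
| "kind_bits (Pow x) = [True, True]"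
| "kind_bits (Inv x) = [True, False]"
| "kind_bits (Plus x i) = [False, True]"

text \<open>The flag \<open>b\<close> selects the second input. The input of \<open>Inv x\<close> is
  known without any counting.\<close>

fun input_form :: "nat \<Rightarrow> bool \<Rightarrow> pgate \<Rightarrow> pgate \<Rightarrow> unit form" where
  "input_form n b Const t = FF"
| "input_form n b (Pow x) t = (if b then FF else heap_form n x 1 t)"
| "input_form n b (Inv x) t = const_form (\<not> b \<and> t = Pow x)"
| "input_form n b (Plus x i) t = heap_form n x (2 * i + of_bool b) t"

text \<open>All gates that can occur for \<open>n\<close> node slots. Rows run up to
  \<open>n\<close> because of the marking, and tree vertices stay below \<open>n\<close> because no
  row has more than \<open>n\<close> entries.\<close>

definition pgate_slots :: "nat \<Rightarrow> pgate list" where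
  "pgate_slots n = [Const] @ map Pow [0..<n] @ map Inv [0..<n] @
     map (\<lambda>(x, i). Plus x i) (List.product [0..<n+1] [0..<n])"

definition slot_forms :: "nat \<Rightarrow> pgate \<Rightarrow> unit form list" where
  "slot_forms n s = map (\<lambda>\<phi>. Conj [active_form n s, \<phi>])
     ([TT, heap_form n n 1 s] @ map const_form (kind_bits s) @
      map (input_form n False s) (pgate_slots n) @ map (input_form n True s) (pgate_slots n))"

definition circuit_forms :: "nat \<Rightarrow> unit form list" where
  "circuit_forms n = concat (map (slot_forms n) (pgate_slots n))"

lemma distinct_pgate_slots: "distinct (pgate_slots n)"
  by (auto simp: pgate_slots_def distinct_map distinct_product inj_on_def)

lemma set_pgate_slots:
  "s \<in> set (pgate_slots n) \<longleftrightarrow> (case s of Const \<Rightarrow> True | Pow x \<Rightarrow> x < n | Inv x \<Rightarrow> x < n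
     | Plus x i \<Rightarrow> x \<le> n \<and> i < n)"
  by (cases s) (auto simp: pgate_slots_def)

text \<open>The index of a hit is the number of hits before it. This turns an access to the
  successor list into counting.\<close>

lemma length_filter_nth_iff:
  assumes "y < n" and "P y" and "j < length (filter P [0..<n])"
  shows "filter P [0..<n] ! j = y \<longleftrightarrow> length (filter P [0..<y]) = j"
proof -
  have "[0..<n] = [0..<y] @ y # [Suc y..<n]"
    using assms(1) upt_add_eq_append[of 0 y "n - y"] by (simp add: upt_conv_Cons)
  hence *: "filter P [0..<n] = filter P [0..<y] @ y # filter P [Suc y..<n]"
    using assms(2) by simp
  hence nth: "filter P [0..<n] ! length (filter P [0..<y]) = y"
    by (metis nth_append_length)
  moreover have "length (filter P [0..<y]) < length (filter P [0..<n])" using * by simp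
  moreover have "distinct (filter P [0..<n])" by simp
  ultimately show ?thesis using assms(3) nth_eq_iff_index_eq by metis
qed

locale encoded_power_circuit = slot_power_circuit +
  fixes w :: "bool list"
  assumes len: "length w = n * (2 * n + 3)"
    and active_bit: "x < n \<Longrightarrow> w ! (x * (2 * n + 3)) = a x"
    and sign_bit: "x \<le> n \<Longrightarrow> y < n \<Longrightarrow> b < 2 \<Longrightarrow> w ! (sign_pos n x y + b) = encode_sign (r x y) ! b"
begin

abbreviation "ev \<equiv> form_eval w (\<lambda>_. False)"

lemma sign_pos_less: "x \<le> n \<Longrightarrow> y < n \<Longrightarrow> sign_pos n x y + 1 < length w"
proof -
  assume *: "x \<le> n" "y < n"
  have "z * (2 * n + 3) + (2 * n + 3) \<le> n * (2 * n + 3)" if "z < n" for z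
    using mult_le_mono1[of "Suc z" n "2 * n + 3"] that by simp
  from this[of "if x = n then y else x"] show ?thesis
    using * unfolding len sign_pos_def by auto
qed

lemma active_pos_less: "x < n \<Longrightarrow> x * (2 * n + 3) < length w"
  unfolding len by simp

lemma ev_nz: "x \<le> n \<Longrightarrow> y < n \<Longrightarrow> ev (Inp (sign_pos n x y)) = (r x y \<noteq> 0)"
  using sign_pos_less[of x y] sign_bit[of x y 0] by (simp add: encode_sign_def)

lemma ev_neg: "x \<le> n \<Longrightarrow> y < n \<Longrightarrow> ev (Inp (sign_pos n x y + 1)) = (r x y < 0)"
  using sign_pos_less[of x y] sign_bit[of x y 1] by (simp add: encode_sign_def)

lemma length_filter_row:
  assumes "x \<le> n" and "m \<le> n"
  shows "length (filter ev (row_form n x m)) = length (filter (\<lambda>y. r x y \<noteq> 0) [0..<m])"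
proof -
  have "filter (ev \<circ> (\<lambda>y. Inp (sign_pos n x y))) [0..<m] = filter (\<lambda>y. r x y \<noteq> 0) [0..<m]"
    by (rule filter_cong) (use assms ev_nz in auto)
  thus ?thesis unfolding row_form_def filter_map length_map by (rule arg_cong)
qed

lemma length_filter_full_row: "x \<le> n \<Longrightarrow> length (filter ev (row_form n x n)) = cnt x"
  by (simp add: length_filter_row cnt_def succs_def)

lemma ev_active: "s \<in> set (pgate_slots n) \<Longrightarrow> ev (active_form n s) = active s"
  using active_bit active_pos_less length_filter_full_row
  by (cases s) (auto simp: set_pgate_slots)

lemma ev_heap:
  assumes "x \<le> n" and "t \<in> set (pgate_slots n)" and "1 \<le> c" and "cnt x = 0 \<or> c < 2 * cnt x"
  shows "ev (heap_form n x c t) = (t = heap_gate x c)"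
proof -
  \<comment> \<open>The full row contributes \<open>cnt x\<close> and its prefix contributes the
    index of \<open>y\<close> among the successors. Comparing their sum with \<open>c\<close>
    includes the test \<open>cnt x \<le> c\<close> for a leaf, and no difference has to be
    computed.\<close>
  have ex: "ev (exactly c (row_form n x n @ row_form n x y)) \<longleftrightarrow>
      cnt x \<le> c \<and> succs x ! (c - cnt x) = y" if "y < n" "r x y \<noteq> 0" for y
  proof -
    have "y \<in> set (succs x)" using that by (simp add: set_succs)
    hence "cnt x \<noteq> 0" by (auto simp: cnt_def)
    hence "succs x ! (c - cnt x) = y \<longleftrightarrow> length (filter (\<lambda>y. r x y \<noteq> 0) [0..<y]) = c - cnt x"
      unfolding succs_def by (intro length_filter_nth_iff) (use that assms in \<open>auto simp: cnt_def succs_def\<close>)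
    moreover have "length (filter ev (row_form n x n @ row_form n x y)) =
        cnt x + length (filter (\<lambda>y. r x y \<noteq> 0) [0..<y])"
      using length_filter_full_row[OF assms(1)] length_filter_row[OF assms(1), of y] that by simp
    ultimately show ?thesis unfolding eval_exactly by auto
  qed
  have 0: "r x y = 0" if "cnt x = 0" for y
    using that set_succs[of y x] by (auto simp: cnt_def)
  have pm: "r x y = 1 \<longleftrightarrow> r x y \<noteq> 0 \<and> \<not> r x y < 0" for y
    using r_range[of x y] by auto
  show ?thesis
  proof (cases t)
    case Const
    thus ?thesis using assms(1) by (auto simp: length_filter_full_row heap_gate_def Let_def)
  next
    case (Plus x' i)
    thus ?thesis using assms(1,3) by (auto simp: length_filter_full_row heap_gate_def Let_def)
  next
    case (Pow y)
    hence y: "y < n" using assms(2) by (simp add: set_pgate_slots)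
    have "ev (heap_form n x c t) \<longleftrightarrow> r x y = 1 \<and> cnt x \<le> c \<and> succs x ! (c - cnt x) = y"
      using ev_nz[OF assms(1) y] ev_neg[OF assms(1) y] ex[OF y] pm[of y] Pow by auto
    thus ?thesis using 0 Pow by (auto simp: heap_gate_def Let_def)
  next
    case (Inv y)
    hence y: "y < n" using assms(2) by (simp add: set_pgate_slots)
    have "ev (heap_form n x c t) \<longleftrightarrow>
        r x y \<noteq> 0 \<and> r x y \<noteq> 1 \<and> cnt x \<le> c \<and> succs x ! (c - cnt x) = y"
      using ev_nz[OF assms(1) y] ev_neg[OF assms(1) y] ex[OF y] pm[of y] Inv by auto
    thus ?thesis using 0 leaf(1)[of x c] assms(4) Inv by (auto simp: heap_gate_def Let_def)
  qed
qed

definition gate_slots :: "nat option list" where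
  "gate_slots = map (\<lambda>s. if active s then Some (to_nat s) else None) (pgate_slots n)"

lemma active_in_slots: "active s \<Longrightarrow> s \<in> set (pgate_slots n)"
proof (cases s)
  case (Plus x i)
  have "cnt x \<le> n" unfolding cnt_def succs_def by (rule order_trans[OF length_filter_le]) simp
  thus "active s \<Longrightarrow> s \<in> set (pgate_slots n)" using Plus by (simp add: set_pgate_slots)
qed (auto simp: set_pgate_slots)

lemma enumerates_gate_slots: "enumerates gate_slots (gates C)"
proof -
  have "{s \<in> set (pgate_slots n). active s} = S" using active_in_slots by auto
  thus ?thesis
    using enumerates_map_Some[OF distinct_pgate_slots[of n], where f = to_nat and P = active]
    by (simp add: gate_slots_def)
qed

lemma unit_vector_gate_slots:
  "active u \<Longrightarrow> unit_vector gate_slots (to_nat u) = map (\<lambda>t. t = u) (pgate_slots n)"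
  by (auto simp: unit_vector_def gate_slots_def)

lemma zero_vector_gate_slots: "zero_vector gate_slots = map (\<lambda>_. False) (pgate_slots n)"
  by (simp add: zero_vector_def gate_slots_def map_replicate_const)

lemma eval_circuit_forms: "map ev (circuit_forms n) = encode_circuit gate_slots C"
proof -
  have "map ev (slot_forms n s) = (case (if active s then Some (to_nat s) else None) of
            None \<Rightarrow> replicate (2 * length gate_slots + 4) False
          | Some g \<Rightarrow> True # (g = out_gate C) # encode_gate_op gate_slots (gate_op C g))"
    if s: "s \<in> set (pgate_slots n)" for s
  proof (cases "active s")
    case False
    have "map ev (slot_forms n s) = map (\<lambda>_. False) (slot_forms n s)"
      using False ev_active[OF s] by (auto simp: slot_forms_def)
    moreover have "length (slot_forms n s) = 2 * length gate_slots + 4"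
      by (cases s) (auto simp: slot_forms_def gate_slots_def)
    ultimately show ?thesis using False by (simp add: map_replicate_const)
  next
    case True
    have heap: "map (\<lambda>t. ev (heap_form n x c t)) (pgate_slots n) =
        unit_vector gate_slots (to_nat (heap_gate x c))"
      if "x \<le> n" "1 \<le> c" "cnt x = 0 \<or> c < 2 * cnt x" for x c
      using unit_vector_gate_slots[OF active_heap_gate[OF that]] ev_heap[OF that(1) _ that(2,3)]
      by auto
    have one: "cnt x = 0 \<or> 1 < 2 * cnt x" for x by linarith
    have "ev (heap_form n n 1 s) = (s = heap_gate n 1)"
      by (rule ev_heap[OF _ s _ one]) auto
    moreover have "map (\<lambda>t. ev (input_form n False s t)) (pgate_slots n) @
        map (\<lambda>t. ev (input_form n True s t)) (pgate_slots n) =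
        drop 2 (encode_gate_op gate_slots (gate_op C (to_nat s)))"
    proof (cases s)
      case (Inv x)
      thus ?thesis using True unit_vector_gate_slots[of "Pow x"] zero_vector_gate_slots by auto
    next
      case (Pow x)
      thus ?thesis using True heap[OF _ _ one] zero_vector_gate_slots by auto
    next
      case (Plus x i)
      thus ?thesis using True heap[of x "2 * i"] heap[of x "2 * i + 1"] by auto
    qed (simp add: zero_vector_gate_slots)
    moreover have "map ev (map const_form (kind_bits s)) =
        take 2 (encode_gate_op gate_slots (gate_op C (to_nat s)))"
      by (cases s) auto
    ultimately have "map ev (slot_forms n s) = True # (s = heap_gate n 1) #
        take 2 (encode_gate_op gate_slots (gate_op C (to_nat s))) @
        drop 2 (encode_gate_op gate_slots (gate_op C (to_nat s)))"
      using ev_active[OF s] True by (simp add: slot_forms_def comp_def del: coded_circuit_simps)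
    thus ?thesis using True by (simp add: append_take_drop_id)
  qed
  thus ?thesis
    unfolding circuit_forms_def encode_circuit_def map_concat gate_slots_def map_map comp_def
    by (intro arg_cong[of _ _ concat] map_cong[OF refl]) (simp add: gate_slots_def)
qed

end

section \<open>Fan-in, depth and size of the first construction\<close>

lemma form_bound_heap_form:
  assumes "c \<le> 2 * n + 1" and "t \<in> set (pgate_slots n)" and "8 * (n + 1) \<le> f"
  shows "form_bound f True 5 (heap_form n x c t)"
proof -
  have mt: "form_bound f True 2 (more_than k (row_form n x n))" if "k \<le> 2 * n + 1" for k
    by (rule form_bound_more_than) (use that assms in \<open>auto simp: row_form_def\<close>)
  have mt4: "form_bound f True 4 (more_than k (row_form n x n))" if "k \<le> 2 * n + 1" for k
    by (rule form_bound_mono[OF mt[OF that]]) simp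
  \<comment> \<open>The largest fan-in occurs here: fewer than \<open>2 * n\<close> formulas against
    a threshold of at most \<open>2 * n + 1\<close>, and padding doubles the sum of the two.\<close>
  have ex: "form_bound f True 4 (exactly c (row_form n x n @ row_form n x y))" if "y < n" for y
    by (rule form_bound_exactly) (use that assms in \<open>auto simp: row_form_def\<close>)
  show ?thesis
    using assms mt4[of 0] form_bound_mono[OF mt[of c], of 5] ex
    by (cases t) (auto simp: set_pgate_slots)
qed

text \<open>Depth 6 splits into 4 for \<open>exactly\<close>, one for the conjunction with the sign
  bits, and one for the conjunction with the activity.\<close>

lemma form_bound_circuit_forms:
  assumes "\<phi> \<in> set (circuit_forms n)"
  shows "form_bound (8 * (n + 1)) True 6 \<phi>"
proof -
  let ?f = "8 * (n + 1)"
  obtain s \<psi> where s: "s \<in> set (pgate_slots n)" and \<phi>: "\<phi> = Conj [active_form n s, \<psi>]"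
    and \<psi>: "\<psi> \<in> {TT, heap_form n n 1 s} \<union> const_form ` set (kind_bits s) \<union>
      input_form n False s ` set (pgate_slots n) \<union> input_form n True s ` set (pgate_slots n)"
    using assms by (auto simp: circuit_forms_def slot_forms_def)
  have "form_bound ?f True 5 (more_than i (row_form n x n))" if "i \<le> n" for i x
    by (rule form_bound_mono[OF form_bound_more_than]) (use that in \<open>auto simp: row_form_def\<close>)
  hence "form_bound ?f True 5 (active_form n s)"
    by (cases s) (use s in \<open>auto simp: set_pgate_slots\<close>)
  moreover have "form_bound ?f True 5 (input_form n b s t)" if "t \<in> set (pgate_slots n)" for b t
    by (cases s) (use s that in \<open>auto simp: set_pgate_slots[of "Plus x i" n for x i] set_pgate_slots[of "Pow x" n for x] intro!: form_bound_heap_form\<close>)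
  hence "form_bound ?f True 5 \<psi>"
    using \<psi> s by (auto intro!: form_bound_heap_form)
  ultimately show ?thesis unfolding \<phi> by simp
qed

lemma length_circuit_forms: "length (circuit_forms n) \<le> 96 * (n + 1) ^ 4"
proof -
  let ?m = "length (pgate_slots n)"
  have "length (slot_forms n s) = 2 * ?m + 4" for s
    by (cases s) (auto simp: slot_forms_def)
  hence "length (circuit_forms n) = ?m * (2 * ?m + 4)"
    unfolding circuit_forms_def
    by (subst length_concat_blocks[of _ "2 * ?m + 4"]) auto
  also have m: "?m = 1 + 3 * n + n * n"
    by (simp add: pgate_slots_def)
  hence "?m * (2 * ?m + 4) \<le> (4 * (n + 1)\<^sup>2) * (2 * (4 * (n + 1)\<^sup>2) + 4 * (4 * (n + 1)\<^sup>2))"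
    by (intro mult_le_mono add_le_mono) (auto simp: power2_eq_square algebra_simps)
  also have "\<dots> = 96 * ((n + 1)\<^sup>2 * (n + 1)\<^sup>2)" by (simp del: power2_sum)
  also have "\<dots> = 96 * (n + 1) ^ 4" by (simp only: flip: power_add) simp
  finally show ?thesis .
qed

lemma circuit_forms_in_TC0:
  "\<exists>F. in_TC0 F \<and> (\<forall>n w. length w = n * (2 * n + 3) \<longrightarrow>
     F w = map (form_eval w (\<lambda>_. False)) (circuit_forms n))"
proof -
  let ?len = "\<lambda>n::nat. n * (2 * n + 3)"
  let ?ev = "\<lambda>w. form_eval w (\<lambda>_::unit. False)"
  have "\<exists>B. wf_bcircuit (?len n) B \<and>
      (\<forall>w. length w = ?len n \<longrightarrow> bcircuit_eval B w = map (?ev w) (circuit_forms n)) \<and>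
      bcircuit_depth B \<le> 7 \<and>
      bcircuit_size B \<le> 10000000000 * (n + 1) ^ 10" for n
  proof -
    let ?N = "n + 1" and ?q = "length (circuit_forms n)" and ?f = "8 * (n + 1)"
    have "\<forall>\<phi>\<in>set (circuit_forms n). form_bound ?f True 6 \<phi>"
      using form_bound_circuit_forms by blast
    from compile_program[of "[]", OF _ this, where q = 0 and n = "?len n"]
    obtain B where B: "wf_bcircuit (?len n) B" "bcircuit_depth B \<le> 7"
      "\<forall>w. length w = ?len n \<longrightarrow> bcircuit_eval B w = map (?ev w) (circuit_forms n)"
      "bcircuit_size B \<le> ?len n + 1 + ?q * (2 * ?f + 1) ^ 6 + ?q"
      by auto
    have "?len n + 1 + ?q * (2 * ?f + 1) ^ 6 + ?q \<le> 10000000000 * (n + 1) ^ 10"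
    proof -
      \<comment> \<open>The cost per level is \<open>16 * ?N + 1\<close>, at most
        \<open>17 * ?N\<close>. Six levels and the degree 4 of the number of outputs make up the
        degree 10.\<close>
      have "?q * (2 * ?f + 1) ^ 6 \<le> (96 * ?N ^ 4) * (17 * ?N) ^ 6"
        by (intro mult_le_mono length_circuit_forms power_mono) auto
      also have "\<dots> = 2317206624 * ?N ^ 10"
        
        by (simp only: power_mult_distrib) (simp flip: power_add)
      moreover have "?q \<le> 96 * ?N ^ 10"
        by (rule order_trans[OF length_circuit_forms]) (intro mult_le_mono2 power_increasing; simp)
      moreover have "?len n + 1 \<le> 3 * ?N ^ 2" by (simp add: power2_eq_square algebra_simps)
      hence "?len n + 1 \<le> 3 * ?N ^ 10"
        by (rule order_trans) (intro mult_le_mono2 power_increasing; simp)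
      ultimately show ?thesis by simp
    qed
    thus ?thesis using B by (intro exI[of _ B]) auto
  qed
  then obtain B where B: "\<And>n. wf_bcircuit (?len n) (B n)"
    "\<And>n w. length w = ?len n \<Longrightarrow> bcircuit_eval (B n) w = map (?ev w) (circuit_forms n)"
    "\<And>n. bcircuit_depth (B n) \<le> 7" "\<And>n. bcircuit_size (B n) \<le> 10000000000 * (n + 1) ^ 10"
    by metis
  have "strict_mono ?len" by (intro strict_monoI mult_strict_mono') auto
  hence "inj ?len" by (rule strict_mono_imp_inj_on)
  from in_TC0_slot_family[OF this _ B(1,4,3)] B(2) show ?thesis by fastforce
qed


section \<open>Correctness of the first construction\<close>

lemma sum_slots:
  assumes "enumerates xs V"
  shows "(\<Sum>i<length xs. if xs ! i \<noteq> None then f (the (xs ! i)) else 0) = (\<Sum>g\<in>V. f g)"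
proof -
  have "(\<Sum>i<length xs. if xs ! i \<noteq> None then f (the (xs ! i)) else 0) =
      (\<Sum>i\<in>{i. i < length xs \<and> xs ! i \<noteq> None}. f (the (xs ! i)))"
    by (rule sum.mono_neutral_cong_right) auto
  also have "\<dots> = (\<Sum>g\<in>V. f g)"
    by (rule sum.reindex_bij_betw[OF enumerates_bij_betw[OF assms]])
  finally show ?thesis .
qed

lemma length_encode_sign [simp]: "length (encode_sign i) = 2"
  by (simp add: encode_sign_def)

lemma encode_pc_nth:
  fixes xs :: "'a option list"
  assumes "i < length xs"
  defines "n \<equiv> length xs"
  shows "length (encode_pc xs \<delta> M) = n * (2 * n + 3)"
    and "encode_pc xs \<delta> M ! (i * (2 * n + 3)) = (xs ! i \<noteq> None)"
    and "b < 2 \<Longrightarrow> encode_pc xs \<delta> M ! (i * (2 * n + 3) + (1 + b)) =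
      (case xs ! i of None \<Rightarrow> False | Some P \<Rightarrow> encode_sign (M P) ! b)"
    and "y < n \<Longrightarrow> b < 2 \<Longrightarrow> encode_pc xs \<delta> M ! (i * (2 * n + 3) + (3 + (y * 2 + b))) =
      (case xs ! i of None \<Rightarrow> False
       | Some P \<Rightarrow> encode_sign (case xs ! y of None \<Rightarrow> 0 | Some Q \<Rightarrow> \<delta> P Q) ! b)"
proof -
  define row where "row P = concat (map (\<lambda>y. encode_sign (case y of None \<Rightarrow> 0 | Some Q \<Rightarrow> \<delta> P Q)) xs)" for P
  define blk where "blk x = (case x of None \<Rightarrow> replicate (2 * length xs + 3) False
     | Some P \<Rightarrow> True # encode_sign (M P) @ row P)" for x
  have enc: "encode_pc xs \<delta> M = concat (map blk xs)"
    unfolding encode_pc_def blk_def row_def ..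
  have len_row: "length (row P) = n * 2" for P
    unfolding row_def n_def by (subst length_concat_blocks[of _ 2]) auto
  have len: "length (blk x) = 2 * n + 3" for x
    by (auto simp: blk_def len_row n_def split: option.split)
  show "length (encode_pc xs \<delta> M) = n * (2 * n + 3)"
    unfolding enc by (subst length_concat_blocks[of _ "2 * n + 3"]) (auto simp: len n_def)
  have nth: "encode_pc xs \<delta> M ! (i * (2 * n + 3) + j) = blk (xs ! i) ! j" if "j < 2 * n + 3" for j
    unfolding enc using assms that by (subst nth_concat_blocks) (auto simp: len)
  show "encode_pc xs \<delta> M ! (i * (2 * n + 3)) = (xs ! i \<noteq> None)"
    using nth[of 0] by (cases "xs ! i") (auto simp: blk_def)
  have blk_sign: "blk x ! (1 + b) = (case x of None \<Rightarrow> False | Some P \<Rightarrow> encode_sign (M P) ! b)"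
    if "b < 2" for x b
    using that by (cases x) (auto simp: blk_def nth_append)
  show "encode_pc xs \<delta> M ! (i * (2 * n + 3) + (1 + b)) =
      (case xs ! i of None \<Rightarrow> False | Some P \<Rightarrow> encode_sign (M P) ! b)" if "b < 2"
    using nth[of "1 + b"] that unfolding blk_sign[OF that] by simp
  assume y: "y < n" and b: "b < 2"
  have "row P ! (y * 2 + b) = encode_sign (case xs ! y of None \<Rightarrow> 0 | Some Q \<Rightarrow> \<delta> P Q) ! b" for P
    unfolding row_def using y b by (subst nth_concat_blocks) (auto simp: n_def)
  moreover have "blk x ! (3 + k) = (case x of None \<Rightarrow> False | Some P \<Rightarrow> row P ! k)" if "k < 2 * n" for x k
    using that by (cases x) (auto simp: blk_def n_def nth_append)
  moreover have "y * 2 + b < 2 * n" "3 + (y * 2 + b) < 2 * n + 3" using y b by simp_all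
  ultimately show "encode_pc xs \<delta> M ! (i * (2 * n + 3) + (3 + (y * 2 + b))) =
      (case xs ! i of None \<Rightarrow> False
       | Some P \<Rightarrow> encode_sign (case xs ! y of None \<Rightarrow> 0 | Some Q \<Rightarrow> \<delta> P Q) ! b)"
    by (simp only: nth)
qed

lemma dag_depth_attained:
  assumes "finite V" and "acyclic E" and "V \<noteq> {}"
  obtains p where "dag_path V E p" and "length p = dag_depth V E + 1"
proof -
  let ?S = "{length p - 1 | p. dag_path V E p}"
  obtain x where "x \<in> V" using assms(3) by auto
  hence "dag_path V E [x]" by (simp add: dag_path_def)
  hence ne: "?S \<noteq> {}" by auto
  have "?S = (\<lambda>p. length p - 1) ` {p. dag_path V E p}" by auto
  hence fin: "finite ?S" using finite_dag_paths[OF assms(1,2)] by simp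
  have "dag_depth V E \<in> ?S"
    unfolding dag_depth_def using Max_in[OF fin ne] cSup_eq_Max[OF fin ne] by simp
  then obtain p where "dag_path V E p" "dag_depth V E = length p - 1" by auto
  thus thesis using that[of p] by (cases p) (auto simp: dag_path_def)
qed

lemma circuit_forms_correct:
  fixes \<Pi> :: "'a set" and xs :: "'a option list"
  assumes pc: "power_circuit \<Pi> \<delta>" and M: "marking \<Pi> M" and xs: "enumerates xs \<Pi>"
  shows "\<exists>(C :: nat circuit) ys.
             circuit C \<and> enumerates ys (gates C) \<and>
             map (form_eval (encode_pc xs \<delta> M) (\<lambda>_. False)) (circuit_forms (length xs)) = encode_circuit ys C \<and>
             circuit_eval C = marking_eval \<Pi> \<delta> M \<and>
             circuit_size C \<le> 2 * card (pc_edges \<Pi> \<delta>) + 3 * card \<Pi> + 1 \<and>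
             circuit_depth C \<le> (pc_depth \<Pi> \<delta> + 2) * (nat \<lceil>log 2 (real (card \<Pi>))\<rceil> + 2) \<and>
             (\<Pi> \<noteq> {} \<longrightarrow> circuit_depth_exp2 C = pc_depth \<Pi> \<delta> + 1)"
proof -
  define n where "n = length xs"
  define a where "a x = (xs ! x \<noteq> None)" for x
  define P where "P x = the (xs ! x)" for x
  define r where "r x y = (if y < n \<and> a y then if x = n then M (P y)
     else if x < n \<and> a x then \<delta> (P x) (P y) else 0 else 0)" for x y
  define v where "v x = node_eval \<Pi> \<delta> (P x)" for x
  define D where "D = pc_depth \<Pi> \<delta>"
  define L where "L = nat \<lceil>log 2 (real (card \<Pi>))\<rceil>"
  have gpc: "generalized_power_circuit \<Pi> \<delta>" using pc by (simp add: power_circuit_def)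
  hence fin: "finite \<Pi>" and acyc: "acyclic (pc_edges \<Pi> \<delta>)"
    and mark: "\<And>P. P \<in> \<Pi> \<Longrightarrow> marking \<Pi> (succ_marking \<delta> P)"
    by (auto simp: generalized_power_circuit_def)
  have sub: "pc_edges \<Pi> \<delta> \<subseteq> \<Pi> \<times> \<Pi>" by (auto simp: pc_edges_def)
  obtain H :: "'a \<Rightarrow> nat" where H: "\<And>x y. (x, y) \<in> pc_edges \<Pi> \<delta> \<Longrightarrow> 1 + H y \<le> H x"
    "\<And>x. x \<in> \<Pi> \<Longrightarrow> \<exists>p. dag_path \<Pi> (pc_edges \<Pi> \<delta>) p \<and> hd p = x \<and> H x = sum_list (map (\<lambda>_. 1) p)"
    "\<And>x. x \<in> \<Pi> \<Longrightarrow> 1 \<le> H x"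
    by (rule dag_height[OF fin acyc sub, where wt = "\<lambda>_. 1"]) blast
  \<comment> \<open>\<open>H\<close> counts vertices, whereas \<open>ht\<close>, like
    \<open>pc_depth\<close>, counts edges.\<close>
  define ht where "ht x = H (P x) - 1" for x
  have P: "P x \<in> \<Pi>" "xs ! x = Some (P x)" if "x < n" "a x" for x
  proof -
    show *: "xs ! x = Some (P x)" using that by (auto simp: a_def P_def)
    show "P x \<in> \<Pi>" using enumerates_set[OF xs, of "P x"] * that nth_mem[of x xs] by (simp add: n_def)
  qed
  have sum: "(\<Sum>x<n. if a x then f (P x) else 0) = (\<Sum>g\<in>\<Pi>. f g)" for f :: "'a \<Rightarrow> 'b::comm_monoid_add"
    unfolding n_def a_def P_def by (rule sum_slots[OF xs])
  have card: "card {x. x < n \<and> a x} = card \<Pi>"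
    using bij_betw_same_card[OF enumerates_bij_betw[OF xs]] by (simp add: n_def a_def)
  have row: "(\<Sum>y<n. of_int (r x y) * v y) = marking_eval \<Pi> \<delta> (if x = n then M else succ_marking \<delta> (P x))"
    if "x = n \<or> x < n \<and> a x" for x
  proof -
    have "(\<Sum>y<n. of_int (r x y) * v y) = (\<Sum>y<n. if a y
        then of_int ((if x = n then M else succ_marking \<delta> (P x)) (P y)) * node_eval \<Pi> \<delta> (P y) else 0)"
      by (rule sum.cong) (use that in \<open>auto simp: r_def v_def succ_marking_def\<close>)
    also have "\<dots> = (\<Sum>Q\<in>\<Pi>. of_int ((if x = n then M else succ_marking \<delta> (P x)) Q) * node_eval \<Pi> \<delta> Q)"
      by (rule sum)
    finally show ?thesis by (simp add: marking_eval_def)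
  qed
  have "card \<Pi> \<le> 2 ^ L"
  proof (cases "card \<Pi> = 0")
    case False
    hence "real (card \<Pi>) = 2 powr log 2 (real (card \<Pi>))" by simp
    also have "\<dots> \<le> 2 powr real L" unfolding L_def by (intro powr_mono) linarith+
    finally have "real (card \<Pi>) \<le> real (2 ^ L)" by (simp add: powr_realpow)
    thus ?thesis by (simp only: of_nat_le_iff)
  qed simp
  interpret encoded_power_circuit n a r v ht D L "encode_pc xs \<delta> M"
  proof unfold_locales
    show "r x y \<in> {- 1, 0, 1}" for x y
      using M mark[of "P x"] P[of x] P[of y] by (auto simp: r_def marking_def succ_marking_def)
    show "y < n \<and> a y \<and> (x = n \<or> x < n \<and> a x)" if "r x y \<noteq> 0" for x y
      using that by (auto simp: r_def split: if_splits)
    show "v x = 2 powr (\<Sum>y<n. of_int (r x y) * v y)" if "x < n" "a x" for x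
      using node_eval_eq[OF gpc P(1)[OF that]] row[of x] that by (simp add: v_def)
    show "ht y < ht x" if "x < n" "r x y \<noteq> 0" for x y
    proof -
      have "(P x, P y) \<in> pc_edges \<Pi> \<delta>" "P y \<in> \<Pi>"
        using that P by (auto simp: r_def pc_edges_def split: if_splits)
      thus ?thesis using H(1)[of "P x" "P y"] H(3)[of "P y"] by (simp add: ht_def)
    qed
    show "ht x \<le> D" if "x < n" "a x" for x
    proof -
      have "P x \<in> \<Pi>" using P(1) that .
      then obtain p where p: "dag_path \<Pi> (pc_edges \<Pi> \<delta>) p" "H (P x) = sum_list (map (\<lambda>_. 1) p)"
        using H(2) by blast
      have "length p - 1 \<le> pc_depth \<Pi> \<delta>"
        using le_Sup_dag_paths[OF fin acyc p(1), of "\<lambda>p. length p - 1"]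
        by (simp add: pc_depth_def dag_depth_def)
      thus ?thesis using p(2) by (simp add: ht_def D_def sum_list_triv)
    qed
    show "card {x. x < n \<and> a x} \<le> 2 ^ L" using card \<open>card \<Pi> \<le> 2 ^ L\<close> by simp
    show "length (encode_pc xs \<delta> M) = n * (2 * n + 3)"
      using encode_pc_nth(1)[of 0 xs \<delta> M] by (cases "xs = []") (auto simp: n_def encode_pc_def)
    show "encode_pc xs \<delta> M ! (x * (2 * n + 3)) = a x" if "x < n" for x
      using encode_pc_nth(2)[of x xs \<delta> M] that by (simp add: n_def a_def)
    show "encode_pc xs \<delta> M ! (sign_pos n x y + b) = encode_sign (r x y) ! b"
      if "x \<le> n" "y < n" "b < 2" for x y b
    proof (cases "x = n")
      case True
      thus ?thesis using encode_pc_nth(3)[of y xs b \<delta> M] that less_2_cases[OF that(3)]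
        by (auto simp: sign_pos_def n_def r_def a_def P_def encode_sign_def split: option.splits)
    next
      case False
      hence pos: "sign_pos n x y + b = x * (2 * n + 3) + (3 + (y * 2 + b))" by (simp add: sign_pos_def)
      show ?thesis unfolding pos
        using encode_pc_nth(4)[of x xs y b \<delta> M] False that less_2_cases[OF that(3)]
        by (auto simp: n_def r_def a_def P_def encode_sign_def split: option.splits)
    qed
  qed
  have cnt_sum: "(\<Sum>x<n. cnt x) = card (pc_edges \<Pi> \<delta>)"
  proof -
    have cnt: "cnt x = (if a x then (\<Sum>Q\<in>\<Pi>. of_bool (\<delta> (P x) Q \<noteq> 0)) else 0)" if "x < n" for x
    proof -
      have "cnt x = (\<Sum>y\<leftarrow>[0..<n]. of_bool (r x y \<noteq> 0))"
        by (simp add: cnt_def succs_def length_filter_eq_sum)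
      also have "\<dots> = (\<Sum>y<n. of_bool (r x y \<noteq> 0))"
        by (simp add: interv_sum_list_conv_sum_set_nat atLeast0LessThan)
      also have "\<dots> = (\<Sum>y<n. if a y then of_bool (a x \<and> \<delta> (P x) (P y) \<noteq> 0) else 0)"
        by (rule sum.cong) (use that in \<open>auto simp: r_def\<close>)
      also have "\<dots> = (\<Sum>Q\<in>\<Pi>. of_bool (a x \<and> \<delta> (P x) Q \<noteq> 0))" by (rule sum)
      finally show ?thesis by simp
    qed
    have "(\<Sum>x<n. cnt x) = (\<Sum>x<n. if a x then (\<Sum>Q\<in>\<Pi>. of_bool (\<delta> (P x) Q \<noteq> 0)) else 0)"
      by (rule sum.cong) (use cnt in auto)
    also have "\<dots> = (\<Sum>R\<in>\<Pi>. \<Sum>Q\<in>\<Pi>. of_bool (\<delta> R Q \<noteq> 0))" by (rule sum)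
    also have "\<dots> = (\<Sum>R\<in>\<Pi>. card {Q \<in> \<Pi>. \<delta> R Q \<noteq> 0})"
      using fin by (simp add: Int_def)
    also have "\<dots> = card (SIGMA R:\<Pi>. {Q \<in> \<Pi>. \<delta> R Q \<noteq> 0})"
      using fin by simp
    also have "(SIGMA R:\<Pi>. {Q \<in> \<Pi>. \<delta> R Q \<noteq> 0}) = pc_edges \<Pi> \<delta>"
      by (auto simp: pc_edges_def)
    finally show ?thesis .
  qed
  have "circuit_depth_exp2 C = D + 1" if ne: "\<Pi> \<noteq> {}"
  proof -
    \<comment> \<open>A longest path has \<open>D + 1\<close> nodes if there is a node at all. The
      empty power circuit also has depth 0, but yields no \<open>2\<^sup>x\<close>-gate.\<close>
    obtain p where p: "dag_path \<Pi> (pc_edges \<Pi> \<delta>) p" "length p = D + 1"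
      using dag_depth_attained[OF fin acyc ne] unfolding D_def pc_depth_def by blast
    have "\<exists>x. x < n \<and> a x \<and> P x = Q" if "Q \<in> \<Pi>" for Q
      using that enumerates_set[OF xs, of Q] by (force simp: in_set_conv_nth n_def a_def P_def)
    then obtain pos where pos: "\<And>Q. Q \<in> \<Pi> \<Longrightarrow> pos Q < n \<and> a (pos Q) \<and> P (pos Q) = Q" by metis
    show ?thesis
    proof (rule depth_exp2)
      have "successively (\<lambda>x y. r (pos x) (pos y) \<noteq> 0) p"
        by (rule successively_mono[of "\<lambda>x y. (x, y) \<in> pc_edges \<Pi> \<delta>"])
           (use p pos in \<open>auto simp: dag_path_def pc_edges_def r_def\<close>)
      thus "successively (\<lambda>x y. r x y \<noteq> 0) (map pos p)" by (simp add: successively_map)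
      show "\<forall>x\<in>set (map pos p). x < n \<and> a x" using p pos by (auto simp: dag_path_def)
    qed (use p in simp)
  qed
  moreover have "circuit_depth C \<le> (D + 2) * (L + 2)"
    by (rule order_trans[OF depth]) (intro mult_le_mono1, simp)
  moreover have "circuit_size C \<le> 2 * card (pc_edges \<Pi> \<delta>) + 3 * card \<Pi> + 1"
    using size card cnt_sum by simp
  moreover have "circuit_eval C = marking_eval \<Pi> \<delta> M" using eval row[of n] by simp
  ultimately show ?thesis
    using circuit enumerates_gate_slots eval_circuit_forms unfolding D_def L_def n_def by blast
qed


section \<open>Binary arithmetic in logarithmic depth\<close>

abbreviation nc_bound :: "nat \<Rightarrow> 'r form \<Rightarrow> bool" where
  "nc_bound \<equiv> form_bound 2 False"

section \<open>Connectives as balanced binary trees\<close>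

function balanced :: "('r form list \<Rightarrow> 'r form) \<Rightarrow> 'r form list \<Rightarrow> 'r form" where
  "balanced G \<phi>s = (if length \<phi>s \<le> 1 then G \<phi>s
     else G [balanced G (take (length \<phi>s div 2) \<phi>s), balanced G (drop (length \<phi>s div 2) \<phi>s)])"
  by auto
termination
  by (relation "measure (\<lambda>(G, \<phi>s). length \<phi>s)") auto

declare balanced.simps [simp del]

lemma eval_balanced [simp]:
  shows "form_eval w e (balanced Disj \<phi>s) \<longleftrightarrow> (\<exists>\<phi>\<in>set \<phi>s. form_eval w e \<phi>)" (is "?D \<phi>s")
    and "form_eval w e (balanced Conj \<phi>s) \<longleftrightarrow> (\<forall>\<phi>\<in>set \<phi>s. form_eval w e \<phi>)" (is "?C \<phi>s")
proof -
  have "?D \<phi>s \<and> ?C \<phi>s"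
  proof (induction \<phi>s rule: length_induct)
    case (1 \<phi>s)
    show ?case
    proof (cases "length \<phi>s \<le> 1")
      case False
      let ?h = "length \<phi>s div 2"
      have "set \<phi>s = set (take ?h \<phi>s) \<union> set (drop ?h \<phi>s)" by (simp flip: set_append)
      thus ?thesis using 1 False by (simp add: balanced.simps[of _ \<phi>s] ball_Un bex_Un)
    qed (simp add: balanced.simps)
  qed
  thus "?D \<phi>s" and "?C \<phi>s" by simp_all
qed

text \<open>There are \<open>m\<close> levels of halving and one for the connective at a leaf, whose
  list has at most one element; for the empty list that connective is the constant.\<close>

lemma nc_bound_balanced:
  assumes "length \<phi>s \<le> 2 ^ m" and "\<forall>\<phi>\<in>set \<phi>s. nc_bound d \<phi>" and "G = Conj \<or> G = Disj"
    and "d + m + 1 \<le> d'"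
  shows "nc_bound d' (balanced G \<phi>s)"
proof -
  have "nc_bound (d + m + 1) (balanced G \<phi>s)"
    using assms(1,2)
  proof (induction m arbitrary: \<phi>s)
    case 0
    hence "nc_bound (d + 0 + 1) (G \<phi>s)" using assms(3) by auto
    thus ?case using 0 by (subst balanced.simps) auto
  next
    case (Suc m)
    let ?h = "length \<phi>s div 2"
    show ?case
    proof (cases "length \<phi>s \<le> 1")
      case True
      have "nc_bound (d + Suc m) \<phi>" if "\<phi> \<in> set \<phi>s" for \<phi>
        using Suc.prems that form_bound_mono by (metis le_add1)
      hence "nc_bound (d + Suc m + 1) (G \<phi>s)"
        using True assms(3) by auto
      thus ?thesis using True by (simp add: balanced.simps)
    next
      case False
      have "nc_bound (d + m + 1) (balanced G (take ?h \<phi>s))"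
        using Suc.prems by (intro Suc.IH) (auto dest: in_set_takeD)
      moreover have "nc_bound (d + m + 1) (balanced G (drop ?h \<phi>s))"
        using Suc.prems by (intro Suc.IH) (auto dest: in_set_dropD)
      ultimately show ?thesis using False assms(3) by (subst balanced.simps) auto
    qed
  qed
  thus ?thesis using assms(4) by (rule form_bound_mono)
qed

definition xor2 :: "'r form \<Rightarrow> 'r form \<Rightarrow> 'r form" where
  "xor2 \<phi> \<psi> = Disj [Conj [\<phi>, Neg \<psi>], Conj [Neg \<phi>, \<psi>]]"

definition xor3 :: "'r form \<Rightarrow> 'r form \<Rightarrow> 'r form \<Rightarrow> 'r form" where
  "xor3 \<phi> \<psi> \<chi> = xor2 (xor2 \<phi> \<psi>) \<chi>"

definition maj3 :: "'r form \<Rightarrow> 'r form \<Rightarrow> 'r form \<Rightarrow> 'r form" where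
  "maj3 \<phi> \<psi> \<chi> = Disj [Conj [\<phi>, \<psi>], Conj [\<chi>, Disj [\<phi>, \<psi>]]]"

lemma eval_xor2 [simp]: "form_eval w e (xor2 \<phi> \<psi>) \<longleftrightarrow> form_eval w e \<phi> \<noteq> form_eval w e \<psi>"
  by (auto simp: xor2_def)

lemma eval_xor3 [simp]:
  "form_eval w e (xor3 \<phi> \<psi> \<chi>) \<longleftrightarrow> ((form_eval w e \<phi> \<noteq> form_eval w e \<psi>) \<noteq> form_eval w e \<chi>)"
  by (simp add: xor3_def)

lemma eval_maj3 [simp]:
  "form_eval w e (maj3 \<phi> \<psi> \<chi>) \<longleftrightarrow> form_eval w e \<phi> \<and> form_eval w e \<psi> \<or>
     form_eval w e \<chi> \<and> (form_eval w e \<phi> \<or> form_eval w e \<psi>)"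
  by (auto simp: maj3_def)

lemma nc_bound_xor2: "nc_bound d \<phi> \<Longrightarrow> nc_bound d \<psi> \<Longrightarrow> nc_bound (d + 3) (xor2 \<phi> \<psi>)"
  using form_bound_mono[of 2 False d _ "d + 1"]
  by (auto simp: xor2_def numeral_3_eq_3)

lemma nc_bound_xor3:
  "nc_bound d \<phi> \<Longrightarrow> nc_bound d \<psi> \<Longrightarrow> nc_bound d \<chi> \<Longrightarrow> nc_bound (d + 6) (xor3 \<phi> \<psi> \<chi>)"
  using nc_bound_xor2[of "d + 3" "xor2 \<phi> \<psi>" \<chi>] nc_bound_xor2[of d \<phi> \<psi>]
    form_bound_mono[of 2 False d \<chi> "d + 3"]
  by (simp add: xor3_def add.assoc)

lemma nc_bound_maj3:
  "nc_bound d \<phi> \<Longrightarrow> nc_bound d \<psi> \<Longrightarrow> nc_bound d \<chi> \<Longrightarrow> nc_bound (d + 3) (maj3 \<phi> \<psi> \<chi>)"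
  using form_bound_mono[of 2 False d _ "d + 1"]
  by (auto simp: maj3_def numeral_3_eq_3)

section \<open>Carry-save addition\<close>

type_synonym 'r word_form = "nat \<Rightarrow> 'r form"

definition cs_sum :: "'r word_form \<Rightarrow> 'r word_form \<Rightarrow> 'r word_form \<Rightarrow> 'r word_form" where
  "cs_sum a b c l = xor3 (a l) (b l) (c l)"

definition cs_carry :: "'r word_form \<Rightarrow> 'r word_form \<Rightarrow> 'r word_form \<Rightarrow> 'r word_form" where
  "cs_carry a b c l = (if l = 0 then FF else maj3 (a (l - 1)) (b (l - 1)) (c (l - 1)))"

text \<open>A binary tree of carry-save adders turns a sum of \<open>2 ^ m\<close> words into a sum of two words. Each
  bit of either word depends on a bounded number of bits of the words one level below.\<close>

primrec csa_tree :: "nat \<Rightarrow> (nat \<Rightarrow> 'r word_form) \<Rightarrow> nat \<Rightarrow> 'r word_form \<times> 'r word_form" where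
  "csa_tree 0 W t = (W t, \<lambda>_. FF)"
| "csa_tree (Suc m) W t =
     (let (a, b) = csa_tree m W (2 * t); (c, d) = csa_tree m W (2 * t + 1);
          s = cs_sum a b c; k = cs_carry a b c
      in (cs_sum s k d, cs_carry s k d))"

text \<open>Integers are read in infinite two's complement, so that only the lower \<open>n\<close> bits matter.\<close>

definition represents :: "nat \<Rightarrow> ('r form \<Rightarrow> bool) \<Rightarrow> 'r word_form \<Rightarrow> int \<Rightarrow> bool" where
  "represents n ev a x \<longleftrightarrow> (\<forall>l<n. ev (a l) = bit x l)"

text \<open>The half adder on all bits at once: \<open>or\<close> is the disjoint union of
  \<open>xor\<close> and \<open>and\<close>, and \<open>x + y\<close> is the sum of
  \<open>and x y\<close> and \<open>or x y\<close>.\<close>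

lemma add_eq_xor_and: "x + y = xor x y + 2 * and x y" for x y :: int
proof -
  have "or x y = xor x y + and x y"
    by (subst disjunctive_add_eq_or) (auto simp: bit_eq_iff bit_simps)
  thus ?thesis using plus_and_or[of x y] by simp
qed

text \<open>The full adder on all bits at once, made of two half adders. The two carries have
  disjoint bits, so that their sum is the bitwise majority \<open>c\<close>.\<close>

lemma carry_save_int:
  fixes x y z :: int
  obtains s k where "x + y + z = s + k" and "\<And>l. bit s l = ((bit x l \<noteq> bit y l) \<noteq> bit z l)"
    and "\<And>l. bit k l = (l > 0 \<and> (bit x (l - 1) \<and> bit y (l - 1) \<or>
           bit z (l - 1) \<and> (bit x (l - 1) \<or> bit y (l - 1))))"
proof -
  define c where "c = or (and x y) (and (xor x y) z)"
  have c: "c = and x y + and (xor x y) z"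
    unfolding c_def by (subst disjunctive_add_eq_or) (auto simp: bit_eq_iff bit_simps)
  show thesis
  proof (rule that[of "xor (xor x y) z" "2 * c"])
    show "x + y + z = xor (xor x y) z + 2 * c"
      using add_eq_xor_and[of x y] add_eq_xor_and[of "xor x y" z] c by simp
    show "bit (2 * c) l = (l > 0 \<and> (bit x (l - 1) \<and> bit y (l - 1) \<or>
           bit z (l - 1) \<and> (bit x (l - 1) \<or> bit y (l - 1))))" for l
      by (cases l) (auto simp: c_def bit_simps bit_double_iff)
  qed (auto simp: bit_simps)
qed

lemma represents_carry_save:
  assumes "represents n (form_eval w e) a x" and "represents n (form_eval w e) b y"
    and "represents n (form_eval w e) c z"
  obtains s k where "x + y + z = s + k" and "represents n (form_eval w e) (cs_sum a b c) s"
    and "represents n (form_eval w e) (cs_carry a b c) k"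
proof -
  obtain s k where sk: "x + y + z = s + k" "\<And>l. bit s l = ((bit x l \<noteq> bit y l) \<noteq> bit z l)"
    "\<And>l. bit k l = (l > 0 \<and> (bit x (l - 1) \<and> bit y (l - 1) \<or>
           bit z (l - 1) \<and> (bit x (l - 1) \<or> bit y (l - 1))))"
    by (rule carry_save_int[of x y z], rule that)
  show thesis
    by (rule that[OF sk(1)])
       (use assms in \<open>auto simp: represents_def cs_sum_def cs_carry_def sk(2,3)\<close>)
qed

lemma sum_lessThan_add: "(\<Sum>j<k + l. g j) = (\<Sum>j<k. g j) + (\<Sum>j<l. g (k + j))" for k l :: nat
  by (induction l) (auto simp: add.assoc)

text \<open>Two carry-save steps turn the four words of the subtrees into two. Output bit
  \<open>l\<close> depends on input bits up to \<open>l\<close> only, so knowledge of the lower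
  \<open>n\<close> bits is preserved.\<close>

lemma represents_csa_tree:
  assumes "\<And>t. represents n (form_eval w e) (W t) (v t)"
  shows "\<exists>x y. represents n (form_eval w e) (fst (csa_tree m W t)) x \<and>
      represents n (form_eval w e) (snd (csa_tree m W t)) y \<and> x + y = (\<Sum>j<2^m. v (t * 2 ^ m + j))"
proof (induction m arbitrary: t)
  case 0
  show ?case
    by (rule exI[of _ "v t"], rule exI[of _ 0]) (use assms in \<open>auto simp: represents_def\<close>)
next
  case (Suc m)
  let ?ev = "form_eval w e"
  obtain a b where ab: "csa_tree m W (2 * t) = (a, b)" by fastforce
  obtain c d where cd: "csa_tree m W (2 * t + 1) = (c, d)" by fastforce
  obtain x y where xy: "represents n ?ev a x" "represents n ?ev b y"
    "x + y = (\<Sum>j<2^m. v (2 * t * 2 ^ m + j))"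
    using Suc.IH[of "2 * t"] unfolding ab by auto
  obtain z u where zu: "represents n ?ev c z" "represents n ?ev d u"
    "z + u = (\<Sum>j<2^m. v ((2 * t + 1) * 2 ^ m + j))"
    using Suc.IH[of "2 * t + 1"] unfolding cd by auto
  obtain s k where sk: "x + y + z = s + k" "represents n ?ev (cs_sum a b c) s"
    "represents n ?ev (cs_carry a b c) k"
    using represents_carry_save[OF xy(1,2) zu(1)] by blast
  obtain s' k' where sk': "s + k + u = s' + k'"
    "represents n ?ev (cs_sum (cs_sum a b c) (cs_carry a b c) d) s'"
    "represents n ?ev (cs_carry (cs_sum a b c) (cs_carry a b c) d) k'"
    using represents_carry_save[OF sk(2,3) zu(2)] by blast
  have "(\<Sum>j<2^Suc m. v (t * 2 ^ Suc m + j)) =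
      (\<Sum>j<2^m. v (t * 2 ^ Suc m + j)) + (\<Sum>j<2^m. v (t * 2 ^ Suc m + (2 ^ m + j)))"
    using sum_lessThan_add[of "\<lambda>j. v (t * 2 ^ Suc m + j)" "2 ^ m" "2 ^ m"] by (simp add: mult_2)
  also have "\<dots> = x + y + (z + u)"
    unfolding xy(3) zu(3) by (simp add: algebra_simps)
  also have "\<dots> = s' + k'" using sk(1) sk'(1) by simp
  finally show ?case using sk'(2,3) unfolding csa_tree.simps ab cd by (auto simp: Let_def)
qed

lemma nc_bound_cs:
  assumes "\<And>l. nc_bound d (a l)" and "\<And>l. nc_bound d (b l)" and "\<And>l. nc_bound d (c l)"
  shows "nc_bound (d + 6) (cs_sum a b c l)" and "nc_bound (d + 6) (cs_carry a b c l)"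
  using nc_bound_xor3[of d "a l" "b l" "c l"]
    form_bound_mono[OF nc_bound_maj3[of d "a (l - 1)" "b (l - 1)" "c (l - 1)"], of "d + 6"] assms
  by (auto simp: cs_sum_def cs_carry_def)

text \<open>Each level consists of two carry-save adders of depth 6.\<close>

lemma nc_bound_csa_tree:
  assumes "\<And>t l. nc_bound d (W t l)" and "1 \<le> d"
  shows "nc_bound (d + 12 * m) (fst (csa_tree m W t) l) \<and> nc_bound (d + 12 * m) (snd (csa_tree m W t) l)"
proof (induction m arbitrary: t l)
  case (Suc m)
  let ?d = "d + 12 * m"
  obtain a b where ab: "csa_tree m W (2 * t) = (a, b)" by fastforce
  obtain c d' where cd: "csa_tree m W (2 * t + 1) = (c, d')" by fastforce
  have *: "nc_bound ?d (a l)" "nc_bound ?d (b l)" "nc_bound ?d (c l)" "nc_bound (?d + 6) (d' l)" for l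
    using Suc.IH[of "2 * t"] Suc.IH[of "2 * t + 1"] unfolding ab cd
    by (auto intro: form_bound_mono[of 2 False ?d])
  have "nc_bound (?d + 6 + 6) (cs_sum (cs_sum a b c) (cs_carry a b c) d' l)"
    "nc_bound (?d + 6 + 6) (cs_carry (cs_sum a b c) (cs_carry a b c) d' l)"
    by (intro nc_bound_cs *)+
  thus ?case unfolding csa_tree.simps ab cd by (simp add: Let_def ac_simps)
qed (use assms in auto)

section \<open>Carry lookahead\<close>

primrec carry :: "bool \<Rightarrow> (nat \<Rightarrow> bool) \<Rightarrow> (nat \<Rightarrow> bool) \<Rightarrow> nat \<Rightarrow> bool" where
  "carry c p q 0 = c"
| "carry c p q (Suc l) = (p l \<and> q l \<or> carry c p q l \<and> (p l \<or> q l))"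

text \<open>The recursion of \<open>carry\<close> splits off the highest position. This form splits
  off the lowest one, as the halving of the summands in \<open>bit_add_carry\<close>
  requires.\<close>

lemma carry_shift:
  "carry c p q (Suc l) =
     carry (p 0 \<and> q 0 \<or> c \<and> (p 0 \<or> q 0)) (\<lambda>l. p (Suc l)) (\<lambda>l. q (Suc l)) l"
  by (induction l) auto

text \<open>Induction on \<open>l\<close> for all summands: halving shifts the bits down by one, and
  the carry out of position 0 becomes the new incoming carry \<open>?c\<close>. Since
  \<open>div\<close> rounds down, this holds for negative summands too.\<close>

lemma bit_add_carry:
  "bit (x + y + of_bool c) l = ((bit x l \<noteq> bit y l) \<noteq> carry c (bit x) (bit y) l)" for x y :: int
proof (induction l arbitrary: x y c)
  case 0
  show ?case by (cases c) (auto simp: bit_0)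
next
  case (Suc l)
  let ?c = "odd x \<and> odd y \<or> c \<and> (odd x \<or> odd y)"
  have "(x + y + of_bool c) div 2 = x div 2 + y div 2 + of_bool ?c"
    by (cases c; cases "even x"; cases "even y") (auto elim!: evenE oddE)
  hence "bit (x + y + of_bool c) (Suc l) = bit (x div 2 + y div 2 + of_bool ?c) l"
    by (simp add: bit_Suc)
  also have "\<dots> = ((bit (x div 2) l \<noteq> bit (y div 2) l) \<noteq> carry ?c (bit (x div 2)) (bit (y div 2)) l)"
    by (rule Suc.IH)
  also have "carry ?c (bit (x div 2)) (bit (y div 2)) l = carry c (bit x) (bit y) (Suc l)"
    by (simp only: carry_shift bit_Suc[abs_def] bit_0)
  finally show ?case by (simp add: bit_Suc)
qed

text \<open>Position \<open>j\<close> generates the carry and the positions \<open>k\<close>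
  propagate it. The unrolled recursion is a disjunction of conjunctions, hence of logarithmic depth
  when written with balanced trees.\<close>

lemma carry_lookahead:
  "carry False p q l \<longleftrightarrow> (\<exists>j<l. p j \<and> q j \<and> (\<forall>k\<in>{Suc j..<l}. p k \<or> q k))"
proof (induction l)
  case (Suc l)
  show ?case
  proof (cases "p l \<and> q l")
    case False
    hence "(\<exists>j<Suc l. p j \<and> q j \<and> (\<forall>k\<in>{Suc j..<Suc l}. p k \<or> q k)) \<longleftrightarrow>
        (\<exists>j<l. p j \<and> q j \<and> (\<forall>k\<in>{Suc j..<Suc l}. p k \<or> q k))"
      by (metis less_Suc_eq)
    moreover have "(\<forall>k\<in>{Suc j..<Suc l}. p k \<or> q k) \<longleftrightarrow> (\<forall>k\<in>{Suc j..<l}. p k \<or> q k) \<and> (p l \<or> q l)"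
      if "j < l" for j
      using that by (auto simp: less_Suc_eq)
    ultimately have "(\<exists>j<Suc l. p j \<and> q j \<and> (\<forall>k\<in>{Suc j..<Suc l}. p k \<or> q k)) \<longleftrightarrow>
        (\<exists>j<l. p j \<and> q j \<and> (\<forall>k\<in>{Suc j..<l}. p k \<or> q k)) \<and> (p l \<or> q l)"
      by blast
    thus ?thesis using False Suc by auto
  qed auto
qed simp

definition carry_form :: "'r word_form \<Rightarrow> 'r word_form \<Rightarrow> 'r word_form" where
  "carry_form a b l = balanced Disj (map (\<lambda>j. balanced Conj
     (Conj [a j, b j] # map (\<lambda>k. Disj [a k, b k]) [Suc j..<l])) [0..<l])"

definition sum_form :: "'r word_form \<Rightarrow> 'r word_form \<Rightarrow> 'r word_form" where
  "sum_form a b l = xor3 (a l) (b l) (carry_form a b l)"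

lemma represents_sum_form:
  assumes "represents n (form_eval w e) a x" and "represents n (form_eval w e) b y"
  shows "represents n (form_eval w e) (sum_form a b) (x + y)"
  unfolding represents_def
proof (intro allI impI)
  fix l assume l: "l < n"
  have "form_eval w e (carry_form a b l) \<longleftrightarrow>
      (\<exists>j<l. bit x j \<and> bit y j \<and> (\<forall>k\<in>{Suc j..<l}. bit x k \<or> bit y k))"
    using assms l by (auto simp: carry_form_def represents_def)
  also have "\<dots> \<longleftrightarrow> carry False (bit x) (bit y) l" by (rule carry_lookahead[symmetric])
  finally show "form_eval w e (sum_form a b l) = bit (x + y) l"
    using bit_add_carry[of x y False l] assms l by (simp add: sum_form_def represents_def)
qed

lemma nc_bound_sum_form:
  assumes "\<And>l. nc_bound d (a l)" and "\<And>l. nc_bound d (b l)" and "l < 2 ^ m"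
  shows "nc_bound (d + 2 * m + 9) (sum_form a b l)"
proof -
  have "nc_bound (d + 1 + m + 1) (balanced Conj (Conj [a j, b j] # map (\<lambda>k. Disj [a k, b k]) [Suc j..<l]))" for j
    by (rule nc_bound_balanced[of _ m "d + 1"]) (use assms in auto)
  hence "nc_bound (d + 2 * m + 3) (carry_form a b l)"
    unfolding carry_form_def
    by (intro nc_bound_balanced[of _ m "d + 1 + m + 1"]) (use assms(3) in auto)
  moreover have "nc_bound (d + 2 * m + 3) (a l)" "nc_bound (d + 2 * m + 3) (b l)"
    using assms(1,2) form_bound_mono[of 2 False d _ "d + 2 * m + 3"] by auto
  ultimately show ?thesis
    unfolding sum_form_def using nc_bound_xor3[of "d + 2 * m + 3"] by (simp add: add.assoc)
qed


section \<open>Repeated squaring of integer matrices\<close>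

text \<open>\<open>Entry x y l\<close> is bit \<open>l\<close> of a matrix entry; \<open>Sum\<close>
  and \<open>Carry\<close> hold the two words that a carry-save tree leaves to the lookahead
  adder.\<close>

datatype reg = Entry nat nat nat | Sum nat nat nat | Carry nat nat nat

definition matmul :: "nat \<Rightarrow> (nat \<Rightarrow> nat \<Rightarrow> int) \<Rightarrow> (nat \<Rightarrow> nat \<Rightarrow> int) \<Rightarrow> nat \<Rightarrow> nat \<Rightarrow> int" where
  "matmul n A B x y = (\<Sum>k<n. A x k * B k y)"

primrec matpow :: "nat \<Rightarrow> (nat \<Rightarrow> nat \<Rightarrow> int) \<Rightarrow> nat \<Rightarrow> nat \<Rightarrow> nat \<Rightarrow> int" where
  "matpow n A 0 x y = of_bool (x = y)"
| "matpow n A (Suc t) x y = (\<Sum>k<n. A x k * matpow n A t k y)"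

lemma matpow_add:
  assumes "x < n"
  shows "matpow n A (s + t) x y = (\<Sum>k<n. matpow n A s x k * matpow n A t k y)"
  using assms
proof (induction s arbitrary: x)
  case 0
  have "(\<Sum>k<n. matpow n A 0 x k * matpow n A t k y) = (\<Sum>k\<in>{x}. matpow n A t k y)"
    using 0 by (intro sum.mono_neutral_cong_right) auto
  thus ?case by simp
next
  case (Suc s)
  have "matpow n A (Suc s + t) x y = (\<Sum>j<n. A x j * (\<Sum>k<n. matpow n A s j k * matpow n A t k y))"
    using Suc.IH by simp
  also have "\<dots> = (\<Sum>j<n. \<Sum>k<n. A x j * matpow n A s j k * matpow n A t k y)"
    by (simp add: sum_distrib_left mult.assoc)
  also have "\<dots> = (\<Sum>k<n. \<Sum>j<n. A x j * matpow n A s j k * matpow n A t k y)"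
    by (rule sum.swap)
  also have "\<dots> = (\<Sum>k<n. matpow n A (Suc s) x k * matpow n A t k y)"
    by (simp add: sum_distrib_right)
  finally show ?case .
qed

text \<open>Schoolbook multiplication: \<open>t = k * n + i\<close> stands for bit \<open>i\<close>
  of the left entry \<open>(x, k)\<close> times the right entry \<open>(k, y)\<close> shifted by
  \<open>i\<close>. So a single tree over \<open>n * n\<close> words computes all \<open>n\<close>
  products and their sum.\<close>

definition partial_product :: "nat \<Rightarrow> nat \<Rightarrow> nat \<Rightarrow> nat \<Rightarrow> reg word_form" where
  "partial_product n x y t l = (let k = t div n; i = t mod n in
     if t < n * n \<and> i \<le> l then Conj [Reg (Entry x k i), Reg (Entry k y (l - i))] else FF)"

definition log_len :: "nat \<Rightarrow> nat" where
  "log_len n = floor_log n + 1"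

lemma less_log_len: "n < 2 ^ log_len n"
  using floor_log_exp2_gt[of n] by (simp add: log_len_def)

definition triples :: "nat \<Rightarrow> (nat \<Rightarrow> nat \<Rightarrow> nat \<Rightarrow> 'b) \<Rightarrow> 'b list" where
  "triples n f = map (\<lambda>(x, y, l). f x y l) (List.product [0..<n] (List.product [0..<n] [0..<n]))"

lemma set_triples: "set (triples n f) = {f x y l | x y l. x < n \<and> y < n \<and> l < n}"
  by (force simp: triples_def)

lemma length_triples [simp]: "length (triples n f) = n * (n * n)"
  by (simp add: triples_def)

definition product_step :: "nat \<Rightarrow> reg step" where
  "product_step n = (triples n Sum @ triples n Carry,
     \<lambda>r. case r of
       Sum x y l \<Rightarrow> fst (csa_tree (2 * log_len n) (partial_product n x y) 0) l
     | Carry x y l \<Rightarrow> snd (csa_tree (2 * log_len n) (partial_product n x y) 0) l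
     | _ \<Rightarrow> FF)"

definition add_step :: "nat \<Rightarrow> reg step" where
  "add_step n = (triples n Entry,
     \<lambda>r. case r of
       Entry x y l \<Rightarrow> sum_form (\<lambda>l. Reg (Sum x y l)) (\<lambda>l. Reg (Carry x y l)) l
     | _ \<Rightarrow> FF)"

definition holds_matrix :: "nat \<Rightarrow> (reg \<Rightarrow> bool) \<Rightarrow> (nat \<Rightarrow> nat \<Rightarrow> int) \<Rightarrow> bool" where
  "holds_matrix n e A \<longleftrightarrow> (\<forall>x<n. \<forall>y<n. \<forall>l<n. e (Entry x y l) = bit (A x y) l)"

lemma represents_partial_product:
  assumes "holds_matrix n e A" and "x < n" and "y < n"
  shows "represents n (form_eval w e) (partial_product n x y t)
    (if t < n * n then of_bool (bit (A x (t div n)) (t mod n)) * 2 ^ (t mod n) * A (t div n) y else 0)"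
proof (cases "t < n * n")
  case True
  hence "t div n < n" "t mod n < n" using assms(2) by (auto simp: less_mult_imp_div_less)
  thus ?thesis using assms True
    by (auto simp: represents_def partial_product_def holds_matrix_def bit_simps Let_def
        push_bit_eq_mult[symmetric] mult.commute[of "2 ^ _"] mult.commute[of _ "2 ^ _"])
qed (simp add: represents_def partial_product_def)

text \<open>Only the bits \<open>i < n\<close> of the left factor occur, hence
  \<open>take_bit\<close>. It agrees with \<open>A x k\<close> modulo \<open>2 ^ n\<close>, and no
  more than that is kept in the registers.\<close>

lemma sum_partial_products:
  fixes A :: "nat \<Rightarrow> nat \<Rightarrow> int"
  shows "(\<Sum>t<n * n. of_bool (bit (A x (t div n)) (t mod n)) * 2 ^ (t mod n) * A (t div n) y) =
    (\<Sum>k<n. take_bit n (A x k) * A k y)"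
proof -
  let ?f = "\<lambda>t. of_bool (bit (A x (t div n)) (t mod n)) * 2 ^ (t mod n) * A (t div n) y"
  have "(\<Sum>t<n * n. ?f t) = (\<Sum>k<n. sum ?f {k * n..<k * n + n})"
    by (rule sum.nat_group[symmetric])
  also have "\<dots> = (\<Sum>k<n. take_bit n (A x k) * A k y)"
  proof (rule sum.cong[OF refl])
    fix k
    have "sum ?f {k * n..<k * n + n} = (\<Sum>i<n. ?f (i + k * n))"
      using sum.shift_bounds_nat_ivl[of ?f 0 "k * n" n] by (simp add: atLeast0LessThan add.commute)
    also have "\<dots> = (\<Sum>i<n. push_bit i (of_bool (bit (A x k) i)) * A k y)"
      by (rule sum.cong) (auto simp: push_bit_eq_mult)
    also have "\<dots> = take_bit n (A x k) * A k y"
      by (simp add: take_bit_sum sum_distrib_right atLeast0LessThan)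
    finally show "sum ?f {k * n..<k * n + n} = take_bit n (A x k) * A k y" .
  qed
  finally show ?thesis .
qed

lemma bit_cong_take_bit:
  assumes "take_bit n x = take_bit n y" and "l < n"
  shows "bit x l = bit (y :: int) l"
  using arg_cong[OF assms(1), of "\<lambda>z. bit z l"] assms(2) by (simp add: bit_take_bit_iff)

lemma holds_matrix_square:
  assumes "holds_matrix n e A"
  shows "holds_matrix n (step_env w (step_env w e (product_step n)) (add_step n)) (matmul n A A)"
  unfolding holds_matrix_def
proof (intro allI impI)
  fix x y l assume xyl: "x < n" "y < n" "l < n"
  let ?e = "step_env w e (product_step n)"
  let ?v = "\<lambda>t. if t < n * n then of_bool (bit (A x (t div n)) (t mod n)) * 2 ^ (t mod n) * A (t div n) y else 0"
  let ?m = "2 * log_len n"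
  obtain s k where sk: "represents n (form_eval w e) (fst (csa_tree ?m (partial_product n x y) 0)) s"
    "represents n (form_eval w e) (snd (csa_tree ?m (partial_product n x y) 0)) k"
    "s + k = (\<Sum>j<2^?m. ?v (0 * 2 ^ ?m + j))"
    using represents_csa_tree[of n w e "partial_product n x y" ?v ?m 0]
      represents_partial_product[OF assms xyl(1,2)] by blast
  have "n * n \<le> 2 ^ log_len n * 2 ^ log_len n"
    using less_log_len[of n] by (intro mult_le_mono) auto
  \<comment> \<open>The tree has \<open>2 ^ ?m\<close> leaves; those from \<open>n * n\<close> on
    hold the word 0.\<close>
  hence "{..<n * n} \<subseteq> {..<2 ^ ?m}" by (auto simp: power_add mult_2)
  hence "(\<Sum>j<2^?m. ?v j) = (\<Sum>t<n * n. of_bool (bit (A x (t div n)) (t mod n)) * 2 ^ (t mod n) * A (t div n) y)"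
    by (intro sum.mono_neutral_cong_right) auto
  hence sum: "s + k = (\<Sum>k<n. take_bit n (A x k) * A k y)"
    using sk(3) sum_partial_products[of A x n y] unfolding mult_zero_left add_0 by (simp only:)
  have "represents n (form_eval w ?e) (\<lambda>l. Reg (Sum x y l)) s"
    "represents n (form_eval w ?e) (\<lambda>l. Reg (Carry x y l)) k"
    using sk(1,2) xyl by (auto simp: represents_def step_env_def product_step_def set_triples)
  from represents_sum_form[OF this]
  have "step_env w ?e (add_step n) (Entry x y l) = bit (s + k) l"
    using xyl by (simp add: represents_def step_env_def[of _ ?e] add_step_def set_triples)
  also have "\<dots> = bit (matmul n A A x y) l"
  proof (rule bit_cong_take_bit[OF _ xyl(3)])
    have "(\<Sum>k<n. take_bit n (A x k) * A k y) mod 2 ^ n = (\<Sum>k<n. (take_bit n (A x k) * A k y) mod 2 ^ n) mod 2 ^ n"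
      by (rule mod_sum_eq[symmetric])
    also have "\<dots> = (\<Sum>k<n. (A x k * A k y) mod 2 ^ n) mod 2 ^ n"
      by (simp add: take_bit_eq_mod mod_mult_left_eq)
    also have "\<dots> = (\<Sum>k<n. A x k * A k y) mod 2 ^ n"
      by (rule mod_sum_eq)
    finally show "take_bit n (s + k) = take_bit n (matmul n A A x y)"
      unfolding sum by (simp add: take_bit_eq_mod matmul_def)
  qed
  finally show "step_env w ?e (add_step n) (Entry x y l) = bit (matmul n A A x y) l" .
qed

primrec squaring_steps :: "nat \<Rightarrow> nat \<Rightarrow> reg step list" where
  "squaring_steps n 0 = []"
| "squaring_steps n (Suc s) = squaring_steps n s @ [product_step n, add_step n]"

lemma holds_matrix_cong:
  "holds_matrix n e A \<Longrightarrow> (\<And>x y. x < n \<Longrightarrow> y < n \<Longrightarrow> A x y = B x y) \<Longrightarrow> holds_matrix n e B"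
  by (simp add: holds_matrix_def)

lemma holds_matrix_squaring_steps:
  assumes "holds_matrix n e A"
  shows "holds_matrix n (run w (squaring_steps n s) e) (matpow n A (2 ^ s))"
proof (induction s)
  case 0
  have "matpow n A 1 x y = A x y" if "x < n" "y < n" for x y
  proof -
    have "matpow n A 1 x y = (\<Sum>k<n. if k = y then A x k else 0)"
      unfolding One_nat_def matpow.simps by (rule sum.cong) auto
    thus ?thesis using that by simp
  qed
  thus ?case using assms by (auto intro: holds_matrix_cong)
next
  case (Suc s)
  have "matmul n (matpow n A (2 ^ s)) (matpow n A (2 ^ s)) x y = matpow n A (2 ^ Suc s) x y"
    if "x < n" for x y
    using matpow_add[OF that, of A "2 ^ s" "2 ^ s" y] by (simp add: matmul_def mult_2)
  thus ?case using holds_matrix_square[OF Suc.IH, of w]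
    by (auto intro: holds_matrix_cong)
qed

lemma step_bound_product_step: "step_bound 2 False (24 * log_len n + 2) (2 * n ^ 3) (product_step n)"
proof -
  have "nc_bound 2 (partial_product n x y t l)" for x y t l
    by (simp add: partial_product_def Let_def)
  hence "nc_bound (2 + 12 * (2 * log_len n)) (fst (csa_tree (2 * log_len n) (partial_product n x y) 0) l)"
    "nc_bound (2 + 12 * (2 * log_len n)) (snd (csa_tree (2 * log_len n) (partial_product n x y) 0) l)" for x y l
    using nc_bound_csa_tree[of 2 "partial_product n x y" "2 * log_len n" 0 l] by auto
  hence "nc_bound (24 * log_len n + 2) (fst (csa_tree (2 * log_len n) (partial_product n x y) 0) l)"
    "nc_bound (24 * log_len n + 2) (snd (csa_tree (2 * log_len n) (partial_product n x y) 0) l)" for x y l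
    by (auto intro: form_bound_mono)
  thus ?thesis
    by (auto simp: step_bound_def product_step_def set_triples power3_eq_cube)
qed

lemma step_bound_add_step: "step_bound 2 False (2 * log_len n + 9) (2 * n ^ 3) (add_step n)"
proof -
  have "nc_bound (0 + 2 * log_len n + 9) (sum_form (\<lambda>l. Reg (Sum x y l)) (\<lambda>l. Reg (Carry x y l)) l)"
    if "l < n" for x y l
    by (rule nc_bound_sum_form) (use that less_log_len[of n] in auto)
  thus ?thesis by (auto simp: step_bound_def add_step_def set_triples power3_eq_cube)
qed


section \<open>Signed binary digits\<close>

text \<open>Booth recoding of an integer in two's complement. The digits vanish beyond the sign bit, so a
  number of small absolute value uses few positions, however many bits have been computed.\<close>

definition booth :: "int \<Rightarrow> nat \<Rightarrow> int" where
  "booth c l = of_bool (l > 0 \<and> bit c (l - 1)) - of_bool (bit c l)"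

lemma booth_range: "booth c l \<in> {-1, 0, 1}"
  by (auto simp: booth_def)

lemma booth_zero [simp]: "booth 0 l = 0"
  by (simp add: booth_def)

lemma booth_nonzero: "booth c l \<noteq> 0 \<longleftrightarrow> (l > 0 \<and> bit c (l - 1)) \<noteq> bit c l"
  by (auto simp: booth_def)

lemma booth_negative: "booth c l < 0 \<longleftrightarrow> \<not> (l > 0 \<and> bit c (l - 1)) \<and> bit c l"
  by (auto simp: booth_def)

text \<open>A set bit \<open>l\<close> contributes \<open>- (2 ^ l)\<close> through digit
  \<open>l\<close> and \<open>2 ^ (l + 1)\<close> through digit \<open>l + 1\<close>, in total
  \<open>2 ^ l\<close>. Only the top bit \<open>m\<close> lacks its second contribution and so acts
  as the sign.\<close>

lemma sum_booth_take_bit: "(\<Sum>l<Suc m. booth c l * 2 ^ l) = take_bit m c - 2 ^ m * of_bool (bit c m)"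
proof (induction m)
  case (Suc m)
  have "take_bit (Suc m) c = take_bit m c + 2 ^ m * of_bool (bit c m)"
    by (simp add: take_bit_Suc_from_most)
  thus ?case using Suc by (auto simp: booth_def)
qed (simp add: booth_def)

lemma sum_booth:
  assumes "- (2 ^ m) \<le> c" and "c < 2 ^ m" and "m < n"
  shows "(\<Sum>l<n. booth c l * 2 ^ l) = c"
proof -
  obtain m' where n: "n = Suc m'" using assms(3) by (cases n) auto
  have "(2::int) ^ m \<le> 2 ^ m'" using assms(3) n by (intro power_increasing) auto
  hence "- (2 ^ m') \<le> c" and "c < 2 ^ m'" using assms(1,2) by linarith+
  hence "signed_take_bit m' c = c" by (rule signed_take_bit_int_eq_self)
  moreover have "signed_take_bit m' c = take_bit m' c - 2 ^ m' * of_bool (bit c m')"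
    unfolding signed_take_bit_eq_take_bit_minus by (simp add: take_bit_Suc_from_most)
  ultimately show ?thesis using sum_booth_take_bit[of c m'] n by simp
qed

text \<open>From position \<open>m\<close> on all bits equal the sign bit, and a digit is the
  difference of adjacent bits.\<close>

lemma booth_eq_0:
  assumes "- (2 ^ m) \<le> c" and "c < 2 ^ m" and "m < l"
  shows "booth c l = 0"
proof -
  have "signed_take_bit m c = c" using assms by (intro signed_take_bit_int_eq_self) auto
  hence "bit c k = bit c m" if "m \<le> k" for k
    using that bit_signed_take_bit_iff[of m c k] by (simp add: min_def)
  from this[of l] this[of "l - 1"] show ?thesis using assms(3) by (simp add: booth_def)
qed


section \<open>From circuits to power circuits\<close>

text \<open>\<open>Digit x i\<close> has the value of the \<open>2\<^sup>x\<close>-gate \<open>x\<close> times \<open>2 ^ i\<close>. The exponent \<open>i\<close> is provided in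
  unary by the nodes \<open>One j\<close> of value 1, because a binary representation would increase the depth.\<close>

datatype node = One nat | Digit nat nat

instance node :: countable
  by countable_datatype

text \<open>Two measures of height are needed: \<open>ht\<close> controls the size of the
  coefficients, and \<open>X\<close>, which counts \<open>2\<^sup>x\<close>-gates, controls the
  depth of the power circuit. The number \<open>n\<close> of slots is what the formulas see, the
  number \<open>N\<close> of gates is what the size bound refers to.\<close>

locale slot_gates =
  fixes n :: nat and a :: "nat \<Rightarrow> bool" and g_op :: "nat \<Rightarrow> nat gate_op" and out :: nat
    and v :: "nat \<Rightarrow> real" and ht X :: "nat \<Rightarrow> nat" and N E :: nat
  assumes a_less: "a x \<Longrightarrow> x < n" and card_a: "card {x. a x} = N"
    and out: "a out"
    and a_inputs: "a x \<Longrightarrow> y \<in> set (gate_inputs (g_op x)) \<Longrightarrow> a y"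
    and ht_inputs: "a x \<Longrightarrow> y \<in> set (gate_inputs (g_op x)) \<Longrightarrow> ht y < ht x"
    and X_inputs: "a x \<Longrightarrow> y \<in> set (gate_inputs (g_op x)) \<Longrightarrow> of_bool (is_exp2_gate (g_op x)) + X y \<le> X x"
    and X_le: "a x \<Longrightarrow> X x \<le> E"
    and ht_le: "a x \<Longrightarrow> ht x < N"
    and v_eq: "a x \<Longrightarrow> v x = (case g_op x of
              Zero_Gate \<Rightarrow> 0
            | Plus_Gate h k \<Rightarrow> v h + v k
            | Minus_Gate h \<Rightarrow> - v h
            | Exp2_Gate h \<Rightarrow> 2 powr v h)"
begin

text \<open>One step of unfolding a gate into its inputs. Since \<open>2\<^sup>x\<close>-gates are left in place, a high
  power of this matrix expresses every gate as an integer combination of \<open>2\<^sup>x\<close>-gates.\<close>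

definition A :: "nat \<Rightarrow> nat \<Rightarrow> int" where
  "A x y = (if a x then case g_op x of
       Zero_Gate \<Rightarrow> 0
     | Plus_Gate h k \<Rightarrow> of_bool (h = y) + of_bool (k = y)
     | Minus_Gate h \<Rightarrow> - of_bool (h = y)
     | Exp2_Gate h \<Rightarrow> of_bool (x = y)
     else 0)"

lemma finite_a: "finite {x. a x}"
  using a_less by (auto intro: finite_subset[of _ "{..<n}"])

abbreviation "is_exp x \<equiv> is_exp2_gate (g_op x)"

lemma A_sum:
  fixes f :: "nat \<Rightarrow> 'b::comm_ring_1"
  assumes "a x"
  shows "(\<Sum>y<n. of_int (A x y) * f y) = (case g_op x of
       Zero_Gate \<Rightarrow> 0
     | Plus_Gate h k \<Rightarrow> f h + f k
     | Minus_Gate h \<Rightarrow> - f h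
     | Exp2_Gate h \<Rightarrow> f x)"
proof -
  have delta: "(\<Sum>y<n. of_bool (h = y) * f y) = f h" if "h < n" for h
  proof -
    have "(\<Sum>y<n. of_bool (h = y) * f y) = (\<Sum>y<n. if y = h then f y else 0)"
      by (rule sum.cong) auto
    thus ?thesis using that by simp
  qed
  show ?thesis
  proof (cases "g_op x")
    case (Plus_Gate h k)
    hence "h < n" "k < n" using a_inputs[OF assms] a_less by auto
    thus ?thesis using Plus_Gate assms delta by (simp add: A_def distrib_right sum.distrib)
  next
    case (Minus_Gate h)
    hence "h < n" using a_inputs[OF assms] a_less by auto
    thus ?thesis using Minus_Gate assms delta by (simp add: A_def sum_negf)
  next
    case (Exp2_Gate h)
    thus ?thesis using assms a_less delta by (simp add: A_def)
  qed (use assms in \<open>simp add: A_def\<close>)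
qed

lemma matpow_Suc:
  assumes "a x"
  shows "matpow n A (Suc t) x y = (case g_op x of
       Zero_Gate \<Rightarrow> 0
     | Plus_Gate h k \<Rightarrow> matpow n A t h y + matpow n A t k y
     | Minus_Gate h \<Rightarrow> - matpow n A t h y
     | Exp2_Gate h \<Rightarrow> matpow n A t x y)"
  using A_sum[OF assms, of "\<lambda>k. matpow n A t k y"] by simp

declare matpow.simps(2) [simp del]

text \<open>On active rows the matrix \<open>A\<close> fixes the vector \<open>v\<close>: this is
  the gate equation for the other gates, and the row of a \<open>2\<^sup>x\<close>-gate is a unit
  vector. So all powers of \<open>A\<close> express the gate values correctly.\<close>

lemma matpow_eval: "a x \<Longrightarrow> (\<Sum>y<n. of_int (matpow n A t x y) * v y) = v x"
proof (induction t arbitrary: x)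
  case 0
  have "(\<Sum>y<n. of_int (matpow n A 0 x y) * v y) = (\<Sum>y<n. if y = x then v y else 0)"
    by (rule sum.cong) auto
  thus ?case using 0 a_less by simp
next
  case (Suc t)
  note inputs = a_inputs[OF Suc.prems]
  show ?case
  proof (cases "g_op x")
    case (Plus_Gate h k)
    thus ?thesis using Suc inputs matpow_Suc[OF Suc.prems] v_eq[OF Suc.prems]
      by (simp add: distrib_right sum.distrib)
  next
    case (Minus_Gate h)
    thus ?thesis using Suc inputs matpow_Suc[OF Suc.prems] v_eq[OF Suc.prems]
      by (simp add: sum_negf)
  qed (use Suc matpow_Suc[OF Suc.prems] v_eq[OF Suc.prems] in simp_all)
qed

lemma matpow_exp: "a x \<Longrightarrow> is_exp x \<Longrightarrow> matpow n A t x y = of_bool (x = y)"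
proof (induction t)
  case (Suc t)
  thus ?case using matpow_Suc[of x t y] by (cases "g_op x") auto
qed simp

text \<open>A nonzero entry stems from a path from \<open>x\<close> to \<open>y\<close> that unfolds
  no \<open>2\<^sup>x\<close>-gate. Each unfolding lowers \<open>ht\<close> and rows of constants
  vanish, so after more than \<open>ht x\<close> steps only paths resting at a
  \<open>2\<^sup>x\<close>-gate survive.\<close>

lemma matpow_nonzero:
  assumes "a x" and "matpow n A t x y \<noteq> 0"
  shows "a y \<and> X y \<le> X x \<and> (ht x < t \<longrightarrow> is_exp y)"
  using assms
proof (induction t arbitrary: x)
  case 0
  thus ?case by (simp split: if_splits)
next
  case (Suc t)
  note inputs = a_inputs[OF Suc.prems(1)] ht_inputs[OF Suc.prems(1)] X_inputs[OF Suc.prems(1)]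
  show ?case
  proof (cases "is_exp x")
    case True
    thus ?thesis using Suc.prems matpow_exp[of x "Suc t" y] by (auto split: if_splits)
  next
    case False
    obtain h where h: "h \<in> set (gate_inputs (g_op x))" "matpow n A t h y \<noteq> 0"
    proof (rule ccontr)
      assume "\<not> thesis"
      hence "\<forall>h\<in>set (gate_inputs (g_op x)). matpow n A t h y = 0" using that by blast
      thus False
        using Suc.prems(2) False unfolding matpow_Suc[OF Suc.prems(1)] by (cases "g_op x") auto
    qed
    have "a y \<and> X y \<le> X h \<and> (ht h < t \<longrightarrow> is_exp y)"
      by (rule Suc.IH) (use inputs(1) h in auto)
    thus ?thesis using inputs(2,3)[OF h(1)] by auto
  qed
qed

text \<open>A \<open>+\<close>-gate adds the sums of two inputs of smaller \<open>ht\<close>. The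
  additional factor 2 is available because a \<open>2\<^sup>x\<close>-gate has an input and thus
  positive \<open>ht\<close>; it makes the upper bound in \<open>c_bound\<close> strict, which saves
  a digit.\<close>

lemma matpow_bound: "a x \<Longrightarrow> 2 * (\<Sum>y | a y \<and> is_exp y. \<bar>matpow n A t x y\<bar>) \<le> 2 ^ ht x"
proof (induction t arbitrary: x)
  case 0
  have "(\<Sum>y | a y \<and> is_exp y. \<bar>matpow n A 0 x y\<bar>) = (\<Sum>y | a y \<and> is_exp y. if y = x then 1 else 0)"
    by (rule sum.cong) auto
  also have "\<dots> = of_bool (is_exp x)" using finite_a 0 by (simp add: sum.delta)
  finally have *: "(\<Sum>y | a y \<and> is_exp y. \<bar>matpow n A 0 x y\<bar>) = of_bool (is_exp x)" .
  show ?case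
  proof (cases "is_exp x")
    case True
    then obtain h where "g_op x = Exp2_Gate h" by (cases "g_op x") auto
    hence "0 < ht x" using ht_inputs[OF 0, of h] by auto
    thus ?thesis unfolding * using True by (cases "ht x") auto
  next
    case False
    thus ?thesis unfolding * by simp
  qed
next
  case (Suc t)
  note x = Suc.prems
  let ?B = "\<lambda>t x. \<Sum>y | a y \<and> is_exp y. \<bar>matpow n A t x y\<bar>"
  have half: "4 * ?B t h \<le> 2 ^ ht x" if "h \<in> set (gate_inputs (g_op x))" for h
  proof -
    have "4 * ?B t h \<le> 2 * 2 ^ ht h" using Suc.IH[of h] a_inputs[OF x that] by simp
    also have "\<dots> = 2 ^ Suc (ht h)" by simp
    also have "\<dots> \<le> (2::int) ^ ht x" using ht_inputs[OF x that] by (intro power_increasing) auto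
    finally show ?thesis .
  qed
  show ?case
  proof (cases "g_op x")
    case Zero_Gate
    thus ?thesis using matpow_Suc[OF x] by simp
  next
    case (Plus_Gate h k)
    have "?B (Suc t) x \<le> (\<Sum>y | a y \<and> is_exp y. \<bar>matpow n A t h y\<bar> + \<bar>matpow n A t k y\<bar>)"
      using matpow_Suc[OF x] Plus_Gate by (intro sum_mono) (simp add: abs_triangle_ineq)
    hence "?B (Suc t) x \<le> ?B t h + ?B t k" by (simp add: sum.distrib)
    thus ?thesis using half[of h] half[of k] Plus_Gate by simp
  next
    case (Minus_Gate h)
    have "0 \<le> ?B t h" by (rule sum_nonneg) simp
    moreover have "?B (Suc t) x = ?B t h" using matpow_Suc[OF x] Minus_Gate by simp
    moreover have "4 * ?B t h \<le> 2 ^ ht x" using half[of h] Minus_Gate by simp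
    ultimately show ?thesis by linarith
  next
    case (Exp2_Gate h)
    thus ?thesis using matpow_Suc[OF x] Suc.IH[OF x] by simp
  qed
qed

text \<open>The exponent exceeds \<open>n\<close> and hence every \<open>ht x\<close>, so only
  columns of \<open>2\<^sup>x\<close>-gates are left. As a power of two it is reached by
  \<open>log_len n\<close> squarings.\<close>

definition c :: "nat \<Rightarrow> nat \<Rightarrow> int" where
  "c = matpow n A (2 ^ log_len n)"

lemma N_le: "N \<le> n"
proof -
  have "card {x. a x} \<le> card {..<n}" using a_less by (intro card_mono) auto
  thus ?thesis using card_a by simp
qed

lemma c_inactive: "\<not> a x \<Longrightarrow> c x y = 0"
  using less_log_len[of n] by (cases "2 ^ log_len n :: nat") (auto simp: c_def A_def matpow.simps(2))

lemma c_nonzero: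
  assumes "c x y \<noteq> 0"
  shows "a x" and "a y" and "is_exp y" and "X y \<le> X x"
proof -
  show x: "a x" using assms c_inactive by auto
  have "ht x < 2 ^ log_len n" using ht_le[OF x] N_le less_log_len[of n] by linarith
  thus "a y" "is_exp y" "X y \<le> X x"
    using matpow_nonzero[OF x, of "2 ^ log_len n" y] assms by (auto simp: c_def)
qed

lemma c_bound: "- (2 ^ (N - 1)) \<le> c x y" "c x y < 2 ^ (N - 1)"
proof -
  have "2 * \<bar>c x y\<bar> \<le> 2 ^ (N - 1)"
  proof (cases "c x y = 0")
    case False
    note * = c_nonzero[OF False]
    have "\<bar>c x y\<bar> \<le> (\<Sum>y | a y \<and> is_exp y. \<bar>c x y\<bar>)"
      by (rule member_le_sum) (use * finite_a in auto)
    hence "2 * \<bar>c x y\<bar> \<le> 2 ^ ht x"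
      using matpow_bound[OF *(1), of "2 ^ log_len n"] by (simp add: c_def)
    also have "\<dots> \<le> (2::int) ^ (N - 1)" using ht_le[OF *(1)] by (intro power_increasing) auto
    finally show ?thesis .
  qed simp
  moreover have "(0::int) < 2 ^ (N - 1)" by simp
  ultimately show "- (2 ^ (N - 1)) \<le> c x y" "c x y < 2 ^ (N - 1)" by linarith+
qed

lemma N_pos: "0 < N"
  using ht_le[OF out] by simp

lemma booth_c: "booth (c x y) l \<noteq> 0 \<Longrightarrow> l < N"
  using booth_eq_0[OF c_bound, of l x y] N_pos by (cases "N - 1 < l") auto

lemma sum_booth_c: "(\<Sum>l<n. booth (c x y) l * 2 ^ l) = c x y"
  by (rule sum_booth[OF c_bound]) (use N_pos N_le in auto)

lemma c_eval: "a x \<Longrightarrow> (\<Sum>y<n. of_int (c x y) * v y) = v x"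
  unfolding c_def by (rule matpow_eval)

section \<open>The power circuit of signed digits\<close>

fun active :: "node \<Rightarrow> bool" where
  "active (Digit x i) = (x < n \<and> i < n \<and> (\<exists>g<n. booth (c g x) i \<noteq> 0))"
| "active (One j) = (\<exists>x<n. \<exists>i<n. j < i \<and> (\<exists>g<n. booth (c g x) i \<noteq> 0))"

text \<open>The exponent of \<open>Digit x i\<close> is \<open>i + v h\<close> for the input
  \<open>h\<close> of \<open>x\<close>: there are \<open>i\<close> successors of value 1, and the
  signed digits of the coefficients of \<open>h\<close> yield \<open>v h\<close>.\<close>

fun delta :: "node \<Rightarrow> node \<Rightarrow> int" where
  "delta (Digit x i) (One j) = of_bool (j < i)"
| "delta (Digit x i) (Digit y l) = (case g_op x of Exp2_Gate h \<Rightarrow> booth (c h y) l | _ \<Rightarrow> 0)"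
| "delta (One j) s = 0"

fun out_marking :: "node \<Rightarrow> int" where
  "out_marking (Digit y l) = booth (c out y) l"
| "out_marking (One j) = 0"

abbreviation "S \<equiv> {s. active s}"
abbreviation "\<Pi> \<equiv> (to_nat :: node \<Rightarrow> nat) ` S"

definition pc_delta :: "nat \<Rightarrow> nat \<Rightarrow> int" where
  "pc_delta p q = delta (from_nat p) (from_nat q)"

definition pc_marking :: "nat \<Rightarrow> int" where
  "pc_marking p = out_marking (from_nat p)"

text \<open>\<open>active\<close> speaks of the slots below \<open>n\<close>, the only range known
  to the formulas. Because only digits that some coefficient uses become nodes, the size is
  nevertheless bounded by the number \<open>N\<close> of gates.\<close>

lemma active_Digit: "active (Digit x i) \<Longrightarrow> a x \<and> is_exp x \<and> i < N"
proof -
  assume "active (Digit x i)"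
  then obtain g where g: "booth (c g x) i \<noteq> 0" by auto
  hence "c g x \<noteq> 0" by auto
  thus ?thesis using c_nonzero booth_c[OF g] by blast
qed

lemma S_subset: "S \<subseteq> One ` {..<N} \<union> (\<lambda>(x, i). Digit x i) ` ({x. a x} \<times> {..<N})"
proof
  fix s assume s: "s \<in> S"
  show "s \<in> One ` {..<N} \<union> (\<lambda>(x, i). Digit x i) ` ({x. a x} \<times> {..<N})"
  proof (cases s)
    case (One j)
    then obtain x i g where "j < i" "booth (c g x) i \<noteq> 0" using s by auto
    hence "j < N" using booth_c[of g x i] by simp
    thus ?thesis using One by auto
  next
    case (Digit x i)
    thus ?thesis using s active_Digit[of x i] by auto
  qed
qed

lemma finite_S: "finite S"
  by (rule finite_subset[OF S_subset]) (use finite_a in auto)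

lemma card_\<Pi>: "card \<Pi> \<le> N\<^sup>2 + N"
proof -
  have "card \<Pi> = card S" by (simp add: card_image)
  also have "\<dots> \<le> card (One ` {..<N} \<union> (\<lambda>(x, i). Digit x i) ` ({x. a x} \<times> {..<N}))"
    by (rule card_mono[OF _ S_subset]) (use finite_a in auto)
  also have "\<dots> \<le> card (One ` {..<N}) + card ((\<lambda>(x, i). Digit x i) ` ({x. a x} \<times> {..<N}))"
    by (rule card_Un_le)
  also have "\<dots> \<le> card {..<N} + card ({x. a x} \<times> {..<N})"
    by (intro add_mono card_image_le) (use finite_a in auto)
  also have "\<dots> = N\<^sup>2 + N" using card_a by (simp add: card_cartesian_product power2_eq_square)
  finally show ?thesis .
qed

fun exp2_rank :: "node \<Rightarrow> nat" where
  "exp2_rank (One j) = 0"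
| "exp2_rank (Digit x i) = X x"

text \<open>A nonzero coefficient of \<open>h\<close> belongs to some \<open>y\<close> with
  \<open>X y \<le> X h\<close>, and \<open>x\<close> itself adds one. The nodes \<open>One j\<close>
  are leaves, so the factor \<open>2 ^ i\<close> costs no additional level.\<close>

lemma exp2_rank_less:
  assumes "active s" and "delta s t \<noteq> 0"
  shows "exp2_rank t < exp2_rank s"
proof -
  obtain x i where s: "s = Digit x i" using assms(2) by (cases s) auto
  hence x: "a x" "is_exp x" using active_Digit assms(1) by auto
  then obtain h where h: "g_op x = Exp2_Gate h" by (cases "g_op x") auto
  have X: "X h < X x" using X_inputs[OF x(1), of h] h by simp
  show ?thesis
  proof (cases t)
    case (One j)
    thus ?thesis using X s by simp
  next
    case (Digit y l)
    hence "c h y \<noteq> 0" using assms(2) s h by auto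
    thus ?thesis using c_nonzero(4)[of h y] X s Digit by simp
  qed
qed

lemma pc_edges_\<Pi>: "(p, q) \<in> pc_edges \<Pi> pc_delta \<Longrightarrow> exp2_rank (from_nat q) < exp2_rank (from_nat p)"
  by (auto simp: pc_edges_def pc_delta_def exp2_rank_less)

lemma delta_range: "delta s t \<in> {-1, 0, 1}"
  using booth_range by (cases "(s, t)" rule: delta.cases) (auto split: gate_op.split)

lemma generalized_power_circuit: "generalized_power_circuit \<Pi> pc_delta"
proof -
  have "acyclic (pc_edges \<Pi> pc_delta)" by (rule acyclic_potential[OF pc_edges_\<Pi>])
  thus ?thesis
    using finite_S delta_range
    by (auto simp: generalized_power_circuit_def marking_def succ_marking_def pc_delta_def simp del: insert_iff)
qed

lemma marking: "marking \<Pi> pc_marking"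
proof -
  have "out_marking s \<in> {-1, 0, 1}" for s using booth_range by (cases s) auto
  thus ?thesis by (auto simp: marking_def pc_marking_def simp del: insert_iff)
qed

lemma depth: "pc_depth \<Pi> pc_delta \<le> E"
  unfolding pc_depth_def
proof (rule dag_depth_le)
  show "exp2_rank (from_nat p) \<le> E" if p: "p \<in> \<Pi>" for p
  proof -
    obtain s where s: "p = to_nat s" "active s" using p by blast
    show ?thesis using s active_Digit X_le by (cases s) auto
  qed
qed (rule pc_edges_\<Pi>)

abbreviation "nv s \<equiv> node_eval \<Pi> pc_delta (to_nat s)"

lemma marking_eval_\<Pi>: "marking_eval \<Pi> pc_delta (\<lambda>p. m (from_nat p)) = (\<Sum>s\<in>S. of_int (m s) * nv s)"
  unfolding marking_eval_def by (subst sum.reindex) auto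

lemma node_eval_\<Pi>:
  assumes "active s"
  shows "nv s = 2 powr (\<Sum>t\<in>S. of_int (delta s t) * nv t)"
  using node_eval_eq[OF generalized_power_circuit, of "to_nat s"] assms marking_eval_\<Pi>[of "delta s"]
  by (simp add: succ_marking_def pc_delta_def)

lemma nv_One: "active (One j) \<Longrightarrow> nv (One j) = 1"
  by (simp add: node_eval_\<Pi> del: active.simps)

lemma sum_nodes:
  fixes f :: "node \<Rightarrow> real"
  shows "(\<Sum>s\<in>S. f s) = (\<Sum>j<n. if active (One j) then f (One j) else 0) +
    (\<Sum>y<n. \<Sum>l<n. if active (Digit y l) then f (Digit y l) else 0)"
proof -
  let ?U = "One ` {..<n}" and ?D = "(\<lambda>(y, l). Digit y l) ` ({..<n} \<times> {..<n})"
  let ?f = "\<lambda>s. if active s then f s else 0"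
  have "s \<in> ?U \<union> ?D" if "s \<in> S" for s
    using that by (cases s) auto
  hence "(\<Sum>s\<in>S. f s) = (\<Sum>s\<in>?U \<union> ?D. ?f s)"
    by (intro sum.mono_neutral_cong_left) auto
  also have "\<dots> = (\<Sum>s\<in>?U. ?f s) + (\<Sum>s\<in>?D. ?f s)"
    by (rule sum.union_disjoint) auto
  also have "(\<Sum>s\<in>?U. ?f s) = (\<Sum>j<n. ?f (One j))"
    by (subst sum.reindex) (auto simp: inj_on_def)
  also have "(\<Sum>s\<in>?D. ?f s) = (\<Sum>(y, l)\<in>{..<n} \<times> {..<n}. ?f (Digit y l))"
    by (subst sum.reindex) (auto simp: inj_on_def intro!: sum.cong)
  finally show ?thesis by (simp add: sum.cartesian_product del: active.simps)
qed

text \<open>Node values are presupposed only where the digit is nonzero. Hence the lemma applies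
  inside the induction on \<open>X\<close>, where just the values of smaller \<open>X\<close> are
  known.\<close>

lemma sum_digits:
  assumes "a g" and "\<And>y l. active (Digit y l) \<Longrightarrow> booth (c g y) l \<noteq> 0 \<Longrightarrow> nv (Digit y l) = 2 ^ l * v y"
  shows "(\<Sum>y<n. \<Sum>l<n. if active (Digit y l) then of_int (booth (c g y) l) * nv (Digit y l) else 0) = v g"
proof -
  have "(if active (Digit y l) then of_int (booth (c g y) l) * nv (Digit y l) else 0) =
      of_int (booth (c g y) l * 2 ^ l) * v y" if "y < n" "l < n" for y l
    using assms that a_less[OF assms(1)] by (cases "booth (c g y) l = 0") auto
  hence "(\<Sum>y<n. \<Sum>l<n. if active (Digit y l) then of_int (booth (c g y) l) * nv (Digit y l) else 0) =
      (\<Sum>y<n. \<Sum>l<n. of_int (booth (c g y) l * 2 ^ l) * v y)"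
    by (intro sum.cong) auto
  also have "\<dots> = (\<Sum>y<n. of_int (\<Sum>l<n. booth (c g y) l * 2 ^ l) * v y)"
    by (simp only: sum_distrib_right of_int_sum)
  also have "\<dots> = v g" unfolding sum_booth_c by (rule c_eval[OF assms(1)])
  finally show ?thesis .
qed

lemma nv_Digit: "active (Digit x i) \<Longrightarrow> nv (Digit x i) = 2 ^ i * v x"
proof (induction "X x" arbitrary: x i rule: less_induct)
  case less
  have x: "a x" "is_exp x" using active_Digit less.prems by auto
  then obtain h where h: "g_op x = Exp2_Gate h" by (cases "g_op x") auto
  have X: "X h < X x" and "a h" using X_inputs[OF x(1), of h] a_inputs[OF x(1), of h] h by auto
  have ones: "active (One j)" if "j < i" for j
    using that less.prems by auto
  have "(\<Sum>j<n. if active (One j) then of_int (delta (Digit x i) (One j)) * nv (One j) else 0) =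
      (\<Sum>j<n. if j < i then 1 else 0)"
    by (rule sum.cong) (use ones nv_One in auto)
  also have "\<dots> = (\<Sum>j<i. 1)"
    using less.prems by (intro sum.mono_neutral_cong_right) auto
  finally have 1: "(\<Sum>j<n. if active (One j) then of_int (delta (Digit x i) (One j)) * nv (One j) else 0) = real i"
    by simp
  have 2: "(\<Sum>y<n. \<Sum>l<n. if active (Digit y l) then of_int (booth (c h y) l) * nv (Digit y l) else 0) = v h"
  proof (rule sum_digits[OF \<open>a h\<close>])
    fix y l assume yl: "active (Digit y l)" "booth (c h y) l \<noteq> 0"
    hence "c h y \<noteq> 0" by auto
    hence "X y < X x" using c_nonzero(4) X by (meson le_less_trans)
    thus "nv (Digit y l) = 2 ^ l * v y" using less.hyps yl(1) by blast
  qed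
  have "nv (Digit x i) = 2 powr (real i + v h)"
    unfolding node_eval_\<Pi>[OF less.prems] sum_nodes using 1 2 h by (simp del: active.simps cong: if_cong)
  thus ?case using v_eq[OF x(1)] h by (simp add: powr_add powr_realpow)
qed

lemma eval: "marking_eval \<Pi> pc_delta pc_marking = v out"
proof -
  have "marking_eval \<Pi> pc_delta pc_marking = (\<Sum>s\<in>S. of_int (out_marking s) * nv s)"
    using marking_eval_\<Pi>[of out_marking] by (simp add: pc_marking_def[abs_def])
  also have "\<dots> = (\<Sum>y<n. \<Sum>l<n. if active (Digit y l) then of_int (booth (c out y) l) * nv (Digit y l) else 0)"
    unfolding sum_nodes by (simp del: active.simps cong: if_cong)
  also have "\<dots> = v out" by (rule sum_digits[OF out]) (rule nv_Digit)
  finally show ?thesis .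
qed

text \<open>With nonnegative exponents all gate values are integers, by induction on
  \<open>ht\<close>. The exponent \<open>i + v h\<close> of a digit node is then a natural
  number.\<close>

lemma power_circuit:
  assumes nonneg: "\<And>x h. a x \<Longrightarrow> g_op x = Exp2_Gate h \<Longrightarrow> 0 \<le> v h"
  shows "power_circuit \<Pi> pc_delta"
proof -
  have int: "v x \<in> \<int>" if "a x" for x
    using that
  proof (induction "ht x" arbitrary: x rule: less_induct)
    case less
    hence IH: "v y \<in> \<int>" if "y \<in> set (gate_inputs (g_op x))" for y
      using a_inputs[OF less.prems that] ht_inputs[OF less.prems that] by blast
    show ?case
    proof (cases "g_op x")
      case (Exp2_Gate h)
      hence "v h \<in> \<int>" "0 \<le> v h" using IH nonneg less.prems by auto
      then obtain k :: nat where "v h = real k" by (metis Ints_cases nonneg_int_cases of_int_0_le_iff of_int_of_nat_eq)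
      thus ?thesis using v_eq[OF less.prems] Exp2_Gate by (simp add: powr_realpow)
    qed (use v_eq[OF less.prems] IH in auto)
  qed
  have "\<exists>k::nat. nv s = 2 ^ k" if s: "active s" for s
  proof (cases s)
    case (One j)
    thus ?thesis using nv_One s by (intro exI[of _ 0]) auto
  next
    case (Digit x i)
    have x: "a x" "is_exp x" using active_Digit s Digit by auto
    then obtain h where h: "g_op x = Exp2_Gate h" by (cases "g_op x") auto
    hence "v h \<in> \<int>" "0 \<le> v h" using int a_inputs[OF x(1)] nonneg x by auto
    then obtain k :: nat where "v h = real k" by (metis Ints_cases nonneg_int_cases of_int_0_le_iff of_int_of_nat_eq)
    hence "nv s = 2 ^ (i + k)"
      using nv_Digit[of x i] s Digit v_eq[OF x(1)] h by (simp add: powr_realpow power_add)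
    thus ?thesis by blast
  qed
  thus ?thesis using generalized_power_circuit by (auto simp: power_circuit_def)
qed

end


section \<open>The second construction in NC2\<close>

definition gate_pos :: "nat \<Rightarrow> nat \<Rightarrow> nat" where
  "gate_pos n x = x * (2 * n + 4)"

abbreviation "input1_form n x y \<equiv> Inp (gate_pos n x + (4 + y))"
abbreviation "input2_form n x y \<equiv> Inp (gate_pos n x + (4 + n + y))"

definition plus_form :: "nat \<Rightarrow> nat \<Rightarrow> reg form" where
  "plus_form n x = Conj [Neg (Inp (gate_pos n x + 2)), Inp (gate_pos n x + 3)]"

definition minus_form :: "nat \<Rightarrow> nat \<Rightarrow> reg form" where
  "minus_form n x = Conj [Inp (gate_pos n x + 2), Neg (Inp (gate_pos n x + 3))]"

definition exp_form :: "nat \<Rightarrow> nat \<Rightarrow> reg form" where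
  "exp_form n x = Conj [Inp (gate_pos n x + 2), Inp (gate_pos n x + 3)]"

text \<open>Two's complement bits of an entry from -1 to 2: for -1 all bits are set, and 2 arises
  when both inputs of a \<open>+\<close>-gate are the same gate.\<close>

definition entry_form :: "nat \<Rightarrow> nat \<Rightarrow> nat \<Rightarrow> nat \<Rightarrow> reg form" where
  "entry_form n x y l = Disj [Conj [minus_form n x, input1_form n x y],
     if l = 0 then Disj [Conj [plus_form n x, xor2 (input1_form n x y) (input2_form n x y)],
        Conj [exp_form n x, const_form (x = y)]]
     else if l = 1 then Conj [plus_form n x, Conj [input1_form n x y, input2_form n x y]]
     else FF]"

definition entry_step :: "nat \<Rightarrow> reg step" where
  "entry_step n = (triples n Entry, \<lambda>r. case r of Entry x y l \<Rightarrow> entry_form n x y l | _ \<Rightarrow> FF)"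

definition coefficient_steps :: "nat \<Rightarrow> reg step list" where
  "coefficient_steps n = entry_step n # squaring_steps n (log_len n)"

definition prev_bit :: "nat \<Rightarrow> nat \<Rightarrow> nat \<Rightarrow> reg form" where
  "prev_bit x y l = (if l = 0 then FF else Reg (Entry x y (l - 1)))"

definition booth_form :: "bool \<Rightarrow> nat \<Rightarrow> nat \<Rightarrow> nat \<Rightarrow> reg form" where
  "booth_form neg x y l = (if neg then Conj [Neg (prev_bit x y l), Reg (Entry x y l)]
     else xor2 (prev_bit x y l) (Reg (Entry x y l)))"

fun node_form :: "nat \<Rightarrow> node \<Rightarrow> reg form" where
  "node_form n (Digit x i) = balanced Disj (map (\<lambda>g. booth_form False g x i) [0..<n])"
| "node_form n (One j) = balanced Disj (map (\<lambda>(x, i).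
     balanced Disj (map (\<lambda>g. booth_form False g x i) [0..<n])) (List.product [0..<n] [Suc j..<n]))"

text \<open>\<open>z\<close> ranges over the candidates for the input of \<open>x\<close>. The
  output conjoins this formula with the activity of \<open>Digit x i\<close>, which guarantees that
  \<open>x\<close> is a \<open>2\<^sup>x\<close>-gate.\<close>

fun delta_form :: "nat \<Rightarrow> bool \<Rightarrow> node \<Rightarrow> node \<Rightarrow> reg form" where
  "delta_form n neg (Digit x i) (One j) = const_form (\<not> neg \<and> j < i)"
| "delta_form n neg (Digit x i) (Digit y l) =
     balanced Disj (map (\<lambda>z. Conj [input1_form n x z, booth_form neg z y l]) [0..<n])"
| "delta_form n neg (One j) s = FF"

fun out_form :: "nat \<Rightarrow> bool \<Rightarrow> node \<Rightarrow> reg form" where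
  "out_form n neg (Digit y l) =
     balanced Disj (map (\<lambda>z. Conj [Inp (gate_pos n z + 1), booth_form neg z y l]) [0..<n])"
| "out_form n neg (One j) = FF"

definition node_slots :: "nat \<Rightarrow> node list" where
  "node_slots n = map One [0..<n] @ map (\<lambda>(x, i). Digit x i) (List.product [0..<n] [0..<n])"

definition node_row :: "nat \<Rightarrow> node \<Rightarrow> reg form list" where
  "node_row n s = map (\<lambda>\<phi>. Conj [node_form n s, \<phi>]) ([TT, out_form n False s, out_form n True s] @
     concat (map (\<lambda>t. [Conj [node_form n t, delta_form n False s t],
       Conj [node_form n t, delta_form n True s t]]) (node_slots n)))"

definition pc_forms :: "nat \<Rightarrow> reg form list" where
  "pc_forms n = concat (map (node_row n) (node_slots n))"

lemma distinct_node_slots: "distinct (node_slots n)"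
  by (auto simp: node_slots_def distinct_map distinct_product inj_on_def)

lemma set_node_slots:
  "s \<in> set (node_slots n) \<longleftrightarrow> (case s of One j \<Rightarrow> j < n | Digit x i \<Rightarrow> x < n \<and> i < n)"
  by (cases s) (auto simp: node_slots_def)

locale encoded_circuit = slot_gates +
  fixes w :: "bool list"
  assumes len: "length w = n * (2 * n + 4)"
    and out_bit: "x < n \<Longrightarrow> w ! (gate_pos n x + 1) = (x = out)"
    and kind_bit1: "x < n \<Longrightarrow> w ! (gate_pos n x + 2) =
      (a x \<and> (case g_op x of Minus_Gate h \<Rightarrow> True | Exp2_Gate h \<Rightarrow> True | _ \<Rightarrow> False))"
    and kind_bit2: "x < n \<Longrightarrow> w ! (gate_pos n x + 3) =
      (a x \<and> (case g_op x of Plus_Gate h k \<Rightarrow> True | Exp2_Gate h \<Rightarrow> True | _ \<Rightarrow> False))"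
    and input1_bit: "x < n \<Longrightarrow> y < n \<Longrightarrow> w ! (gate_pos n x + (4 + y)) =
      (a x \<and> (case gate_inputs (g_op x) of h # hs \<Rightarrow> y = h | _ \<Rightarrow> False))"
    and input2_bit: "x < n \<Longrightarrow> y < n \<Longrightarrow> w ! (gate_pos n x + (4 + n + y)) =
      (a x \<and> (case gate_inputs (g_op x) of h # k # hs \<Rightarrow> y = k | _ \<Rightarrow> False))"
begin

lemma gate_pos_less: "x < n \<Longrightarrow> j < 2 * n + 4 \<Longrightarrow> gate_pos n x + j < length w"
  using mult_le_mono1[of "Suc x" n "2 * n + 4"] unfolding len gate_pos_def by simp

definition e :: "reg \<Rightarrow> bool" where
  "e = run w (coefficient_steps n) (\<lambda>_. False)"

lemma eval_entry_form:
  assumes "x < n" and "y < n"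
  shows "form_eval w e' (entry_form n x y l) = bit (A x y) l"
proof -
  have inp: "form_eval w e' (Inp (gate_pos n x + j)) = w ! (gate_pos n x + j)" if "j < 2 * n + 4" for j
    unfolding form_eval.simps using gate_pos_less[OF assms(1) that] by blast
  have "form_eval w e' (Inp (gate_pos n x + 2)) = w ! (gate_pos n x + 2)"
    "form_eval w e' (Inp (gate_pos n x + 3)) = w ! (gate_pos n x + 3)"
    "form_eval w e' (input1_form n x y) = w ! (gate_pos n x + (4 + y))"
    "form_eval w e' (input2_form n x y) = w ! (gate_pos n x + (4 + n + y))"
    by (rule inp, use assms(2) in simp)+
  note bits = this[unfolded kind_bit1[OF assms(1)] kind_bit2[OF assms(1)]
      input1_bit[OF assms] input2_bit[OF assms]]
  have two: "bit (of_bool p + of_bool q :: int) l = (if l = 0 then p \<noteq> q else l = 1 \<and> p \<and> q)" for p q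
    by (cases p; cases q; cases l) (auto simp: bit_0 bit_Suc bit_1_iff)
  show ?thesis
  proof (cases "a x")
    case False
    thus ?thesis using bits
      by (simp add: entry_form_def plus_form_def minus_form_def exp_form_def A_def del: form_eval.simps(1))
  next
    case True
    show ?thesis
    proof (cases "g_op x")
      case (Plus_Gate h k)
      thus ?thesis using bits True two[of "h = y" "k = y"]
        by (auto simp: entry_form_def plus_form_def minus_form_def exp_form_def A_def simp del: form_eval.simps(1))
    next
      case (Minus_Gate h)
      thus ?thesis using bits True
        by (auto simp: entry_form_def plus_form_def minus_form_def exp_form_def A_def simp del: form_eval.simps(1))
    next
      case (Exp2_Gate h)
      thus ?thesis using bits True
        by (auto simp: entry_form_def plus_form_def minus_form_def exp_form_def A_def bit_1_iff simp del: form_eval.simps(1))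
    qed (use bits True in \<open>simp add: entry_form_def plus_form_def minus_form_def exp_form_def A_def del: form_eval.simps(1)\<close>)
  qed
qed

lemma holds_matrix_c: "holds_matrix n e c"
proof -
  have "holds_matrix n (step_env w (\<lambda>_. False) (entry_step n)) A"
    by (auto simp: holds_matrix_def step_env_def entry_step_def set_triples eval_entry_form)
  thus ?thesis unfolding e_def coefficient_steps_def c_def
    by (simp add: holds_matrix_squaring_steps)
qed

abbreviation "ev \<equiv> form_eval w e"

lemma ev_booth:
  assumes "x < n" and "y < n" and "l < n"
  shows "ev (booth_form neg x y l) = (if neg then booth (c x y) l < 0 else booth (c x y) l \<noteq> 0)"
proof -
  have "ev (prev_bit x y l) = (l > 0 \<and> bit (c x y) (l - 1))"
    using holds_matrix_c assms by (auto simp: prev_bit_def holds_matrix_def)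
  moreover have "ev (Reg (Entry x y l)) = bit (c x y) l"
    using holds_matrix_c assms by (auto simp: holds_matrix_def)
  ultimately show ?thesis by (auto simp: booth_form_def booth_nonzero booth_negative)
qed

lemma ev_node: "s \<in> set (node_slots n) \<Longrightarrow> ev (node_form n s) = active s"
proof (cases s)
  case (One j)
  have "ev (node_form n s) \<longleftrightarrow>
      (\<exists>x\<in>{0..<n}. \<exists>i\<in>{Suc j..<n}. \<exists>g\<in>{0..<n}. booth (c g x) i \<noteq> 0)"
    using One ev_booth by simp
  also have "\<dots> \<longleftrightarrow> active s"
    unfolding One active.simps by (meson Suc_le_eq atLeastLessThan_iff zero_le)
  finally show ?thesis .
qed (auto simp: set_node_slots ev_booth)

lemma ev_input1:
  assumes "x < n" and "y < n"
  shows "ev (input1_form n x y) = (a x \<and> (case gate_inputs (g_op x) of h # hs \<Rightarrow> y = h | _ \<Rightarrow> False))"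
  using input1_bit[OF assms] gate_pos_less[OF assms(1), of "4 + y"] assms(2) by simp

lemma ev_out_bit: "x < n \<Longrightarrow> ev (Inp (gate_pos n x + 1)) = (x = out)"
  using out_bit[of x] gate_pos_less[of x 1] by simp

lemma ev_delta:
  assumes "s \<in> set (node_slots n)" and "t \<in> set (node_slots n)" and "active s"
  shows "ev (delta_form n neg s t) = (if neg then delta s t < 0 else delta s t \<noteq> 0)"
proof (cases s)
  case (Digit x i)
  have x: "a x" "is_exp x" using active_Digit assms(3) Digit by auto
  then obtain h where h: "g_op x = Exp2_Gate h" by (cases "g_op x") auto
  have hn: "h < n" "x < n" using a_inputs[OF x(1), of h] h a_less x(1) by auto
  show ?thesis
  proof (cases t)
    case (One j)
    thus ?thesis using Digit by auto
  next
    case (Digit y l)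
    hence yl: "y < n" "l < n" using assms(2) by (auto simp: set_node_slots)
    have "ev (delta_form n neg s t) = (\<exists>z<n. z = h \<and> ev (booth_form neg z y l))"
      using ev_input1[OF hn(2)] x h Digit \<open>s = Digit x i\<close> by (auto simp del: form_eval.simps(1))
    also have "\<dots> = ev (booth_form neg h y l)" using hn by auto
    finally show ?thesis using ev_booth[OF hn(1) yl, of neg] Digit \<open>s = Digit x i\<close> h by simp
  qed
qed (use assms in auto)

lemma ev_out:
  assumes "s \<in> set (node_slots n)"
  shows "ev (out_form n neg s) = (if neg then out_marking s < 0 else out_marking s \<noteq> 0)"
proof (cases s)
  case (Digit y l)
  hence yl: "y < n" "l < n" using assms by (auto simp: set_node_slots)
  have out: "out < n" using out a_less by simp
  have "ev (out_form n neg s) = (\<exists>z<n. z = out \<and> ev (booth_form neg z y l))"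
    using ev_out_bit Digit by (auto simp del: form_eval.simps(1))
  also have "\<dots> = ev (booth_form neg out y l)" using out by auto
  finally show ?thesis using ev_booth[OF out yl, of neg] Digit by simp
qed simp

definition pc_slots :: "nat option list" where
  "pc_slots = map (\<lambda>s. if active s then Some (to_nat s) else None) (node_slots n)"

lemma enumerates_pc_slots: "enumerates pc_slots \<Pi>"
proof -
  have "s \<in> set (node_slots n)" if "active s" for s
    using that by (cases s) (auto simp: set_node_slots)
  hence "{s \<in> set (node_slots n). active s} = S" by auto
  thus ?thesis
    using enumerates_map_Some[OF distinct_node_slots[of n], where f = to_nat and P = active]
    by (simp add: pc_slots_def)
qed

lemma eval_pc_forms: "map ev (pc_forms n) = encode_pc pc_slots pc_delta pc_marking"
proof -
  have "map ev (node_row n s) = (case (if active s then Some (to_nat s) else None) of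
            None \<Rightarrow> replicate (2 * length pc_slots + 3) False
          | Some p \<Rightarrow> True # encode_sign (pc_marking p) @
              concat (map (\<lambda>y. encode_sign (case y of None \<Rightarrow> 0 | Some q \<Rightarrow> pc_delta p q)) pc_slots))"
    if s: "s \<in> set (node_slots n)" for s
  proof (cases "active s")
    case False
    have "map ev (node_row n s) = map (\<lambda>_. False) (node_row n s)"
      using False ev_node[OF s] by (simp add: node_row_def)
    moreover have "length (node_row n s) = 2 * length pc_slots + 3"
      unfolding node_row_def
      by (simp add: length_concat_blocks[of _ 2] pc_slots_def del: length_concat)
    ultimately show ?thesis using False by (simp add: map_replicate_const)
  next
    case True
    have "map ev (concat (map (\<lambda>t. [Conj [node_form n t, delta_form n False s t],
         Conj [node_form n t, delta_form n True s t]]) (node_slots n))) =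
        concat (map (\<lambda>t. [active t \<and> delta s t \<noteq> 0, active t \<and> delta s t < 0]) (node_slots n))"
      unfolding map_concat map_map comp_def
      by (intro arg_cong[of _ _ concat] map_cong[OF refl]) (use ev_node ev_delta[OF s _ True] in simp)
    also have "\<dots> = concat (map (\<lambda>y. encode_sign (case y of None \<Rightarrow> 0 | Some q \<Rightarrow> pc_delta (to_nat s) q)) pc_slots)"
      unfolding pc_slots_def map_map comp_def
      by (intro arg_cong[of _ _ concat] map_cong[OF refl]) (auto simp: encode_sign_def pc_delta_def)
    finally have "map ev (concat (map (\<lambda>t. [Conj [node_form n t, delta_form n False s t],
         Conj [node_form n t, delta_form n True s t]]) (node_slots n))) =
        concat (map (\<lambda>y. encode_sign (case y of None \<Rightarrow> 0 | Some q \<Rightarrow> pc_delta (to_nat s) q)) pc_slots)" .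
    moreover have "map ev (node_row n s) = map ev ([TT, out_form n False s, out_form n True s] @
     concat (map (\<lambda>t. [Conj [node_form n t, delta_form n False s t],
       Conj [node_form n t, delta_form n True s t]]) (node_slots n)))"
      unfolding node_row_def using ev_node[OF s] True by (simp only: map_map comp_def) simp
    ultimately show ?thesis
      using True ev_out[OF s] by (simp add: encode_sign_def pc_marking_def del: map_concat)
  qed
  thus ?thesis
    unfolding pc_forms_def encode_pc_def map_concat
    by (subst (2) pc_slots_def) (auto simp: comp_def intro!: arg_cong[of _ _ concat])
qed

end

section \<open>Depth and size of the second construction\<close>

lemma nc_bound_booth_form: "nc_bound 4 (booth_form neg x y l)"
  by (auto simp: booth_form_def prev_bit_def xor2_def)

lemma nc_bound_digit_disj:
  "nc_bound (log_len n + 5) (balanced Disj (map (\<lambda>g. booth_form neg g x i) [0..<n]))"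
  by (rule nc_bound_balanced[of _ "log_len n" 4])
     (use less_log_len[of n] nc_bound_booth_form in auto)

lemma nc_bound_select:
  "nc_bound (log_len n + 6) (balanced Disj (map (\<lambda>z. Conj [Inp (p z), booth_form neg z y l]) [0..<n]))"
  by (rule nc_bound_balanced[of _ "log_len n" 5])
     (use less_log_len[of n] nc_bound_booth_form in auto)

text \<open>\<open>One j\<close> is the worst case: the disjunction over pairs contributes
  \<open>2 * log_len n\<close> and the inner one over \<open>g\<close> another
  \<open>log_len n\<close>.\<close>

lemma nc_bound_node_form: "nc_bound (3 * log_len n + 6) (node_form n s)"
proof (cases s)
  case (One j)
  have "n * (n - Suc j) \<le> 2 ^ log_len n * 2 ^ log_len n"
    using less_log_len[of n] by (intro mult_le_mono) auto
  also have "\<dots> = 2 ^ (2 * log_len n)" by (metis mult_2 power_add)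
  finally have "n * (n - Suc j) \<le> 2 ^ (2 * log_len n)" .
  thus ?thesis unfolding One node_form.simps
    by (intro nc_bound_balanced[of _ "2 * log_len n" "log_len n + 5"])
       (use nc_bound_digit_disj in auto)
next
  case (Digit x i)
  show ?thesis unfolding Digit node_form.simps
    by (rule form_bound_mono[OF nc_bound_digit_disj]) simp
qed

lemma nc_bound_delta_form: "nc_bound (3 * log_len n + 6) (delta_form n neg s t)"
  using form_bound_mono[OF nc_bound_select, of n "3 * log_len n + 6"]
  by (cases "(n, neg, s, t)" rule: delta_form.cases) auto

lemma nc_bound_out_form: "nc_bound (3 * log_len n + 6) (out_form n neg s)"
  using form_bound_mono[OF nc_bound_select, of n "3 * log_len n + 6"] by (cases s) auto

lemma nc_bound_pc_forms:
  assumes "\<phi> \<in> set (pc_forms n)"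
  shows "nc_bound (3 * log_len n + 8) \<phi>"
proof -
  define d where "d = 3 * log_len n + 6"
  have d: "nc_bound d (node_form n s)" "nc_bound d (out_form n neg s)" "nc_bound d (delta_form n neg s t)"
    for s t neg
    unfolding d_def by (rule nc_bound_node_form nc_bound_out_form nc_bound_delta_form)+
  have Suc_d: "nc_bound (Suc d) (node_form n s)" "nc_bound (Suc d) (out_form n neg s)" for s neg
    by (rule form_bound_mono[OF d(1)] form_bound_mono[OF d(2)], simp)+
  obtain s \<psi> where \<phi>: "\<phi> = Conj [node_form n s, \<psi>]"
    and \<psi>: "\<psi> \<in> {TT, out_form n False s, out_form n True s} \<or>
      (\<exists>t neg. \<psi> = Conj [node_form n t, delta_form n neg s t])"
    using assms by (auto simp: pc_forms_def node_row_def)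
  have "nc_bound (Suc d) \<psi>"
    using \<psi> d Suc_d by auto
  hence "nc_bound (Suc (Suc d)) \<phi>" using Suc_d by (simp add: \<phi>)
  thus ?thesis by (simp add: d_def add.commute)
qed

lemma length_pc_forms: "length (pc_forms n) \<le> 5 * (n + 1) ^ 4"
proof -
  let ?m = "length (node_slots n)"
  have "length (node_row n s) = 2 * ?m + 3" for s
    unfolding node_row_def by (simp add: length_concat_blocks[of _ 2] del: length_concat)
  hence "length (pc_forms n) = ?m * (2 * ?m + 3)"
    unfolding pc_forms_def by (subst length_concat_blocks[of _ "2 * ?m + 3"]) auto
  also have m: "?m = n + n * n"
    by (simp add: node_slots_def)
  hence "?m * (2 * ?m + 3) \<le> (n + 1)\<^sup>2 * (2 * (n + 1)\<^sup>2 + 3 * (n + 1)\<^sup>2)"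
    by (intro mult_le_mono add_le_mono) (auto simp: power2_eq_square)
  also have "\<dots> = 5 * ((n + 1)\<^sup>2 * (n + 1)\<^sup>2)" by (simp del: power2_sum)
  also have "\<dots> = 5 * (n + 1) ^ 4" by (simp only: flip: power_add) simp
  finally show ?thesis .
qed

lemma step_bound_mono: "step_bound f b d q st \<Longrightarrow> d \<le> d' \<Longrightarrow> step_bound f b d' q st"
  by (auto simp: step_bound_def intro: form_bound_mono)

lemma step_bound_entry_step: "step_bound 2 False 8 (2 * n ^ 3) (entry_step n)"
  by (auto simp: step_bound_def entry_step_def set_triples power3_eq_cube entry_form_def
      plus_form_def minus_form_def exp_form_def xor2_def)

lemma step_bound_coefficient_steps:
  assumes "st \<in> set (coefficient_steps n)"
  shows "step_bound 2 False (24 * log_len n + 9) (2 * n ^ 3) st"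
proof -
  have "set (squaring_steps n s) \<subseteq> {product_step n, add_step n}" for s
    by (induction s) auto
  hence "st \<in> {entry_step n, product_step n, add_step n}"
    using assms by (auto simp: coefficient_steps_def)
  thus ?thesis
    using step_bound_mono[OF step_bound_entry_step[of n], of "24 * log_len n + 9"]
      step_bound_mono[OF step_bound_product_step[of n], of "24 * log_len n + 9"]
      step_bound_mono[OF step_bound_add_step[of n], of "24 * log_len n + 9"]
    by auto
qed

lemma length_squaring_steps: "length (squaring_steps n s) = 2 * s"
  by (induction s) auto

lemma log_len_bounds: "1 \<le> log_len n" "2 ^ log_len n \<le> 2 * (n + 1)" "log_len n \<le> 2 * (n + 1)"
proof -
  show "1 \<le> log_len n" by (simp add: log_len_def)
  show *: "2 ^ log_len n \<le> 2 * (n + 1)"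
    using floor_log_exp2_le[of n] by (cases "n = 0") (auto simp: log_len_def)
  show "log_len n \<le> 2 * (n + 1)"
    using less_exp[of "log_len n"] * by linarith
qed

text \<open>The base \<open>5 = 2 * 2 + 1\<close> is the cost per level at fan-in 2. Via
  \<open>8 ^ (33 * log_len n) = (2 ^ log_len n) ^ 99\<close> the power becomes polynomial of degree
  99; the number of formulas, cubic per step times a logarithm, and the number of outputs add degree
  4.\<close>

lemma size_estimate:
  assumes "q \<le> 5 * (n + 1) ^ 4"
  shows "n * (2 * n + 4) + 1 + ((2 * log_len n + 1) * (2 * n ^ 3) + q) * (2 * 2 + 1) ^ (24 * log_len n + 9) + q
    \<le> 2 ^ 105 * (n + 1) ^ 103"
proof -
  define m where "m = n + 1"
  have m: "1 \<le> m" by (simp add: m_def)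
  have "(5::nat) ^ (24 * log_len n + 9) \<le> 8 ^ (33 * log_len n)"
  proof -
    have "(5::nat) ^ (24 * log_len n + 9) \<le> 8 ^ (24 * log_len n + 9)" by (rule power_mono) auto
    also have "\<dots> \<le> 8 ^ (33 * log_len n)" using log_len_bounds(1)[of n] by (intro power_increasing) auto
    finally show ?thesis .
  qed
  also have "(8::nat) ^ (33 * log_len n) = (2 ^ log_len n) ^ 99"
  proof -
    have "(8::nat) ^ (33 * log_len n) = (2 ^ 3) ^ (33 * log_len n)" by simp
    also have "\<dots> = 2 ^ (log_len n * 99)" by (simp only: power_mult[symmetric]) (simp add: mult.commute)
    also have "\<dots> = (2 ^ log_len n) ^ 99" by (rule power_mult)
    finally show ?thesis .
  qed
  also have "\<dots> \<le> (2 * m) ^ 99" using log_len_bounds(2)[of n] unfolding m_def by (rule power_mono) simp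
  finally have 5: "(5::nat) ^ (24 * log_len n + 9) \<le> 2 ^ 99 * m ^ 99" by (simp only: power_mult_distrib)
  have "2 * log_len n + 1 \<le> 6 * m" using log_len_bounds[of n] unfolding m_def by linarith
  moreover have "2 * n ^ 3 \<le> 2 * m ^ 3" unfolding m_def by (intro mult_le_mono2 power_mono) auto
  ultimately have "(2 * log_len n + 1) * (2 * n ^ 3) \<le> (6 * m) * (2 * m ^ 3)" by (rule mult_le_mono)
  also have "\<dots> = 12 * m ^ 4" by (simp add: power4_eq_xxxx power3_eq_cube)
  finally have "(2 * log_len n + 1) * (2 * n ^ 3) + q \<le> 17 * m ^ 4" using assms by (simp add: m_def)
  hence "((2 * log_len n + 1) * (2 * n ^ 3) + q) * 5 ^ (24 * log_len n + 9) \<le> (17 * m ^ 4) * (2 ^ 99 * m ^ 99)"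
    using 5 by (rule mult_le_mono)
  also have "\<dots> = 17 * 2 ^ 99 * m ^ 103" by (simp flip: power_add)
  finally have 1: "((2 * log_len n + 1) * (2 * n ^ 3) + q) * 5 ^ (24 * log_len n + 9) \<le> 17 * 2 ^ 99 * m ^ 103" .
  have "n * (2 * n + 4) + 1 \<le> 2 * m\<^sup>2" by (simp add: m_def power2_eq_square algebra_simps)
  also have "\<dots> \<le> 2 * m ^ 103" using m by (intro mult_le_mono2 power_increasing) auto
  finally have 2: "n * (2 * n + 4) + 1 \<le> 2 * m ^ 103" .
  have "5 * m ^ 4 \<le> 5 * m ^ 103" using m by (intro mult_le_mono2 power_increasing) auto
  hence 3: "q \<le> 5 * m ^ 103" using assms by (simp add: m_def)
  have "n * (2 * n + 4) + 1 + ((2 * log_len n + 1) * (2 * n ^ 3) + q) * 5 ^ (24 * log_len n + 9) + q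
      \<le> 2 * m ^ 103 + 17 * 2 ^ 99 * m ^ 103 + 5 * m ^ 103"
    using 1 2 3 by (intro add_mono)
  also have "\<dots> = (2 + 17 * 2 ^ 99 + 5) * m ^ 103" by (simp only: distrib_right)
  also have "\<dots> \<le> 2 ^ 105 * m ^ 103" by (rule mult_le_mono1) simp
  finally show ?thesis by (simp add: m_def)
qed

lemma pc_forms_in_NC2:
  "\<exists>F. in_NC2 F \<and> (\<forall>n w. length w = n * (2 * n + 4) \<longrightarrow>
     F w = map (form_eval w (run w (coefficient_steps n) (\<lambda>_. False))) (pc_forms n))"
proof -
  let ?len = "\<lambda>n::nat. n * (2 * n + 4)"
  let ?ev = "\<lambda>n w. form_eval w (run w (coefficient_steps n) (\<lambda>_. False))"
  have "\<exists>B. wf_bcircuit (?len n) B \<and>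
      (\<forall>w. length w = ?len n \<longrightarrow> bcircuit_eval B w = map (?ev n w) (pc_forms n)) \<and>
      bcircuit_depth B \<le> 133 * (floor_log n + 1)\<^sup>2 \<and>
      bcircuit_size B \<le> 2 ^ 105 * (n + 1) ^ 103 \<and>
      (\<forall>g\<in>set (fst B). bounded_fanin_gate g)" for n
  proof -
    let ?L = "log_len n" and ?q = "length (pc_forms n)"
    have len: "length (coefficient_steps n) = 2 * ?L + 1"
      by (simp add: coefficient_steps_def length_squaring_steps)
    have "\<forall>\<phi>\<in>set (pc_forms n). nc_bound (24 * ?L + 9) \<phi>"
      using form_bound_mono[OF nc_bound_pc_forms] by auto
    from compile_program[OF _ this, where ps = "coefficient_steps n" and q = "2 * n ^ 3" and n = "?len n"]
      step_bound_coefficient_steps[of _ n]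
    obtain B where B: "wf_bcircuit (?len n) B"
      "\<forall>w. length w = ?len n \<longrightarrow> bcircuit_eval B w = map (?ev n w) (pc_forms n)"
      "bcircuit_depth B \<le> 1 + (2 * ?L + 1 + 1) * (24 * ?L + 9)"
      "bcircuit_size B \<le> ?len n + 1 +
         ((2 * ?L + 1) * (2 * n ^ 3) + ?q) * (2 * 2 + 1) ^ (24 * ?L + 9) + ?q"
      "\<forall>g\<in>set (fst B). length (bgate_args g) \<le> 2 \<and> (is_maj g \<longrightarrow> False)"
      unfolding len by (metis one_le_numeral)
    \<comment> \<open>Two steps per squaring, one for the matrix and one round for the outputs are
      at most \<open>4 * ?L\<close> rounds, each of depth at most \<open>33 * ?L\<close>; thus
      \<open>133 = 1 + 4 * 33\<close>.\<close>
    have "1 + (2 * ?L + 1 + 1) * (24 * ?L + 9) \<le> 1 * (?L * ?L) + (4 * ?L) * (33 * ?L)"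
      using log_len_bounds(1)[of n] by (intro add_mono mult_le_mono) auto
    also have "\<dots> = 133 * ?L\<^sup>2" by (simp add: power2_eq_square)
    finally have "bcircuit_depth B \<le> 133 * (floor_log n + 1)\<^sup>2" using B(3) by (simp add: log_len_def)
    moreover have "bcircuit_size B \<le> 2 ^ 105 * (n + 1) ^ 103"
      using B(4) size_estimate[OF length_pc_forms] by (rule order_trans)
    moreover have "bounded_fanin_gate g" if "g \<in> set (fst B)" for g
      using B(5) that by (cases g) auto
    ultimately show ?thesis using B(1,2) by blast
  qed
  then obtain B where B: "\<And>n. wf_bcircuit (?len n) (B n)"
    "\<And>n w. length w = ?len n \<Longrightarrow> bcircuit_eval (B n) w = map (?ev n w) (pc_forms n)"
    "\<And>n. bcircuit_depth (B n) \<le> 133 * (floor_log n + 1)\<^sup>2"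
    "\<And>n. bcircuit_size (B n) \<le> 2 ^ 105 * (n + 1) ^ 103"
    "\<And>n g. g \<in> set (fst (B n)) \<Longrightarrow> bounded_fanin_gate g"
    by metis
  have "strict_mono ?len" by (intro strict_monoI mult_strict_mono') auto
  hence "inj ?len" by (rule strict_mono_imp_inj_on)
  from in_NC2_slot_family[OF this _ B(1,4,3,5)] B(2) show ?thesis by fastforce
qed


section \<open>Correctness of the second construction\<close>

lemma length_encode_gate_op: "length (encode_gate_op xs g) = 2 * length xs + 2"
  by (cases g) (auto simp: unit_vector_def zero_vector_def)

lemma encode_gate_op_nth:
  shows "encode_gate_op xs g ! 0 = (case g of Minus_Gate h \<Rightarrow> True | Exp2_Gate h \<Rightarrow> True | _ \<Rightarrow> False)"
    and "encode_gate_op xs g ! 1 = (case g of Plus_Gate h k \<Rightarrow> True | Exp2_Gate h \<Rightarrow> True | _ \<Rightarrow> False)"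
    and "y < length xs \<Longrightarrow> encode_gate_op xs g ! (2 + y) =
      (case gate_inputs g of h # hs \<Rightarrow> xs ! y = Some h | _ \<Rightarrow> False)"
    and "y < length xs \<Longrightarrow> encode_gate_op xs g ! (2 + length xs + y) =
      (case gate_inputs g of h # k # hs \<Rightarrow> xs ! y = Some k | _ \<Rightarrow> False)"
  by (cases g; simp add: unit_vector_def zero_vector_def nth_append)+

lemma encode_circuit_nth:
  fixes xs :: "'g option list"
  assumes "i < length xs"
  defines "n \<equiv> length xs"
  shows "length (encode_circuit xs C) = n * (2 * n + 4)"
    and "encode_circuit xs C ! (i * (2 * n + 4) + 1) = (case xs ! i of None \<Rightarrow> False | Some g \<Rightarrow> g = out_gate C)"
    and "j < 2 * n + 2 \<Longrightarrow> encode_circuit xs C ! (i * (2 * n + 4) + (2 + j)) =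
      (case xs ! i of None \<Rightarrow> False | Some g \<Rightarrow> encode_gate_op xs (gate_op C g) ! j)"
proof -
  define blk where "blk x = (case x of None \<Rightarrow> replicate (2 * length xs + 4) False
     | Some g \<Rightarrow> True # (g = out_gate C) # encode_gate_op xs (gate_op C g))" for x
  have enc: "encode_circuit xs C = concat (map blk xs)"
    unfolding encode_circuit_def blk_def ..
  have len: "length (blk x) = 2 * n + 4" for x
    by (auto simp: blk_def length_encode_gate_op n_def split: option.split)
  show "length (encode_circuit xs C) = n * (2 * n + 4)"
    unfolding enc by (subst length_concat_blocks[of _ "2 * n + 4"]) (auto simp: len n_def)
  have nth: "encode_circuit xs C ! (i * (2 * n + 4) + j) = blk (xs ! i) ! j" if "j < 2 * n + 4" for j
    unfolding enc using assms that by (subst nth_concat_blocks) (auto simp: len)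
  have blk1: "blk x ! 1 = (case x of None \<Rightarrow> False | Some g \<Rightarrow> g = out_gate C)" for x
    by (cases x) (auto simp: blk_def)
  have blk2: "blk x ! (2 + j) = (case x of None \<Rightarrow> False | Some g \<Rightarrow> encode_gate_op xs (gate_op C g) ! j)"
    if "j < 2 * n + 2" for x j
    using that by (cases x) (auto simp: blk_def n_def)
  show "encode_circuit xs C ! (i * (2 * n + 4) + 1) = (case xs ! i of None \<Rightarrow> False | Some g \<Rightarrow> g = out_gate C)"
    using nth[of 1] unfolding blk1 by simp
  assume j: "j < 2 * n + 2"
  hence "2 + j < 2 * n + 4" by simp
  from nth[OF this] show "encode_circuit xs C ! (i * (2 * n + 4) + (2 + j)) =
      (case xs ! i of None \<Rightarrow> False | Some g \<Rightarrow> encode_gate_op xs (gate_op C g) ! j)"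
    unfolding blk2[OF j] .
qed

lemma pc_forms_correct:
  fixes C :: "'g circuit" and xs :: "'g option list"
  assumes C: "circuit C" and xs: "enumerates xs (gates C)"
  shows "\<exists>(\<Pi> :: nat set) \<delta> M ys.
             generalized_power_circuit \<Pi> \<delta> \<and> marking \<Pi> M \<and> enumerates ys \<Pi> \<and>
             map (form_eval (encode_circuit xs C)
               (run (encode_circuit xs C) (coefficient_steps (length xs)) (\<lambda>_. False)))
               (pc_forms (length xs)) = encode_pc ys \<delta> M \<and>
             circuit_eval C = marking_eval \<Pi> \<delta> M \<and>
             pc_depth \<Pi> \<delta> \<le> circuit_depth_exp2 C \<and>
             card \<Pi> \<le> (circuit_size C)\<^sup>2 + circuit_size C \<and>
             ((\<forall>g\<in>gates C. \<forall>h. gate_op C g = Exp2_Gate h \<longrightarrow> 0 \<le> gate_eval C h) \<longrightarrow>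
                power_circuit \<Pi> \<delta>)"
proof -
  let ?V = "gates C" and ?E = "circuit_edges C"
  define n where "n = length xs"
  define P where "P x = the (xs ! x)" for x
  define a where "a x = (x < n \<and> xs ! x \<noteq> None)" for x
  have fin: "finite ?V" and acyc: "acyclic ?E" and sub: "?E \<subseteq> ?V \<times> ?V"
    and closed: "\<And>g h. g \<in> ?V \<Longrightarrow> h \<in> set (gate_inputs (gate_op C g)) \<Longrightarrow> h \<in> ?V"
    and out_V: "out_gate C \<in> ?V"
    using C by (auto simp: circuit_def circuit_edges_def)
  have P: "P x \<in> ?V" "xs ! x = Some (P x)" if "a x" for x
  proof -
    show *: "xs ! x = Some (P x)" using that by (auto simp: a_def P_def)
    show "P x \<in> ?V" using enumerates_set[OF xs, of "P x"] * that nth_mem[of x xs] by (simp add: n_def a_def)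
  qed
  have "\<exists>x. a x \<and> P x = g" if "g \<in> ?V" for g
    using that enumerates_set[OF xs, of g] by (force simp: in_set_conv_nth n_def a_def P_def)
  \<comment> \<open>\<open>pos\<close> inverts \<open>P\<close> and renames each gate to its slot,
    which turns \<open>C\<close> into a circuit on slot numbers.\<close>
  then obtain pos where pos: "\<And>g. g \<in> ?V \<Longrightarrow> a (pos g) \<and> P (pos g) = g" by metis
  have pos_eq: "xs ! y = Some g \<longleftrightarrow> y = pos g" if "y < n" "g \<in> ?V" for y g
    using enumerates_inj[OF xs, of y "pos g" g] pos[OF that(2)] P(2)[of "pos g"] that
    by (auto simp: a_def n_def)
  define g_op where "g_op x = map_gate_op pos (gate_op C (P x))" for x
  obtain H :: "'g \<Rightarrow> nat" where H: "\<And>x y. (x, y) \<in> ?E \<Longrightarrow> 1 + H y \<le> H x"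
    "\<And>x. x \<in> ?V \<Longrightarrow> \<exists>p. dag_path ?V ?E p \<and> hd p = x \<and> H x = sum_list (map (\<lambda>_. 1) p)"
    "\<And>x. x \<in> ?V \<Longrightarrow> 1 \<le> H x"
    by (rule dag_height[OF fin acyc sub, where wt = "\<lambda>_. 1"]) blast
  let ?wt = "\<lambda>g. of_bool (is_exp2_gate (gate_op C g)) :: nat"
  obtain X :: "'g \<Rightarrow> nat" where X: "\<And>x y. (x, y) \<in> ?E \<Longrightarrow> ?wt x + X y \<le> X x"
    "\<And>x. x \<in> ?V \<Longrightarrow> \<exists>p. dag_path ?V ?E p \<and> hd p = x \<and> X x = sum_list (map ?wt p)"
    "\<And>x. x \<in> ?V \<Longrightarrow> ?wt x \<le> X x"
    by (rule dag_height[OF fin acyc sub, where wt = ?wt]) blast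
  have input: "\<exists>h\<in>?V. y = pos h \<and> (P x, h) \<in> ?E \<and> P y = h" if "a x" "y \<in> set (gate_inputs (g_op x))" for x y
    using that P(1)[of x] closed pos by (auto simp: g_op_def circuit_edges_def)
  have card_a: "card {x. a x} = card ?V"
    using bij_betw_same_card[OF enumerates_bij_betw[OF xs]] by (simp add: n_def a_def)
  interpret encoded_circuit n a g_op "pos (out_gate C)" "\<lambda>x. gate_eval C (P x)"
    "\<lambda>x. H (P x) - 1" "\<lambda>x. X (P x)" "card ?V" "circuit_depth_exp2 C" "encode_circuit xs C"
  proof unfold_locales
    show "x < n" if "a x" for x using that by (simp add: a_def)
    show "card {x. a x} = card ?V" by (rule card_a)
    show "a (pos (out_gate C))" using pos[OF out_V] by simp
    show "a y" if "a x" "y \<in> set (gate_inputs (g_op x))" for x y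
      using input[OF that] pos by metis
    show "H (P y) - 1 < H (P x) - 1" if xy: "a x" "y \<in> set (gate_inputs (g_op x))" for x y
    proof -
      obtain h where "h \<in> ?V" "(P x, h) \<in> ?E" "P y = h" using input[OF xy] by blast
      thus ?thesis using H(1)[of "P x" h] H(3)[of h] by simp
    qed
    show "of_bool (is_exp2_gate (g_op x)) + X (P y) \<le> X (P x)"
      if xy: "a x" "y \<in> set (gate_inputs (g_op x))" for x y
    proof -
      obtain h where "(P x, h) \<in> ?E" "P y = h" using input[OF xy] by blast
      thus ?thesis using X(1)[of "P x" h] by (simp add: g_op_def)
    qed
    show "X (P x) \<le> circuit_depth_exp2 C" if "a x" for x
    proof -
      have "P x \<in> ?V" using P(1) that .
      then obtain p where p: "dag_path ?V ?E p" "X (P x) = sum_list (map ?wt p)" using X(2) by blast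
      thus ?thesis
        using le_Sup_dag_paths[OF fin acyc p(1), of "\<lambda>p. length (filter (\<lambda>g. is_exp2_gate (gate_op C g)) p)"]
        by (simp add: circuit_depth_exp2_def length_filter_eq_sum)
    qed
    show "H (P x) - 1 < card ?V" if "a x" for x
    proof -
      have x: "P x \<in> ?V" using P(1) that .
      then obtain p where p: "dag_path ?V ?E p" "H (P x) = sum_list (map (\<lambda>_. 1) p)" using H(2) by blast
      \<comment> \<open>A path repeats no gate, so it has at most as many vertices as there are
        gates, and strictly fewer edges.\<close>
      have "length p = card (set p)" using dag_path_distinct[OF acyc p(1)] by (simp add: distinct_card)
      also have "\<dots> \<le> card ?V" using p(1) fin by (intro card_mono) (auto simp: dag_path_def)
      finally show ?thesis using p(2) H(3)[OF x] by (simp add: sum_list_triv)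
    qed
    show "gate_eval C (P x) = (case g_op x of Zero_Gate \<Rightarrow> 0
            | Plus_Gate h k \<Rightarrow> gate_eval C (P h) + gate_eval C (P k)
            | Minus_Gate h \<Rightarrow> - gate_eval C (P h)
            | Exp2_Gate h \<Rightarrow> 2 powr gate_eval C (P h))" if "a x" for x
    proof -
      have x: "P x \<in> ?V" using P(1) that .
      have "P (pos h) = h" if "h \<in> set (gate_inputs (gate_op C (P x)))" for h
        using closed[OF x that] pos by blast
      thus ?thesis using gate_eval_eq[OF C x] by (cases "gate_op C (P x)") (auto simp: g_op_def)
    qed
    show "length (encode_circuit xs C) = n * (2 * n + 4)"
      using encode_circuit_nth(1)[of 0 xs C] by (cases "xs = []") (auto simp: n_def encode_circuit_def)
    fix x assume x: "x < n"
    note nth = encode_circuit_nth(2,3)[OF x[unfolded n_def], where C = C, folded n_def gate_pos_def]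
    have case_a: "(case xs ! x of None \<Rightarrow> False | Some g \<Rightarrow> Q g) = (a x \<and> Q (P x))" for Q
      using x by (auto simp: a_def P_def split: option.split)
    show "encode_circuit xs C ! (gate_pos n x + 1) = (x = pos (out_gate C))"
      using nth(1) pos_eq[OF x out_V] by (auto split: option.split)
    show "encode_circuit xs C ! (gate_pos n x + 2) =
      (a x \<and> (case g_op x of Minus_Gate h \<Rightarrow> True | Exp2_Gate h \<Rightarrow> True | _ \<Rightarrow> False))"
      using nth(2)[of 0] unfolding case_a encode_gate_op_nth
      by (cases "gate_op C (P x)") (auto simp: g_op_def)
    have "encode_circuit xs C ! (gate_pos n x + (2 + 1)) =
      (a x \<and> (case g_op x of Plus_Gate h k \<Rightarrow> True | Exp2_Gate h \<Rightarrow> True | _ \<Rightarrow> False))"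
      using nth(2)[of 1] unfolding case_a encode_gate_op_nth
      by (cases "gate_op C (P x)") (auto simp: g_op_def)
    thus "encode_circuit xs C ! (gate_pos n x + 3) =
      (a x \<and> (case g_op x of Plus_Gate h k \<Rightarrow> True | Exp2_Gate h \<Rightarrow> True | _ \<Rightarrow> False))"
      by simp
    fix y assume y: "y < n"
    have pos_add: "2 + (2 + y) = 4 + y" "2 + (2 + n + y) = 4 + n + y" by simp_all
    have inputs: "xs ! y = Some h \<longleftrightarrow> y = pos h"
      if "a x" "h \<in> set (gate_inputs (gate_op C (P x)))" for h
      by (rule pos_eq[OF y closed[OF P(1)[OF that(1)] that(2)]])
    have "encode_circuit xs C ! (gate_pos n x + (2 + (2 + y))) =
      (a x \<and> (case gate_inputs (gate_op C (P x)) of h # hs \<Rightarrow> xs ! y = Some h | _ \<Rightarrow> False))"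
      using nth(2)[of "2 + y"] encode_gate_op_nth(3)[of y xs "gate_op C (P x)"] y
      unfolding case_a n_def by simp
    also have "\<dots> = (a x \<and> (case gate_inputs (g_op x) of h # hs \<Rightarrow> y = h | _ \<Rightarrow> False))"
      using inputs by (cases "gate_op C (P x)") (auto simp: g_op_def)
    finally show "encode_circuit xs C ! (gate_pos n x + (4 + y)) =
      (a x \<and> (case gate_inputs (g_op x) of h # hs \<Rightarrow> y = h | _ \<Rightarrow> False))" 
      by (simp only: pos_add)
    have "encode_circuit xs C ! (gate_pos n x + (2 + (2 + n + y))) =
      (a x \<and> (case gate_inputs (gate_op C (P x)) of h # k # hs \<Rightarrow> xs ! y = Some k | _ \<Rightarrow> False))"
      using nth(2)[of "2 + n + y"] encode_gate_op_nth(4)[of y xs "gate_op C (P x)"] y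
      unfolding case_a n_def by simp
    also have "\<dots> = (a x \<and> (case gate_inputs (g_op x) of h # k # hs \<Rightarrow> y = k | _ \<Rightarrow> False))"
      using inputs by (cases "gate_op C (P x)") (auto simp: g_op_def)
    finally show "encode_circuit xs C ! (gate_pos n x + (4 + n + y)) =
      (a x \<and> (case gate_inputs (g_op x) of h # k # hs \<Rightarrow> y = k | _ \<Rightarrow> False))" 
      by (simp only: pos_add)
  qed
  have "power_circuit \<Pi> pc_delta"
    if nonneg: "\<forall>g\<in>gates C. \<forall>h. gate_op C g = Exp2_Gate h \<longrightarrow> 0 \<le> gate_eval C h"
  proof (rule power_circuit)
    fix x h assume x: "a x" "g_op x = Exp2_Gate h"
    then obtain k where k: "gate_op C (P x) = Exp2_Gate k" "h = pos k"
      by (cases "gate_op C (P x)") (auto simp: g_op_def)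
    hence "P h = k" using closed[OF P(1)[OF x(1)], of k] pos by auto
    thus "0 \<le> gate_eval C (P h)" using nonneg P(1)[OF x(1)] k by auto
  qed
  moreover have "circuit_eval C = marking_eval \<Pi> pc_delta pc_marking"
    using eval pos[OF out_V] by (simp add: circuit_eval_def)
  ultimately show ?thesis
    using generalized_power_circuit marking enumerates_pc_slots eval_pc_forms[unfolded e_def] depth card_\<Pi>
    unfolding n_def[symmetric] circuit_size_def by blast
qed


section \<open>Both translations with their size, depth and complexity bounds\<close>

theorem proposition30:
  shows
    "(\<exists>F. in_TC0 F \<and>
       (\<forall>(\<Pi> :: 'a set) \<delta> M xs.
          power_circuit \<Pi> \<delta> \<and> marking \<Pi> M \<and> enumerates xs \<Pi> \<longrightarrow>
          (\<exists>(C :: nat circuit) ys.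
             circuit C \<and> enumerates ys (gates C) \<and>
             F (encode_pc xs \<delta> M) = encode_circuit ys C \<and>
             circuit_eval C = marking_eval \<Pi> \<delta> M \<and>
             circuit_size C \<le> 2 * card (pc_edges \<Pi> \<delta>) + 3 * card \<Pi> + 1 \<and>
             circuit_depth C \<le> (pc_depth \<Pi> \<delta> + 2) * (nat \<lceil>log 2 (real (card \<Pi>))\<rceil> + 2) \<and>
             (\<Pi> \<noteq> {} \<longrightarrow> circuit_depth_exp2 C = pc_depth \<Pi> \<delta> + 1))))
     \<and>
     (\<exists>F. in_NC2 F \<and>
       (\<forall>(C :: 'g circuit) xs.
          circuit C \<and> enumerates xs (gates C) \<longrightarrow>
          (\<exists>(\<Pi> :: nat set) \<delta> M ys.
             generalized_power_circuit \<Pi> \<delta> \<and> marking \<Pi> M \<and> enumerates ys \<Pi> \<and>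
             F (encode_circuit xs C) = encode_pc ys \<delta> M \<and>
             circuit_eval C = marking_eval \<Pi> \<delta> M \<and>
             pc_depth \<Pi> \<delta> \<le> circuit_depth_exp2 C \<and>
             card \<Pi> \<le> (circuit_size C)\<^sup>2 + circuit_size C \<and>
             ((\<forall>g\<in>gates C. \<forall>h. gate_op C g = Exp2_Gate h \<longrightarrow> 0 \<le> gate_eval C h) \<longrightarrow>
                power_circuit \<Pi> \<delta>))))"
proof (rule conjI, goal_cases)
  case 1
  obtain F where F: "in_TC0 F" "\<And>n w. length w = n * (2 * n + 3) \<Longrightarrow>
     F w = map (form_eval w (\<lambda>_. False)) (circuit_forms n)"
    using circuit_forms_in_TC0 by blast
  have "F (encode_pc xs \<delta> M) =
      map (form_eval (encode_pc xs \<delta> M) (\<lambda>_. False)) (circuit_forms (length xs))"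
    for xs :: "'a option list" and \<delta> M
    using encode_pc_nth(1)[of 0 xs \<delta> M] by (intro F(2)) (cases "xs = []"; simp add: encode_pc_def)
  with F(1) circuit_forms_correct show ?case by (intro exI[of _ F]) (simp only: simp_thms, blast)
next
  case 2
  obtain F where F: "in_NC2 F" "\<And>n w. length w = n * (2 * n + 4) \<Longrightarrow>
     F w = map (form_eval w (run w (coefficient_steps n) (\<lambda>_. False))) (pc_forms n)"
    using pc_forms_in_NC2 by blast
  have "F (encode_circuit xs C) = map (form_eval (encode_circuit xs C)
      (run (encode_circuit xs C) (coefficient_steps (length xs)) (\<lambda>_. False))) (pc_forms (length xs))"
    for xs and C :: "'g circuit"
    using encode_circuit_nth(1)[of 0 xs C] by (intro F(2)) (cases "xs = []"; simp add: encode_circuit_def)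
  with F(1) pc_forms_correct show ?case by (intro exI[of _ F]) (simp only: simp_thms, blast)
qed

end
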